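(* Let $r\ge 1$. There exist constants $c_1,c_2>0$, independent of $n$ and of $F$, such that for any $(f,\theta^* )\in\mathbb{F}(\beta_0,M)\times\mathbb{S}^1$, with $F(x)=f(x^\top\theta^* )$, and any $n\ge n_0\vee n_1$, $$\mathcal R^{(n)}_{r,t}\big(\widehat F_{(\hat\theta,\hat h)},F\big)\le c_1\left[\frac{\ln(n)}{n\,h^*_{\mathcal K,f}(t^\top\theta^* )}\right]^{1/2}+c_2\,n^{-1/2}\qquad\forall t\in[-1/2,1/2]^2 .$$
   Context: **Model.** One observes $(X_1,Y_1),\dots,(X_n,Y_n)\in\mathbb{R}^2\times\mathbb{R}$ with $Y_i=F(X_i)+\varepsilon_i$, where $F(x)=f(x^\top\theta^* )$ with unknown $f:\mathbb{R}\to\mathbb{R}$ and unknown $\theta^*\in\mathbb{S}^1$ (unit sphere of $\mathbb{R}^2$). The $X_i$ are i.i.d. with known Lebesgue density $g$, the $\varepsilon_i$ are i.i.d. centered, and the sequences $(X_i)$, $(\varepsilon_i)$ are independent. $\mathbb{E}^{(n)}_F$ is expectation under the law of $\{(X_i,Y_i)\}_{i=1}^n$. The pointwise risk of an estimator $\widehat F$ at $t$ is $\mathcal R^{(n)}_{r,t}(\widehat F,F)=\big(\mathbb{E}^{(n)}_F|\widehat F(t)-F(t)|^r\big)^{1/r}$. **Standing assumptions.** (Noise) $\varepsilon_1$ has a symmetric distribution with density $p\in\mathfrak P=\{\ell:\mathbb{R}\to\mathbb{R}_+ : \int_x^\infty \ell(y)\,dy\le\Upsilon e^{-\Omega x^\omega}\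 \forall x\ge0\}$, where $\Upsilon>0,\Omega\in(0,1],\omega>0$ are fixed. (Design) There is $\underline g\in(0,1)$ with $\inf_{x\in[-3,3]^2}g(x)\ge\underline g$. (Kernel) $\mathcal K:\mathbb{R}\to\mathbb{R}$ is symmetric, $\mathrm{supp}(\mathcal K)\subseteq[-1/2,1/2]$, $\int\mathcal K=1$, and $|\mathcal K(u)-\mathcal K(v)|\le Q|u-v|$ for all $u,v$, for some $Q>0$. Put $K(u,v)=\mathcal K(u)\mathcal K(v)$; $\|\mathcal K\|_p$ is the $L_p(\mathbb{R})$ norm. **Link class.** For $\beta_0\in(0,1),M>0$: $\mathbb{F}(\beta_0,M)=\{U:\mathbb{R}\to\mathbb{R}: \|U\|_\infty+\sup_{y_1\neq y_2}|U(y_1)-U(y_2)|/|y_1-y_2|^{\beta_0}\le M\}$. **Sample size.** $h_{\min}=n^{-1}\ln^{1+2/\omega}(n)$, $\mathfrak h=\sqrt{n^{-1}\ln^{1+1/\omega}(n)}$; $n_0=\inf\{m\in\mathbb{N}^*: (M\vee1)\max\{\mathfrak h^{\beta_0},\ln^{1/\omega}(n)h_{\min}^{\beta_0}\}\le1\ \forall n\ge m\}$; $n_1=\inf\{m\in\mathbb{N}^*: (n\mathfrak h^2)^{-1/2}C_3(n)\le1/2\ \forall n\ge m\}$. **Oracle bandwidth.** $\Delta_{\mathcal K,f}(h,z)=\sup_{0<\delta\le h}\big|\frac1\delta\int\mathcal K\big(\frac{u-z}{\delta}\big)[f(u)-f(z)]\,du\big|$, $\Delta^*_{\mathcal K,f}(h,y)=\sup_{a>0}\frac1{2a}\int_{y-a}^{y+a}\Delta_{\mathcal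 K,f}(h,z)\,dz$, and $h^*_{\mathcal K,f}(y)=\sup\{h\in[h_{\min},1]:\sqrt{nh}\,\Delta^*_{\mathcal K,f}(h,y)\le\|\mathcal K\|_\infty\sqrt{\ln(n)}\}$. **Constants.** $\tau=(\Omega^{-1}(4r+1)\ln(n))^{1/\omega}$, $\sigma^2=\sup\int x^2p(x)\,dx$ over symmetric probability densities $p\in\mathfrak P$, $c_1(n)=730\ln(16n^2\underline g^{-1/2}[12Q+\sqrt2])+8r\ln(n)+394$, $c_2(n)=730\ln(16n^2\tau\underline g^{-1/2}[12Q+\sqrt2])+8r\ln(n)+394$, $c_3(n)=365\ln(5n^2Q\underline g^{-1/2})+8r\ln(n)+197$, $c_4(n)=365\ln(5n^2\tau Q\underline g^{-1/2})+8r\ln(n)+197$, $C_1(n)=2\sqrt2\,\underline g^{-1/2}\|\mathcal K\|_\infty^2\sqrt{c_1(n)}+\frac83c_1(n)(\ln n)^{-(2+\omega)/(2\omega)}\underline g^{-1}\|\mathcal K\|^2_\infty$, $C_2(n)=2\sqrt2(\sigma\vee1)\underline g^{-1/2}\|\mathcal K\|_\infty^2\sqrt{c_2(n)}+\frac83c_2(n)(\ln n)^{-1/2}\underline g^{-1}\|\mathcal K\|_\infty^2(\Omega^{-1}(4r+1))^{1/\omega}$, $C_3(n)=2\sqrt2\,\underline g^{-1/2}\|\mathcal K\|_\infty^2\sqrt{c_3(n)}+\frac83\underline g^{-1}\|\mathcal K\|_\infty^2c_3(n)(n\mathfrak h^2)^{-1/2}$, $C_4(n)=2\sqrt2(\sigma\vee1)\underline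 g^{-1/2}\|\mathcal K\|_\infty^2\sqrt{c_4(n)}+\frac83\tau c_4(n)(n\mathfrak h^2)^{-1/2}\underline g^{-1}\|\mathcal K\|_\infty^2$, $C_5(n)=\|\mathcal K\|_1^2+(n\mathfrak h^2)^{-1/2}C_4(n)+1/2$. (The functions $c_1(n),c_2(n)$ are unrelated to the constants $c_1,c_2$ in the claim.) **Estimator** (here $r$ is the index of the risk). For a $2\times2$ matrix $E$ put $\widehat F(E,t)=\frac{\det(E)}n\sum_{i=1}^n\frac{K(E(X_i-t))}{g(X_i)}Y_i$. For $\theta,\nu\in\mathbb{S}^1$, $h>0$ let $E_{(\theta,h)}=\begin{pmatrix}h^{-1}\theta_1&h^{-1}\theta_2\\-\theta_2&\theta_1\end{pmatrix}$, $\overline E_{(\theta,h)(\nu,h)}=\begin{pmatrix}\frac{\theta_1+\nu_1}{2h(1+|\nu^\top\theta|)}&\frac{\theta_2+\nu_2}{2h(1+|\nu^\top\theta|)}\\-\frac{\theta_2+\nu_2}{2(1+|\nu^\top\theta|)}&\frac{\theta_1+\nu_1}{2(1+|\nu^\top\theta|)}\end{pmatrix}$, and $E_{(\theta,h)(\nu,h)}=\overline E_{(\theta,h)(\nu,h)}$ if $\nu^\top\theta\ge0$, $=\overline E_{(-\theta,h)(\nu,h)}$ if $\nu^\top\theta<0$. Write $\widehat F_{(\theta,h)}(t)=\widehat F(E_{(\theta,h)},t)$ and $\widehat F_{(\theta,h)(\nu,h)}(t)=\widehat F(E_{(\theta,h)(\nu,h)},t)$. Let $K_{\mathfrak h}(u_1,u_2)=\mathfrak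 h^{-2}\mathcal K(u_1/\mathfrak h)\mathcal K(u_2/\mathfrak h)$ and $\widehat F_\infty=2\sup_{v\in[-5/2,5/2]^2}\big|n^{-1}\sum_{i=1}^ng^{-1}(X_i)K_{\mathfrak h}(X_i-v)Y_i\big|+2C_5(n)$. For $\eta\in(0,1]$ let $\mathrm{TH}(\eta)=2\big[\|\mathcal K\|_\infty^2\sqrt{\ln(n)}+\widehat F_\infty C_1(n)+C_2(n)\big](\eta n)^{-1/2}$. Let $\mathcal H_n=\{2^{-k}:k=0,1,2,\dots\}\cap[2^{-1}h_{\min},1]$ and, for $\theta\in\mathbb{S}^1,h\in\mathcal H_n$, $R^{(1)}_t(\theta,h)=\sup_{\eta\in\mathcal H_n,\eta\le h}\big[\sup_{\nu\in\mathbb{S}^1}|\widehat F_{(\theta,\eta)(\nu,\eta)}(t)-\widehat F_{(\nu,\eta)}(t)|-\mathrm{TH}(\eta)\big]_+$, $R^{(2)}_t(h)=\sup_{\eta\in\mathcal H_n,\eta\le h}\big[\sup_{\theta\in\mathbb{S}^1}|\widehat F_{(\theta,h)}(t)-\widehat F_{(\theta,\eta)}(t)|-\mathrm{TH}(\eta)\big]_+$. $(\hat\theta,\hat h)$ (depending on $t$) is a measurable minimizer of $R^{(1)}_t(\theta,h)+R^{(2)}_t(h)+\mathrm{TH}(h)$ over $\mathbb{S}^1\times\mathcal H_n$, and the estimator is $t\mapsto\widehat F_{(\hat\theta,\hat h)}(t)$. *)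

theory Defs
  imports "HOL-Probability.Probability"
begin

text \<open>
  The quantities on which the estimation procedure depends: the kernel and its Lipschitz constant,
  the design density and its lower bound, the parameters \<open>\<Upsilon>\<close>, \<open>\<Omega>\<close>, \<open>\<omega>\<close>
  of the noise class, and the index \<open>r\<close> of the risk. The record carries no constraints.
\<close>

record procedure =
  kern :: "real \<Rightarrow> real"
  lipK :: real
  design :: "real^2 \<Rightarrow> real"
  glow :: real
  Ups :: real
  Omg :: real
  omg :: real
  rexp :: real

definition kernel_sup :: "procedure \<Rightarrow> real" where
  "kernel_sup S = (SUP u. \<bar>kern S u\<bar>)"

definition kernel_L1 :: "procedure \<Rightarrow> real" where
  "kernel_L1 S = (LBINT u. \<bar>kern S u\<bar>)"

definition kernel2 :: "procedure \<Rightarrow> real^2 \<Rightarrow> real" where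
  "kernel2 S x = kern S (x$1) * kern S (x$2)"


text \<open>Noise densities. Symmetry is a property of the law, so densities may be changed on null sets.\<close>

definition symmetric_law :: "real measure \<Rightarrow> bool" where
  "symmetric_law \<mu> \<longleftrightarrow> distr \<mu> borel uminus = \<mu>"

definition noise_class :: "procedure \<Rightarrow> (real \<Rightarrow> real) set" where
  "noise_class S = {l. l \<in> borel_measurable borel \<and> (\<forall>x. 0 \<le> l x) \<and>
     (\<forall>x\<ge>0. (\<integral>\<^sup>+y\<in>{x..}. ennreal (l y) \<partial>lborel) \<le> ennreal (Ups S * exp (- Omg S * x powr omg S)))}"

definition sigma2 :: "procedure \<Rightarrow> real" where
  "sigma2 S = (SUP p \<in> {p \<in> noise_class S. prob_space (density lborel (\<lambda>x. ennreal (p x))) \<and>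
                          symmetric_law (density lborel (\<lambda>x. ennreal (p x)))}.
                 LBINT x. x\<^sup>2 * p x)"

definition sigma :: "procedure \<Rightarrow> real" where
  "sigma S = sqrt (sigma2 S)"


text \<open>Suprema are taken in the extended reals, since the sum may be infinite.\<close>

definition link_class :: "real \<Rightarrow> real \<Rightarrow> (real \<Rightarrow> real) set" where
  "link_class \<beta>\<^sub>0 M =
     {U. (SUP y. ereal \<bar>U y\<bar>)
         + (SUP (y\<^sub>1, y\<^sub>2) \<in> {(y\<^sub>1, y\<^sub>2). y\<^sub>1 \<noteq> y\<^sub>2}. ereal (\<bar>U y\<^sub>1 - U y\<^sub>2\<bar> / \<bar>y\<^sub>1 - y\<^sub>2\<bar> powr \<beta>\<^sub>0))
         \<le> ereal M}"


definition hmin :: "procedure \<Rightarrow> nat \<Rightarrow> real" where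
  "hmin S n = ln (real n) powr (1 + 2 / omg S) / real n"

definition hfrak :: "procedure \<Rightarrow> nat \<Rightarrow> real" where
  "hfrak S n = sqrt (ln (real n) powr (1 + 1 / omg S) / real n)"

definition tau :: "procedure \<Rightarrow> nat \<Rightarrow> real" where
  "tau S n = ((4 * rexp S + 1) * ln (real n) / Omg S) powr (1 / omg S)"

definition c1 :: "procedure \<Rightarrow> nat \<Rightarrow> real" where
  "c1 S n = 730 * ln (16 * (real n)\<^sup>2 * glow S powr (-1/2) * (12 * lipK S + sqrt 2))
              + 8 * rexp S * ln (real n) + 394"

definition c2 :: "procedure \<Rightarrow> nat \<Rightarrow> real" where
  "c2 S n = 730 * ln (16 * (real n)\<^sup>2 * tau S n * glow S powr (-1/2) * (12 * lipK S + sqrt 2))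
              + 8 * rexp S * ln (real n) + 394"

definition c3 :: "procedure \<Rightarrow> nat \<Rightarrow> real" where
  "c3 S n = 365 * ln (5 * (real n)\<^sup>2 * lipK S * glow S powr (-1/2)) + 8 * rexp S * ln (real n) + 197"

definition c4 :: "procedure \<Rightarrow> nat \<Rightarrow> real" where
  "c4 S n = 365 * ln (5 * (real n)\<^sup>2 * tau S n * lipK S * glow S powr (-1/2))
              + 8 * rexp S * ln (real n) + 197"

definition C1 :: "procedure \<Rightarrow> nat \<Rightarrow> real" where
  "C1 S n = 2 * sqrt 2 * glow S powr (-1/2) * (kernel_sup S)\<^sup>2 * sqrt (c1 S n)
     + 8/3 * c1 S n * ln (real n) powr (- (2 + omg S) / (2 * omg S)) * inverse (glow S) * (kernel_sup S)\<^sup>2"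

definition C2 :: "procedure \<Rightarrow> nat \<Rightarrow> real" where
  "C2 S n = 2 * sqrt 2 * max (sigma S) 1 * glow S powr (-1/2) * (kernel_sup S)\<^sup>2 * sqrt (c2 S n)
     + 8/3 * c2 S n * ln (real n) powr (-1/2) * inverse (glow S) * (kernel_sup S)\<^sup>2
         * ((4 * rexp S + 1) / Omg S) powr (1 / omg S)"

definition C3 :: "procedure \<Rightarrow> nat \<Rightarrow> real" where
  "C3 S n = 2 * sqrt 2 * glow S powr (-1/2) * (kernel_sup S)\<^sup>2 * sqrt (c3 S n)
     + 8/3 * inverse (glow S) * (kernel_sup S)\<^sup>2 * c3 S n * (real n * (hfrak S n)\<^sup>2) powr (-1/2)"

definition C4 :: "procedure \<Rightarrow> nat \<Rightarrow> real" where
  "C4 S n = 2 * sqrt 2 * max (sigma S) 1 * glow S powr (-1/2) * (kernel_sup S)\<^sup>2 * sqrt (c4 S n)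
     + 8/3 * tau S n * c4 S n * (real n * (hfrak S n)\<^sup>2) powr (-1/2) * inverse (glow S) * (kernel_sup S)\<^sup>2"

definition C5 :: "procedure \<Rightarrow> nat \<Rightarrow> real" where
  "C5 S n = (kernel_L1 S)\<^sup>2 + (real n * (hfrak S n)\<^sup>2) powr (-1/2) * C4 S n + 1/2"

definition n0 :: "procedure \<Rightarrow> real \<Rightarrow> real \<Rightarrow> nat" where
  "n0 S \<beta>\<^sub>0 M = Inf {m. 1 \<le> m \<and> (\<forall>n\<ge>m.
     max M 1 * max (hfrak S n powr \<beta>\<^sub>0) (ln (real n) powr (1 / omg S) * hmin S n powr \<beta>\<^sub>0) \<le> 1)}"

text \<open>
  At \<open>n = 1\<close> the expression below is \<open>0\<close>, because \<open>0 powr a = 0\<close>, whereas it should be infinite.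
  The infimum is unaffected: the condition fails at \<open>n = 2\<close>, since \<open>ln 2 < 1\<close> and,
  under the assumptions on the kernel (which force \<open>lipK S \<ge> 4\<close>),
  \<open>c3 S 2 > 197\<close> and \<open>kernel_sup S \<ge> 1\<close>.
\<close>

definition n1 :: "procedure \<Rightarrow> nat" where
  "n1 S = Inf {m. 1 \<le> m \<and> (\<forall>n\<ge>m. (real n * (hfrak S n)\<^sup>2) powr (-1/2) * C3 S n \<le> 1/2)}"


definition Delta :: "procedure \<Rightarrow> (real \<Rightarrow> real) \<Rightarrow> real \<Rightarrow> real \<Rightarrow> real" where
  "Delta S f h z = (SUP \<delta>\<in>{0<..h}. \<bar>(1 / \<delta>) * (LBINT u. kern S ((u - z) / \<delta>) * (f u - f z))\<bar>)"

definition Delta_star :: "procedure \<Rightarrow> (real \<Rightarrow> real) \<Rightarrow> real \<Rightarrow> real \<Rightarrow> real" where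
  "Delta_star S f h y = (SUP a\<in>{0<..}. (1 / (2 * a)) * (LBINT z:{y - a..y + a}. Delta S f h z))"

definition h_star :: "procedure \<Rightarrow> nat \<Rightarrow> (real \<Rightarrow> real) \<Rightarrow> real \<Rightarrow> real" where
  "h_star S n f y = Sup {h \<in> {hmin S n..1}.
     sqrt (real n * h) * Delta_star S f h y \<le> kernel_sup S * sqrt (ln (real n))}"


text \<open>
  A data set is a function \<open>d\<close> with \<open>d i = (X\<^sub>i, Y\<^sub>i)\<close>. The observations are indexed
  by \<open>i < n\<close> rather than by \<open>1, \<dots>, n\<close>.
\<close>

type_synonym dataset = "nat \<Rightarrow> (real^2) \<times> real"

definition Fhat_mat :: "procedure \<Rightarrow> nat \<Rightarrow> dataset \<Rightarrow> real^2^2 \<Rightarrow> real^2 \<Rightarrow> real" where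
  "Fhat_mat S n d E t =
     det E / real n * (\<Sum>i<n. kernel2 S (E *v (fst (d i) - t)) / design S (fst (d i)) * snd (d i))"

definition E_single :: "real^2 \<Rightarrow> real \<Rightarrow> real^2^2" where
  "E_single \<theta> h = vector [vector [\<theta>$1 / h, \<theta>$2 / h], vector [- \<theta>$2, \<theta>$1]]"

definition E_bar :: "real^2 \<Rightarrow> real^2 \<Rightarrow> real \<Rightarrow> real^2^2" where
  "E_bar \<theta> \<nu> h =
     vector [vector [(\<theta>$1 + \<nu>$1) / (2 * h * (1 + \<bar>\<nu> \<bullet> \<theta>\<bar>)), (\<theta>$2 + \<nu>$2) / (2 * h * (1 + \<bar>\<nu> \<bullet> \<theta>\<bar>))],
             vector [- (\<theta>$2 + \<nu>$2) / (2 * (1 + \<bar>\<nu> \<bullet> \<theta>\<bar>)), (\<theta>$1 + \<nu>$1) / (2 * (1 + \<bar>\<nu> \<bullet> \<theta>\<bar>))]]"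

definition E_pair :: "real^2 \<Rightarrow> real^2 \<Rightarrow> real \<Rightarrow> real^2^2" where
  "E_pair \<theta> \<nu> h = (if 0 \<le> \<nu> \<bullet> \<theta> then E_bar \<theta> \<nu> h else E_bar (- \<theta>) \<nu> h)"

definition Fhat :: "procedure \<Rightarrow> nat \<Rightarrow> dataset \<Rightarrow> real^2 \<Rightarrow> real \<Rightarrow> real^2 \<Rightarrow> real" where
  "Fhat S n d \<theta> h t = Fhat_mat S n d (E_single \<theta> h) t"

definition Fhat_pair :: "procedure \<Rightarrow> nat \<Rightarrow> dataset \<Rightarrow> real^2 \<Rightarrow> real^2 \<Rightarrow> real \<Rightarrow> real^2 \<Rightarrow> real" where
  "Fhat_pair S n d \<theta> \<nu> h t = Fhat_mat S n d (E_pair \<theta> \<nu> h) t"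

definition kernel2_hfrak :: "procedure \<Rightarrow> nat \<Rightarrow> real^2 \<Rightarrow> real" where
  "kernel2_hfrak S n u = kern S (u$1 / hfrak S n) * kern S (u$2 / hfrak S n) / (hfrak S n)\<^sup>2"

definition Fhat_inf :: "procedure \<Rightarrow> nat \<Rightarrow> dataset \<Rightarrow> real" where
  "Fhat_inf S n d =
     2 * (SUP v\<in>cbox (vec (-5/2)) (vec (5/2)).
            \<bar>(1 / real n) * (\<Sum>i<n. kernel2_hfrak S n (fst (d i) - v) / design S (fst (d i)) * snd (d i))\<bar>)
     + 2 * C5 S n"

definition TH :: "procedure \<Rightarrow> nat \<Rightarrow> dataset \<Rightarrow> real \<Rightarrow> real" where
  "TH S n d \<eta> = 2 * ((kernel_sup S)\<^sup>2 * sqrt (ln (real n)) + Fhat_inf S n d * C1 S n + C2 S n)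
                  * (\<eta> * real n) powr (-1/2)"

definition bandwidths :: "procedure \<Rightarrow> nat \<Rightarrow> real set" where
  "bandwidths S n = {(1/2)^k | k :: nat. True} \<inter> {hmin S n / 2..1}"

definition R1 :: "procedure \<Rightarrow> nat \<Rightarrow> dataset \<Rightarrow> real^2 \<Rightarrow> real^2 \<Rightarrow> real \<Rightarrow> real" where
  "R1 S n d t \<theta> h = (SUP \<eta>\<in>{\<eta> \<in> bandwidths S n. \<eta> \<le> h}.
     max 0 ((SUP \<nu>\<in>sphere 0 1. \<bar>Fhat_pair S n d \<theta> \<nu> \<eta> t - Fhat S n d \<nu> \<eta> t\<bar>) - TH S n d \<eta>))"

definition R2 :: "procedure \<Rightarrow> nat \<Rightarrow> dataset \<Rightarrow> real^2 \<Rightarrow> real \<Rightarrow> real" where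
  "R2 S n d t h = (SUP \<eta>\<in>{\<eta> \<in> bandwidths S n. \<eta> \<le> h}.
     max 0 ((SUP \<theta>\<in>sphere 0 1. \<bar>Fhat S n d \<theta> h t - Fhat S n d \<theta> \<eta> t\<bar>) - TH S n d \<eta>))"

definition criterion :: "procedure \<Rightarrow> nat \<Rightarrow> dataset \<Rightarrow> real^2 \<Rightarrow> real^2 \<Rightarrow> real \<Rightarrow> real" where
  "criterion S n d t \<theta> h = R1 S n d t \<theta> h + R2 S n d t h + TH S n d h"

text \<open>
  A measurable minimizer \<open>sel\<close> maps the data to the selected pair \<open>(\<theta>, h)\<close> at the point \<open>t\<close>.
  Minimization is required on the data sets for which the estimators are defined, i.e. where the
  design density does not vanish at any design point; these have probability one.
\<close>

definition measurable_minimizer ::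
  "procedure \<Rightarrow> nat \<Rightarrow> real^2 \<Rightarrow> (dataset \<Rightarrow> (real^2) \<times> real) \<Rightarrow> bool" where
  "measurable_minimizer S n t sel \<longleftrightarrow>
     sel \<in> PiM {..<n} (\<lambda>_. borel) \<rightarrow>\<^sub>M borel \<and>
     (\<forall>d \<in> space (PiM {..<n} (\<lambda>_. borel)). (\<forall>i<n. 0 < design S (fst (d i))) \<longrightarrow>
        sel d \<in> sphere 0 1 \<times> bandwidths S n \<and>
        (\<forall>(\<theta>, h) \<in> sphere 0 1 \<times> bandwidths S n.
           criterion S n d t (fst (sel d)) (snd (sel d)) \<le> criterion S n d t \<theta> h))"

definition selected_estimator ::
  "procedure \<Rightarrow> nat \<Rightarrow> (dataset \<Rightarrow> (real^2) \<times> real) \<Rightarrow> dataset \<Rightarrow> real^2 \<Rightarrow> real" where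
  "selected_estimator S n sel d t = Fhat S n d (fst (sel d)) (snd (sel d)) t"


definition sample ::
  "(nat \<Rightarrow> 'w \<Rightarrow> real^2) \<Rightarrow> (nat \<Rightarrow> 'w \<Rightarrow> real) \<Rightarrow> (real^2 \<Rightarrow> real) \<Rightarrow> nat \<Rightarrow> 'w \<Rightarrow> dataset" where
  "sample X \<epsilon> F n w = (\<lambda>i\<in>{..<n}. (X i w, F (X i w) + \<epsilon> i w))"

text \<open>
  The risk takes values in \<open>ennreal\<close>, so that an infinite \<open>r\<close>-th moment gives an infinite risk.
  The argument \<open>T\<close> is the estimate at \<open>t\<close> as a random variable and \<open>a\<close> is the value estimated.
\<close>

definition risk :: "'w measure \<Rightarrow> real \<Rightarrow> ('w \<Rightarrow> real) \<Rightarrow> real \<Rightarrow> ennreal" where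
  "risk P r T a =
     (let m = \<integral>\<^sup>+w. ennreal (\<bar>T w - a\<bar> powr r) \<partial>P
      in if m = \<infinity> then \<infinity> else ennreal (enn2real m powr (1 / r)))"

end

theory Submission
  imports Defs "HOL-Real_Asymp.Real_Asymp"
begin

text \<open>
  For \<open>1/2 \<le> \<bar>w\<bar> \<le> 1\<close> the matrices \<open>E_single w h\<close> comprise both families of estimators: the matrix of
  a pair of directions is \<open>E_single w h\<close> with \<open>w = (\<plusminus>\<theta> + \<nu>) / (2 (1 + \<bar>\<nu> \<bullet> \<theta>\<bar>))\<close>. The mean of such an estimator is
  \<open>\<integral>\<integral> K u K v f (y + a u + b v)\<close>, which differs from \<open>\<integral> K v f (y + b v)\<close> by at most a constant times
  \<open>Delta_star\<close>. For \<open>w = \<nu>\<close> and for the pair \<open>(\<theta>s, \<nu>)\<close> the value of \<open>b\<close> is the same, so the biases cancel in both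
  comparisons and the true direction with the oracle bandwidth makes \<open>R1\<close> and \<open>R2\<close> vanish whenever all stochastic
  errors are below their thresholds. A Bernstein bound over nets of polynomial size shows that this fails with
  probability at most a constant times \<open>n\<close> to the power \<open>- 4 r\<close>. On the failure event the error is at most of order
  \<open>n (1 + mean of \<bar>\<epsilon>\<bar>)\<close>, and \<open>z \<le> \<alpha> z\<^sup>2 + 1 / \<alpha>\<close> with \<open>\<alpha> = n powr (- 7 r / 2)\<close> bounds its contribution by
  \<open>n powr (-1/2)\<close>. Only finitely many \<open>n\<close> are not covered, and for them this crude bound suffices.
\<close>

section \<open>Change of variables in the plane\<close>

text \<open>In a wrong direction \<nu> the mean of an estimator is close to
  \<open>smooth1 (cross \<nu> \<theta>s)\<close>, which may be far from \<open>f\<close>. So only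
  differences of estimators with a common limit are controlled. The error of the approximation is an
  average of local errors of \<open>f\<close> over a segment whose length depends on \<nu>; this is
  why the oracle bandwidth is defined through the centred maximal function \<open>Delta_star\<close>
  and not through \<open>Delta\<close> at one point. A second obstacle is that the thresholds must
  scale with the sup norm \<open>L\<close> of the regression function, which is unknown. Writing the
  link as \<open>L * G\<close> with \<open>\<bar>G\<bar> \<le> 1\<close> makes the design part of
  the error \<open>L\<close> times a process with the known bound \<open>C1\<close>, and
  \<open>Fhat_inf\<close> replaces \<open>L\<close>: on the good event it lies between
  \<open>L\<close> and \<open>3 * M + 4 * C5\<close>, so the threshold is large enough and still of
  the right order. The noise is unbounded; Bernstein's inequality is applied to its truncation at
  \<open>tau\<close>, which symmetry keeps centred. All constants depend on \<open>f\<close> through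
  \<open>M\<close> only, which makes the final bound uniform over the class.\<close>

lemma Basis_real2: "(Basis :: (real^2) set) = {axis 1 1, axis 2 1}"
  by (auto simp: Basis_vec_def UNIV_2)

lemma prod_Basis_real2: "(\<Prod>b\<in>(Basis :: (real^2) set). f b) = f (axis 1 1) * f (axis 2 1)"
  by (simp add: Basis_real2 axis_eq_axis)

lemma box_real2: "x \<in> box l (u :: real^2) \<longleftrightarrow> l$1 < x$1 \<and> x$1 < u$1 \<and> l$2 < x$2 \<and> x$2 < u$2"
  by (auto simp: box_def Basis_real2 inner_axis)

lemma borel_measurable_vector2 [measurable]:
  "(\<lambda>(a, b). vector [a, b] :: real^2) \<in> borel \<Otimes>\<^sub>M borel \<rightarrow>\<^sub>M borel"
proof -
  have "(\<lambda>x :: real \<times> real. vector [fst x, snd x] :: real^2) = (\<lambda>x. fst x *\<^sub>R axis 1 1 + snd x *\<^sub>R axis 2 1)"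
    by (auto simp: fun_eq_iff vec_eq_iff forall_2 axis_def)
  also have "\<dots> \<in> borel \<Otimes>\<^sub>M borel \<rightarrow>\<^sub>M borel"
    by measurable
  finally show ?thesis
    by (simp add: case_prod_beta')
qed

text \<open>Boxes determine Lebesgue measure, and the preimage of a box is a rectangle of the same
  area. Integrals over \<open>real^2\<close> thereby become iterated integrals over the
  coordinates.\<close>

lemma lborel_real2: "lborel = distr (lborel \<Otimes>\<^sub>M lborel) borel (\<lambda>(a, b). vector [a, b] :: real^2)"
proof (rule lborel_eqI)
  fix l u :: "real^2"
  assume lu: "\<And>b. b \<in> Basis \<Longrightarrow> l \<bullet> b \<le> u \<bullet> b"
  then have le: "l$1 \<le> u$1" "l$2 \<le> u$2"
    using lu[of "axis 1 1"] lu[of "axis 2 1"] by (auto simp: Basis_real2 inner_axis)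
  have "(\<lambda>(a, b). vector [a, b] :: real^2) -` box l u \<inter> space (lborel \<Otimes>\<^sub>M lborel)
      = {l$1<..<u$1} \<times> {l$2<..<u$2}"
    by (auto simp: box_real2 space_pair_measure)
  then show "emeasure (distr (lborel \<Otimes>\<^sub>M lborel) borel (\<lambda>(a, b). vector [a, b])) (box l u)
      = (\<Prod>b\<in>Basis. (u - l) \<bullet> b)"
    using le by (simp add: emeasure_distr lborel.emeasure_pair_measure_Times prod_Basis_real2
        inner_axis ennreal_mult)
qed simp

lemma borel_measurable_affine_matrix:
  fixes E :: "real^'n^'m"
  shows "(\<lambda>x. E *v (x - t)) \<in> borel \<rightarrow>\<^sub>M borel"
proof -
  have "continuous_on UNIV (\<lambda>x. E *v x - E *v t)"
    by (intro continuous_intros linear_continuous_on) simp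
  then show ?thesis
    by (intro borel_measurable_continuous_onI) (simp add: matrix_vector_mult_diff_distrib)
qed

text \<open>Both measures agree on boxes: the preimage of a box is its image under the inverse
  matrix, translated by \<open>t\<close>, so its measure is divided by \<open>det E\<close>. As an
  identity of measures this transfers integrals and integrability at once.\<close>

lemma lborel_linear_image:
  fixes E :: "real^'n::{finite,wellorder}^'n::_" and t :: "real^'n::_"
  assumes det: "0 < det E"
  shows "lborel = density (distr lborel borel (\<lambda>x. E *v (x - t))) (\<lambda>_. ennreal (det E))"
proof (rule lborel_eqI)
  fix l u :: "real^'n::_"
  assume lu: "\<And>b. b \<in> Basis \<Longrightarrow> l \<bullet> b \<le> u \<bullet> b"
  have inv: "invertible E" using det by (simp add: invertible_det_nz)
  obtain F where EF: "E ** F = mat 1" "F ** E = mat 1"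
    using inv by (auto simp: invertible_def)
  have detF: "det F = 1 / det E"
    using arg_cong[OF EF(1), of det] det by (simp add: det_mul det_I field_simps)
  have [measurable]: "(\<lambda>x. E *v (x - t)) \<in> borel \<rightarrow>\<^sub>M borel"
    by (rule borel_measurable_affine_matrix)
  have pre: "(\<lambda>x. E *v (x - t)) -` box l u = (+) t ` ((*v) F ` box l u)"
  proof (intro subset_antisym subsetI)
    fix x assume "x \<in> (\<lambda>x. E *v (x - t)) -` box l u"
    then have "E *v (x - t) \<in> box l u" by simp
    moreover have "x = t + F *v (E *v (x - t))"
      by (simp add: matrix_vector_mul_assoc EF)
    ultimately show "x \<in> (+) t ` ((*v) F ` box l u)" by blast
  next
    fix x assume "x \<in> (+) t ` ((*v) F ` box l u)"
    then show "x \<in> (\<lambda>x. E *v (x - t)) -` box l u"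
      by (auto simp: matrix_vector_mul_assoc EF)
  qed
  have lin: "linear ((*v) F)" by simp
  have box: "box l u \<in> lmeasurable" by simp
  have img: "(*v) F ` box l u \<in> lmeasurable"
    "measure lebesgue ((*v) F ` box l u) = measure lebesgue (box l u) / det E"
    using measure_linear_image[OF lin box] measurable_linear_image[OF lin box] det detF by auto
  have "emeasure lborel ((\<lambda>x. E *v (x - t)) -` box l u)
      = emeasure lebesgue ((+) t ` ((*v) F ` box l u))"
    using measurable_sets_borel[of "\<lambda>x. E *v (x - t)" borel "box l u"] by (simp flip: pre)
  also have "\<dots> = ennreal (measure lebesgue (box l u) / det E)"
    using img by (simp add: emeasure_eq_measure2 measurable_translation measure_translation)
  finally have *: "emeasure lborel ((\<lambda>x. E *v (x - t)) -` box l u) = ennreal (measure lborel (box l u) / det E)"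
    by simp
  have "0 \<le> (\<Prod>b\<in>Basis. (u - l) \<bullet> b)"
    by (intro prod_nonneg) (auto simp: lu inner_diff_left)
  then show "emeasure (density (distr lborel borel (\<lambda>x. E *v (x - t))) (\<lambda>_. ennreal (det E))) (box l u)
      = (\<Prod>b\<in>Basis. (u - l) \<bullet> b)"
    using det lu
    by (simp add: emeasure_density nn_integral_cmult_indicator emeasure_distr * flip: ennreal_mult)
qed simp

lemma
  fixes E :: "real^'n::{finite,wellorder}^'n::_" and t :: "real^'n::_" and f :: "real^'n::_ \<Rightarrow> real"
  assumes det: "0 < det E" and f [measurable]: "f \<in> borel_measurable borel"
  shows lborel_integral_linear_image:
      "(LBINT x. det E * f (E *v (x - t))) = (LBINT x. f x)"
    and lborel_integrable_linear_image:
      "integrable lborel (\<lambda>x. det E * f (E *v (x - t))) \<longleftrightarrow> integrable lborel f"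
proof -
  have [measurable]: "(\<lambda>x. E *v (x - t)) \<in> borel \<rightarrow>\<^sub>M borel"
    by (rule borel_measurable_affine_matrix)
  show "(LBINT x. det E * f (E *v (x - t))) = (LBINT x. f x)"
    using det by (subst (2) lborel_linear_image[OF det, of t])
      (simp add: integral_density integral_distr del: integral_mult_right_zero)
  show "integrable lborel (\<lambda>x. det E * f (E *v (x - t))) \<longleftrightarrow> integrable lborel f"
    using det by (subst (2) lborel_linear_image[OF det, of t])
      (simp add: integrable_density integrable_distr_eq del: integrable_mult_left_iff)
qed

lemma
  fixes f :: "real^2 \<Rightarrow> real"
  assumes f: "integrable lborel f"
  shows lborel_integral_real2: "(LBINT x. f x) = (LBINT a. LBINT b. f (vector [a, b]))"
    and lborel_integrable_real2: "integrable (lborel \<Otimes>\<^sub>M lborel) (\<lambda>(a, b). f (vector [a, b]))"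
proof -
  have [measurable]: "f \<in> borel_measurable borel" using f by auto
  show int: "integrable (lborel \<Otimes>\<^sub>M lborel) (\<lambda>(a, b). f (vector [a, b]))"
    using f by (subst (asm) lborel_real2) (simp add: integrable_distr_eq case_prod_beta')
  have "(LBINT x. f x) = (\<integral>z. (\<lambda>(a, b). f (vector [a, b])) z \<partial>(lborel \<Otimes>\<^sub>M lborel))"
    by (subst lborel_real2) (simp add: integral_distr case_prod_beta')
  also have "\<dots> = (LBINT a. LBINT b. f (vector [a, b]))"
    using lborel_pair.integral_fst'[OF int] by simp
  finally show "(LBINT x. f x) = (LBINT a. LBINT b. f (vector [a, b]))" .
qed

section \<open>Bernstein's inequality and independent pairs\<close>

lemma power2_le_if_abs_le:
  fixes x y :: real
  assumes "\<bar>x\<bar> \<le> y"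
  shows "x\<^sup>2 \<le> y\<^sup>2"
  using power_mono[OF assms, of 2] by simp

text \<open>For negative \<open>x\<close> the bound goes through the reciprocal:
  \<open>exp (- y)\<close> is at most \<open>1 / (1 + y + y\<^sup>2 / 2)\<close>, and multiplying
  out shows that this is at most \<open>1 - y + y\<^sup>2\<close>.\<close>

lemma exp_le_quadratic:
  fixes x :: real
  assumes "\<bar>x\<bar> \<le> 1"
  shows "exp x \<le> 1 + x + x\<^sup>2"
proof (cases "0 \<le> x")
  case True
  then show ?thesis using exp_bound[of x] assms by simp
next
  case False
  define y where "y = - x"
  have y: "0 < y" "y \<le> 1" using False assms by (auto simp: y_def)
  have "1 + y + y\<^sup>2 / 2 \<le> exp y"
    using exp_lower_Taylor_quadratic[of y] y by simp
  then have "exp (- y) \<le> 1 / (1 + y + y\<^sup>2 / 2)"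
    using y by (simp add: exp_minus field_simps add_pos_nonneg)
  also have "\<dots> \<le> 1 - y + y\<^sup>2"
  proof -
    have "(1 - y + y\<^sup>2) * (1 + y + y\<^sup>2 / 2) = 1 + y\<^sup>2 / 2 + y^3 / 2 + y^4 / 2"
      by (simp add: power2_eq_square power3_eq_cube power4_eq_xxxx field_simps)
    also have "1 \<le> \<dots>" using y by simp
    finally show ?thesis using y by (simp add: divide_le_eq add_pos_nonneg)
  qed
  finally show ?thesis by (simp add: y_def)
qed

context prob_space
begin

text \<open>The uncentred second moment suffices: \<open>1 + l E Z + l^2 V\<close> is at most the
  exponential of \<open>l E Z + l^2 V\<close>, and dividing by \<open>exp (l E Z)\<close> centres
  the variable. The range condition therefore concerns \<open>Z\<close> itself, and \<open>B\<close>
  is not doubled.\<close>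

lemma bernstein_mgf:
  fixes Z :: "'a \<Rightarrow> real" and B V l :: real
  assumes Z [measurable]: "Z \<in> borel_measurable M"
    and bound: "\<And>w. w \<in> space M \<Longrightarrow> \<bar>Z w\<bar> \<le> B"
    and var: "expectation (\<lambda>w. (Z w)\<^sup>2) \<le> V"
    and l: "0 \<le> l" "l * B \<le> 1"
  shows "expectation (\<lambda>w. exp (l * (Z w - expectation Z))) \<le> exp (l\<^sup>2 * V)"
proof -
  have intZ: "integrable M Z"
    by (rule integrable_const_bound[where B = B]) (auto simp: bound)
  have intZ2: "integrable M (\<lambda>w. (Z w)\<^sup>2)"
    by (rule integrable_const_bound[where B = "B\<^sup>2"])
      (intro AE_I2, simp, rule power2_le_if_abs_le, erule bound, measurable)
  have le: "\<bar>l * Z w\<bar> \<le> 1" if "w \<in> space M" for w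
  proof -
    have "\<bar>l * Z w\<bar> \<le> l * B"
      using mult_left_mono[OF bound[OF that] l(1)] l by (simp add: abs_mult)
    then show ?thesis using l by simp
  qed
  have intE: "integrable M (\<lambda>w. exp (l * Z w))"
    by (rule integrable_const_bound[where B = "exp 1"]) (intro AE_I2, simp, drule le, simp, simp)
  have "expectation (\<lambda>w. exp (l * Z w)) \<le> expectation (\<lambda>w. 1 + l * Z w + l\<^sup>2 * (Z w)\<^sup>2)"
  proof (rule integral_mono)
    fix w assume "w \<in> space M"
    from exp_le_quadratic[OF le[OF this]]
    show "exp (l * Z w) \<le> 1 + l * Z w + l\<^sup>2 * (Z w)\<^sup>2"
      by (simp add: power_mult_distrib)
  qed (use intZ intZ2 intE in auto)
  also have "\<dots> = 1 + l * expectation Z + l\<^sup>2 * expectation (\<lambda>w. (Z w)\<^sup>2)"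
    using intZ intZ2 by (simp add: prob_space)
  also have "\<dots> \<le> 1 + (l * expectation Z + l\<^sup>2 * V)"
    using var by (simp add: mult_left_mono)
  also have "\<dots> \<le> exp (l * expectation Z + l\<^sup>2 * V)"
    by (rule exp_ge_add_one_self)
  finally have "expectation (\<lambda>w. exp (l * Z w)) * exp (- (l * expectation Z)) \<le> exp (l\<^sup>2 * V)"
    by (simp add: exp_add exp_minus field_simps)
  moreover have "exp (l * (Z w - expectation Z)) = exp (l * Z w) * exp (- (l * expectation Z))" for w
    by (simp add: algebra_simps flip: exp_add)
  ultimately show ?thesis by simp
qed

lemma bernstein_upper:
  fixes Z :: "nat \<Rightarrow> 'a \<Rightarrow> real"
  assumes ind: "indep_vars (\<lambda>_. borel) Z UNIV"
    and bound: "\<And>i w. w \<in> space M \<Longrightarrow> \<bar>Z i w\<bar> \<le> B"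
    and var: "\<And>i. expectation (\<lambda>w. (Z i w)\<^sup>2) \<le> V"
    and pos: "0 < B" "0 < V" "0 < x" "0 < n"
  shows "prob {w \<in> space M. (\<Sum>i<n. Z i w - expectation (Z i)) \<ge> 2 * sqrt (n * V * x) + B * x} \<le> exp (- x)"
proof -
  have Z [measurable]: "\<And>i. Z i \<in> borel_measurable M"
    using ind by (auto simp: indep_vars_def)
  define s where "s = 2 * sqrt (n * V * x) + B * x"
  \<comment> \<open>The first value balances \<open>n l^2 V\<close> against \<open>x\<close>; the
    cap \<open>1 / B\<close> keeps \<open>l Z\<close> in the range where the quadratic bound on
    \<open>exp\<close> holds.\<close>
  define l where "l = min (sqrt (x / (n * V))) (1 / B)"
  have l: "0 < l" "l * B \<le> 1" using pos by (auto simp: l_def min_def field_simps)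
  define U where "U i w = exp (l * (Z i w - expectation (Z i)))" for i w
  have [measurable]: "U i \<in> borel_measurable M" for i
    unfolding U_def by measurable
  have le: "\<bar>l * Z i w\<bar> \<le> 1" if "w \<in> space M" for i w
  proof -
    have "\<bar>l * Z i w\<bar> \<le> l * B"
      using mult_left_mono[OF bound[OF that, of i], of l] l by (simp add: abs_mult)
    then show ?thesis using l by simp
  qed
  have intU: "integrable M (U i)" for i
    unfolding U_def
    by (rule integrable_const_bound[where B = "exp (1 - l * expectation (Z i))"])
      (intro AE_I2, drule le[of _ i], simp add: algebra_simps, measurable)
  have indU: "indep_vars (\<lambda>_. borel) U {..<n}"
    unfolding U_def
    by (rule indep_vars_subset[OF indep_vars_compose2[OF ind, where Y = "\<lambda>i z. exp (l * (z - expectation (Z i)))"]]) auto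
  have "expectation (\<lambda>w. \<Prod>i<n. U i w) = (\<Prod>i<n. expectation (U i))"
    by (rule indep_vars_lebesgue_integral) (use indU intU in auto)
  also have "\<dots> \<le> (\<Prod>i<n. exp (l\<^sup>2 * V))"
    unfolding U_def using l by (intro prod_mono) (auto intro!: bernstein_mgf bound var)
  finally have mgf: "expectation (\<lambda>w. \<Prod>i<n. U i w) \<le> exp (n * l\<^sup>2 * V)"
    by (simp add: exp_of_nat_mult mult.assoc)
  have intP: "integrable M (\<lambda>w. \<Prod>i<n. U i w)"
    by (rule indep_vars_integrable) (use indU intU in auto)
  have "prob {w \<in> space M. (\<Sum>i<n. Z i w - expectation (Z i)) \<ge> s}
      = prob {w \<in> space M. exp (l * s) \<le> (\<Prod>i<n. U i w)}"
    using l by (intro arg_cong[where f = prob])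
      (auto simp: U_def simp flip: exp_sum sum_distrib_left)
  also have "\<dots> \<le> expectation (\<lambda>w. \<Prod>i<n. U i w) / exp (l * s)"
    by (rule integral_Markov_inequality_measure[where A = "{}"])
      (use intP in \<open>auto intro!: prod_nonneg simp: U_def\<close>)
  also have "\<dots> \<le> exp (n * l\<^sup>2 * V - l * s)"
    using mgf by (simp add: exp_diff divide_right_mono)
  \<comment> \<open>Uncapped, the exponent is at most \<open>x - 2 x\<close>. Capped, the summand
    \<open>B x\<close> of the threshold supplies \<open>- x\<close>, and \<open>n V / B^2\<close> is
    dominated by the square root term because \<open>1 / B\<close> is below the first value of the
    minimum.\<close>
  also have "n * l\<^sup>2 * V - l * s \<le> - x"
  proof (cases "sqrt (x / (n * V)) \<le> 1 / B")
    case True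
    then have l': "l = sqrt (x / (n * V))" by (simp add: l_def)
    have "l\<^sup>2 = x / (n * V)" using pos by (simp add: l')
    then have a: "n * l\<^sup>2 * V = x" using pos by simp
    have "l * sqrt (n * V * x) = sqrt ((x / (n * V)) * (n * V * x))"
      by (simp only: l' real_sqrt_mult[symmetric])
    also have "(x / (n * V)) * (n * V * x) = x\<^sup>2" using pos by (simp add: power2_eq_square)
    finally have "l * sqrt (n * V * x) = x" using pos by simp
    moreover have "0 \<le> l * (B * x)" using l pos by simp
    ultimately show ?thesis using a by (simp add: s_def algebra_simps)
  next
    case False
    then have l': "l = 1 / B" by (simp add: l_def)
    have "n * V / B\<^sup>2 \<le> sqrt (n * V * x) / B"
    proof -
      have "sqrt (n * V) * sqrt (n * V) * (1 / B) \<le> sqrt (n * V) * sqrt (n * V) * sqrt (x / (n * V))"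
        using False pos by (intro mult_left_mono) auto
      also have "\<dots> = sqrt (n * V * x)" using pos
        by (simp add: real_sqrt_mult real_sqrt_divide)
      finally have "n * V / B \<le> sqrt (n * V * x)" using pos by simp
      then show ?thesis using pos by (simp add: power2_eq_square field_simps)
    qed
    moreover have "0 \<le> sqrt (n * V * x) / B" using pos by simp
    moreover have "n * l\<^sup>2 * V - l * s = n * V / B\<^sup>2 - 2 * (sqrt (n * V * x) / B) - x"
      using pos by (simp add: s_def l' field_simps power2_eq_square)
    ultimately show ?thesis by linarith
  qed
  finally show ?thesis by (simp add: s_def)
qed

lemma bernstein:
  fixes Z :: "nat \<Rightarrow> 'a \<Rightarrow> real"
  assumes ind: "indep_vars (\<lambda>_. borel) Z UNIV"
    and bound: "\<And>i w. w \<in> space M \<Longrightarrow> \<bar>Z i w\<bar> \<le> B"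
    and var: "\<And>i. expectation (\<lambda>w. (Z i w)\<^sup>2) \<le> V"
    and pos: "0 < B" "0 < V" "0 < x" "0 < n"
  shows "prob {w \<in> space M. \<bar>\<Sum>i<n. Z i w - expectation (Z i)\<bar> \<ge> 2 * sqrt (n * V * x) + B * x}
    \<le> 2 * exp (- x)"
proof -
  have Z [measurable]: "\<And>i. Z i \<in> borel_measurable M"
    using ind by (auto simp: indep_vars_def)
  let ?s = "2 * sqrt (n * V * x) + B * x"
  have ind': "indep_vars (\<lambda>_. borel) (\<lambda>i w. - Z i w) UNIV"
    by (rule indep_vars_compose2[OF ind]) auto
  define T where "T w = (\<Sum>i<n. Z i w - expectation (Z i))" for w
  have T [measurable]: "T \<in> borel_measurable M"
    unfolding T_def by (intro borel_measurable_sum borel_measurable_diff Z) auto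
  have neg: "(\<Sum>i<n. - Z i w - expectation (\<lambda>w. - Z i w)) = - T w" for w
    by (simp add: T_def flip: sum_negf)
  have "prob {w \<in> space M. ?s \<le> T w} \<le> exp (- x)"
    using bernstein_upper[OF ind bound var pos] by (simp add: T_def)
  moreover have "prob {w \<in> space M. ?s \<le> - T w} \<le> exp (- x)"
    using bernstein_upper[OF ind' _ _ pos] by (simp only: neg) (simp add: bound var)
  moreover have "{w \<in> space M. ?s \<le> \<bar>T w\<bar>} = {w \<in> space M. ?s \<le> T w} \<union> {w \<in> space M. ?s \<le> - T w}"
    by auto
  moreover have "prob ({w \<in> space M. ?s \<le> T w} \<union> {w \<in> space M. ?s \<le> - T w})
      \<le> prob {w \<in> space M. ?s \<le> T w} + prob {w \<in> space M. ?s \<le> - T w}"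
    by (rule measure_Un_le) auto
  ultimately show ?thesis by (simp add: T_def)
qed

section \<open>Sequences of independent pairs\<close>

lemma measurable_Collect_PiM:
  assumes "A \<in> sets N"
  shows "{x \<in> space (PiM UNIV (\<lambda>_. N)). x i \<in> A} \<in> sets (PiM UNIV (\<lambda>_. N))"
proof -
  have "(\<lambda>x. x i) \<in> PiM UNIV (\<lambda>_. N) \<rightarrow>\<^sub>M N"
    by (rule measurable_component_singleton) simp
  from measurable_sets[OF this assms] show ?thesis
    by (simp add: vimage_def Int_def conj_commute)
qed

text \<open>
  Two independent sequences, each with independent terms, form a sequence of independent pairs: the
  rectangles generate the product \<open>\<sigma>\<close>-algebra and their probabilities factor.
\<close>

lemma indep_vars_Pair:
  fixes X :: "nat \<Rightarrow> 'a \<Rightarrow> 'b::second_countable_topology"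
    and Y :: "nat \<Rightarrow> 'a \<Rightarrow> 'c::second_countable_topology"
  assumes X: "indep_vars (\<lambda>_. borel) X UNIV" and Y: "indep_vars (\<lambda>_. borel) Y UNIV"
    and XY: "indep_set
          (sets (vimage_algebra (space M) (\<lambda>w i. X i w) (PiM UNIV (\<lambda>_. borel))))
          (sets (vimage_algebra (space M) (\<lambda>w i. Y i w) (PiM UNIV (\<lambda>_. borel))))"
  shows "indep_vars (\<lambda>_. borel \<Otimes>\<^sub>M borel) (\<lambda>i w. (X i w, Y i w)) UNIV"
proof -
  have [measurable]: "random_variable borel (X i)" "random_variable borel (Y i)" for i
    using X Y by (auto simp: indep_vars_def)
  define G where "G i = {{w \<in> space M. X i w \<in> A \<and> Y i w \<in> B} | A B. A \<in> sets borel \<and> B \<in> sets borel}" for i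
  \<comment> \<open>Independence of the two sequences separates the \<open>X\<close> part from the
    \<open>Y\<close> part; independence within each sequence then separates the indices.\<close>
  have fac: "prob (\<Inter>i\<in>J. {w \<in> space M. X i w \<in> A i \<and> Y i w \<in> B i})
      = (\<Prod>i\<in>J. prob {w \<in> space M. X i w \<in> A i}) * (\<Prod>i\<in>J. prob {w \<in> space M. Y i w \<in> B i})"
    if J: "finite J" "J \<noteq> {}" and AB: "\<And>i. A i \<in> sets borel" "\<And>i. B i \<in> sets borel" for J :: "nat set" and A B
  proof -
    have inX: "(\<Inter>i\<in>J. {w \<in> space M. X i w \<in> A i}) \<in> sets (vimage_algebra (space M) (\<lambda>w i. X i w) (PiM UNIV (\<lambda>_. borel)))"
    proof -
      have "(\<Inter>i\<in>J. {w \<in> space M. X i w \<in> A i}) = (\<lambda>w i. X i w) -` (\<Inter>i\<in>J. {x \<in> space (PiM UNIV (\<lambda>_. borel)). x i \<in> A i}) \<inter> space M"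
        using J by (auto simp: space_PiM)
      moreover have "(\<Inter>i\<in>J. {x \<in> space (PiM UNIV (\<lambda>_. borel)). x i \<in> A i}) \<in> sets (PiM UNIV (\<lambda>_. borel))"
        using J AB by (intro sets.finite_INT) (auto intro!: measurable_Collect_PiM)
      ultimately show ?thesis by (simp add: in_vimage_algebra)
    qed
    have inY: "(\<Inter>i\<in>J. {w \<in> space M. Y i w \<in> B i}) \<in> sets (vimage_algebra (space M) (\<lambda>w i. Y i w) (PiM UNIV (\<lambda>_. borel)))"
    proof -
      have "(\<Inter>i\<in>J. {w \<in> space M. Y i w \<in> B i}) = (\<lambda>w i. Y i w) -` (\<Inter>i\<in>J. {x \<in> space (PiM UNIV (\<lambda>_. borel)). x i \<in> B i}) \<inter> space M"
        using J by (auto simp: space_PiM)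
      moreover have "(\<Inter>i\<in>J. {x \<in> space (PiM UNIV (\<lambda>_. borel)). x i \<in> B i}) \<in> sets (PiM UNIV (\<lambda>_. borel))"
        using J AB by (intro sets.finite_INT) (auto intro!: measurable_Collect_PiM)
      ultimately show ?thesis by (simp add: in_vimage_algebra)
    qed
    have "(\<Inter>i\<in>J. {w \<in> space M. X i w \<in> A i \<and> Y i w \<in> B i})
        = (\<Inter>i\<in>J. {w \<in> space M. X i w \<in> A i}) \<inter> (\<Inter>i\<in>J. {w \<in> space M. Y i w \<in> B i})"
      using J by auto
    also have "prob \<dots> = prob (\<Inter>i\<in>J. {w \<in> space M. X i w \<in> A i}) * prob (\<Inter>i\<in>J. {w \<in> space M. Y i w \<in> B i})"
      by (rule indep_setD[OF XY inX inY])
    also have "prob (\<Inter>i\<in>J. {w \<in> space M. X i w \<in> A i}) = (\<Prod>i\<in>J. prob {w \<in> space M. X i w \<in> A i})"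
      using indep_varsD[OF X J(2,1), of A] AB by (simp add: vimage_def Int_def conj_commute)
    also have "prob (\<Inter>i\<in>J. {w \<in> space M. Y i w \<in> B i}) = (\<Prod>i\<in>J. prob {w \<in> space M. Y i w \<in> B i})"
      using indep_varsD[OF Y J(2,1), of B] AB by (simp add: vimage_def Int_def conj_commute)
    finally show ?thesis .
  qed
  have stable: "Int_stable (G i)" for i
  proof (rule Int_stableI)
    fix a b assume "a \<in> G i" "b \<in> G i"
    then obtain A B A' B' where *: "a = {w \<in> space M. X i w \<in> A \<and> Y i w \<in> B}" "b = {w \<in> space M. X i w \<in> A' \<and> Y i w \<in> B'}"
      "A \<in> sets borel" "B \<in> sets borel" "A' \<in> sets borel" "B' \<in> sets borel"
      unfolding G_def by blast
    then have "a \<inter> b = {w \<in> space M. X i w \<in> A \<inter> A' \<and> Y i w \<in> B \<inter> B'}" by auto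
    with * show "a \<inter> b \<in> G i"
      unfolding G_def by (intro CollectI exI[of _ "A \<inter> A'"] exI[of _ "B \<inter> B'"] conjI) auto
  qed
  have "indep_sets G UNIV"
  proof (rule indep_setsI)
    show "G i \<subseteq> events" for i
    proof
      fix a assume "a \<in> G i"
      then obtain A B where "a = {w \<in> space M. X i w \<in> A \<and> Y i w \<in> B}"
        and [measurable]: "A \<in> sets borel" "B \<in> sets borel"
        unfolding G_def by blast
      moreover have "{w \<in> space M. X i w \<in> A \<and> Y i w \<in> B} \<in> events" by measurable
      ultimately show "a \<in> events" by (simp only:)
    qed
  next
    fix a and J :: "nat set" assume J: "J \<noteq> {}" "J \<subseteq> UNIV" "finite J" and a: "\<forall>j\<in>J. a j \<in> G j"
    have "\<forall>j\<in>J. \<exists>C. a j = {w \<in> space M. X j w \<in> fst C \<and> Y j w \<in> snd C} \<and> fst C \<in> sets borel \<and> snd C \<in> sets borel"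
    proof
      fix j assume "j \<in> J"
      then obtain A B where "a j = {w \<in> space M. X j w \<in> A \<and> Y j w \<in> B}" "A \<in> sets borel" "B \<in> sets borel"
        using a unfolding G_def by blast
      then show "\<exists>C. a j = {w \<in> space M. X j w \<in> fst C \<and> Y j w \<in> snd C} \<and> fst C \<in> sets borel \<and> snd C \<in> sets borel"
        by (intro exI[of _ "(A, B)"]) simp
    qed
    from bchoice[OF this] obtain C where C: "\<forall>j\<in>J. a j = {w \<in> space M. X j w \<in> fst (C j) \<and> Y j w \<in> snd (C j)}
        \<and> fst (C j) \<in> sets borel \<and> snd (C j) \<in> sets borel" ..
    define A where "A j = fst (C j)" for j
    define B where "B j = snd (C j)" for j
    have AB: "\<And>j. j \<in> J \<Longrightarrow> a j = {w \<in> space M. X j w \<in> A j \<and> Y j w \<in> B j} \<and> A j \<in> sets borel \<and> B j \<in> sets borel"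
      using C by (simp add: A_def B_def)
    \<comment> \<open>The factorisation is stated for sets at every index; outside \<open>J\<close>
      they are padded with \<open>UNIV\<close> so that all of them are Borel.\<close>
    define A' where "A' j = (if j \<in> J then A j else UNIV)" for j
    define B' where "B' j = (if j \<in> J then B j else UNIV)" for j
    have m: "A' j \<in> sets borel" "B' j \<in> sets borel" for j using AB by (auto simp: A'_def B'_def)
    have a': "a j = {w \<in> space M. X j w \<in> A' j \<and> Y j w \<in> B' j}" if "j \<in> J" for j
      using AB that by (simp add: A'_def B'_def)
    have "prob (\<Inter>j\<in>J. a j) = (\<Prod>i\<in>J. prob {w \<in> space M. X i w \<in> A' i} * prob {w \<in> space M. Y i w \<in> B' i})"
      using fac[OF J(3,1) m] by (simp add: a' prod.distrib)
    also have "\<dots> = (\<Prod>i\<in>J. prob (a i))"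
    proof (rule prod.cong[OF refl])
      fix i assume i: "i \<in> J"
      show "prob {w \<in> space M. X i w \<in> A' i} * prob {w \<in> space M. Y i w \<in> B' i} = prob (a i)"
        using fac[of "{i}" A' B'] m i by (simp add: a')
    qed
    finally show "prob (\<Inter>j\<in>J. a j) = (\<Prod>j\<in>J. prob (a j))" .
  qed
  then have sig: "indep_sets (\<lambda>i. sigma_sets (space M) (G i)) UNIV"
    by (rule indep_sets_sigma) (rule stable)
  have sub: "{(\<lambda>w. (X i w, Y i w)) -` C \<inter> space M | C. C \<in> sets (borel \<Otimes>\<^sub>M borel)} \<subseteq> sigma_sets (space M) (G i)" for i
  proof -
    have "(\<lambda>w. (X i w, Y i w)) \<in> measurable (Sigma_Algebra.sigma (space M) (G i)) (Sigma_Algebra.sigma (UNIV \<times> UNIV) {A \<times> B | A B. A \<in> sets borel \<and> B \<in> sets borel})"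
    proof (rule measurable_measure_of)
      fix C assume "C \<in> {A \<times> B | A B. A \<in> sets (borel :: 'b measure) \<and> B \<in> sets (borel :: 'c measure)}"
      then obtain A B where C: "C = A \<times> B" "A \<in> sets borel" "B \<in> sets borel" by blast
      have "(\<lambda>w. (X i w, Y i w)) -` C \<inter> space (Sigma_Algebra.sigma (space M) (G i)) = {w \<in> space M. X i w \<in> A \<and> Y i w \<in> B}"
        using C by (auto simp: space_measure_of_conv)
      then have "(\<lambda>w. (X i w, Y i w)) -` C \<inter> space (Sigma_Algebra.sigma (space M) (G i)) \<in> G i"
        unfolding G_def using C by (intro CollectI exI[of _ A] exI[of _ B] conjI) auto
      moreover have "G i \<subseteq> Pow (space M)" unfolding G_def by auto
      ultimately show "(\<lambda>w. (X i w, Y i w)) -` C \<inter> space (Sigma_Algebra.sigma (space M) (G i)) \<in> sets (Sigma_Algebra.sigma (space M) (G i))"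
        by auto
    qed auto
    then have "(\<lambda>w. (X i w, Y i w)) \<in> measurable (Sigma_Algebra.sigma (space M) (G i)) (borel \<Otimes>\<^sub>M borel)"
      by (simp add: pair_measure_def measurable_def sets_measure_of_conv space_measure_of_conv)
    moreover have "G i \<subseteq> Pow (space M)" unfolding G_def by auto
    ultimately show ?thesis
      by (auto dest!: measurable_sets simp: space_measure_of_conv)
  qed
  show ?thesis
    unfolding indep_vars_def2
    by (intro conjI ballI indep_sets_mono_sets[OF sig sub]) measurable
qed

end

section \<open>Nets and noise moments\<close>

text \<open>The net consists of points of \<open>A\<close> itself, one from each occupied cell of
  side \<open>1 / m\<close>, because the support and norm conditions on the weights are available
  only on \<open>A\<close>. Along each axis the floor takes at most \<open>2 * R * m + 1\<close>
  values, the right endpoint included.\<close>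

lemma finite_net_real2:
  fixes A :: "(real^2) set" and R m :: nat
  assumes A: "\<And>x. x \<in> A \<Longrightarrow> \<bar>x$1\<bar> \<le> real R \<and> \<bar>x$2\<bar> \<le> real R" and m: "0 < m"
  obtains N where "N \<subseteq> A" "finite N" "card N \<le> (2 * R * m + 1)\<^sup>2"
    "\<And>x. x \<in> A \<Longrightarrow> \<exists>y\<in>N. \<bar>x$1 - y$1\<bar> \<le> 1 / m \<and> \<bar>x$2 - y$2\<bar> \<le> 1 / m"
proof
  define q where "q x = (\<lfloor>m * x$1\<rfloor>, \<lfloor>m * x$2\<rfloor>)" for x :: "real^2"
  define G where "G = {- int (R * m)..int (R * m)} \<times> {- int (R * m)..int (R * m)}"
  define N where "N = inv_into A q ` (q ` A)"
  have "q x \<in> G" if "x \<in> A" for x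
  proof -
    have "- (real R * m) \<le> m * x$i \<and> m * x$i \<le> real R * m" if "\<bar>x$i\<bar> \<le> real R" for i
    proof -
      have "\<bar>m * x$i\<bar> \<le> real R * m"
        using mult_left_mono[OF that, of "real m"] by (simp add: abs_mult mult.commute)
      then show ?thesis by (simp add: abs_le_iff)
    qed
    from this[of 1] this[of 2] show ?thesis using A[OF that]
      unfolding q_def G_def by (simp add: le_floor_iff floor_le_iff)
  qed
  then have qA: "q ` A \<subseteq> G" by auto
  have finG: "finite G" by (simp add: G_def)
  have "card G = (2 * R * m + 1)\<^sup>2" by (simp add: G_def power2_eq_square nat_add_distrib nat_mult_distrib)
  then have cqA: "card (q ` A) \<le> (2 * R * m + 1)\<^sup>2"
    using card_mono[OF finG qA] by simp
  have fqA: "finite (q ` A)" using finG qA finite_subset by blast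
  show "N \<subseteq> A" unfolding N_def by (auto intro: inv_into_into)
  show "finite N" using fqA by (simp add: N_def)
  show "card N \<le> (2 * R * m + 1)\<^sup>2"
    unfolding N_def using card_image_le[OF fqA] cqA order_trans by blast
  fix x assume x: "x \<in> A"
  let ?y = "inv_into A q (q x)"
  have y: "?y \<in> N" "q ?y = q x" using x by (auto simp: N_def f_inv_into_f)
  have close: "\<bar>a - b\<bar> \<le> 1 / m" if "\<lfloor>m * b\<rfloor> = \<lfloor>m * a\<rfloor>" for a b :: real
  proof -
    have "\<bar>m * a - m * b\<bar> \<le> 1" using that by linarith
    then have "m * \<bar>a - b\<bar> \<le> 1" by (simp add: abs_mult flip: right_diff_distrib)
    then show ?thesis using m by (simp add: field_simps)
  qed
  show "\<exists>y\<in>N. \<bar>x$1 - y$1\<bar> \<le> 1 / m \<and> \<bar>x$2 - y$2\<bar> \<le> 1 / m"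
    using y close by (intro bexI[of _ ?y]) (auto simp: q_def)
qed

text \<open>Layer sum for \<open>E \<bar>\<epsilon>\<bar>^q\<close>: the term \<open>k\<close> is
  \<open>(k + 1)^q\<close> times a bound on the probability of
  \<open>\<bar>\<epsilon>\<bar> \<ge> k\<close>, the factor 2 accounting for two tails. It depends
  on \<open>S\<close> only and so serves all symmetric densities of the class at once.\<close>

definition moment_bound :: "procedure \<Rightarrow> real \<Rightarrow> real" where
  "moment_bound S q = (\<Sum>k. real (k + 1) powr q * (2 * Ups S * exp (- Omg S * real k powr omg S)))"

lemma summable_moment:
  fixes a b c q :: real
  assumes "0 < a" "0 < b"
  shows "summable (\<lambda>k. real (k + 1) powr q * (c * exp (- a * real k powr b)))"
proof -
  have "(\<lambda>k. real (k + 1) powr q * exp (- a * real k powr b)) \<in> O(\<lambda>k. 1 / real k ^ 2)"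
    using assms by real_asymp
  moreover have "summable (\<lambda>k. norm (1 / real k ^ 2))"
    using inverse_power_summable[of 2] by (simp add: inverse_eq_divide)
  ultimately have "summable (\<lambda>k. real (k + 1) powr q * exp (- a * real k powr b))"
    by (rule summable_comparison_test_bigo[rotated])
  from summable_mult[OF this, of c] show ?thesis
    by (simp add: mult_ac)
qed

text \<open>The left tail is the image of the right tail under negation.\<close>

lemma emeasure_symmetric_tail:
  fixes \<mu> :: "real measure"
  assumes sets: "sets \<mu> = sets borel" and sym: "symmetric_law \<mu>"
    and tail: "emeasure \<mu> {x..} \<le> ennreal T" and T: "0 \<le> T"
  shows "emeasure \<mu> {y. x \<le> \<bar>y\<bar>} \<le> ennreal (2 * T)"
proof -
  have [measurable_cong]: "sets \<mu> = sets borel" by fact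
  have sp: "space \<mu> = UNIV" using sets_eq_imp_space_eq[OF sets] by simp
  have "emeasure \<mu> {..-x} = emeasure (distr \<mu> borel uminus) {..-x}"
    using sym by (simp add: symmetric_law_def)
  also have "\<dots> = emeasure \<mu> {x..}"
    by (subst emeasure_distr) (auto simp: sp vimage_def intro!: arg_cong[where f = "emeasure \<mu>"])
  finally have "emeasure \<mu> {..-x} = emeasure \<mu> {x..}" .
  have "emeasure \<mu> {y. x \<le> \<bar>y\<bar>} \<le> emeasure \<mu> ({x..} \<union> {..-x})"
    by (rule emeasure_mono) (auto simp: sets)
  also have "\<dots> \<le> emeasure \<mu> {x..} + emeasure \<mu> {..-x}"
    by (rule emeasure_subadditive) (auto simp: sets)
  also have "\<dots> \<le> ennreal T + ennreal T"
    using tail \<open>emeasure \<mu> {..-x} = emeasure \<mu> {x..}\<close> by (intro add_mono) auto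
  also have "\<dots> = ennreal (2 * T)" using T by (simp flip: ennreal_plus)
  finally show ?thesis .
qed

lemma noise_tail:
  assumes p: "p \<in> noise_class S" and sym: "symmetric_law (density lborel (\<lambda>x. ennreal (p x)))"
    and U: "0 < Ups S" and x: "0 \<le> x"
  shows "emeasure (density lborel (\<lambda>x. ennreal (p x))) {y. x \<le> \<bar>y\<bar>}
    \<le> ennreal (2 * Ups S * exp (- Omg S * x powr omg S))"
proof -
  have [measurable]: "p \<in> borel_measurable borel" using p by (simp add: noise_class_def)
  have "emeasure (density lborel (\<lambda>x. ennreal (p x))) {x..} = (\<integral>\<^sup>+y\<in>{x..}. ennreal (p y) \<partial>lborel)"
    by (simp add: emeasure_density)
  also have "\<dots> \<le> ennreal (Ups S * exp (- Omg S * x powr omg S))"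
    using p x by (simp add: noise_class_def)
  finally have "emeasure (density lborel (\<lambda>x. ennreal (p x))) {x..} \<le> ennreal (Ups S * exp (- Omg S * x powr omg S))" .
  from emeasure_symmetric_tail[OF _ sym this] U show ?thesis by (simp add: mult.assoc)
qed

lemma noise_moment:
  assumes p: "p \<in> noise_class S" and sym: "symmetric_law (density lborel (\<lambda>x. ennreal (p x)))"
    and par: "0 < Ups S" "0 < Omg S" "0 < omg S" and q: "0 \<le> q"
  shows "(\<integral>\<^sup>+x. ennreal (\<bar>x\<bar> powr q) \<partial>density lborel (\<lambda>x. ennreal (p x))) \<le> ennreal (moment_bound S q)"
proof -
  let ?\<mu> = "density lborel (\<lambda>x. ennreal (p x))"
  let ?a = "\<lambda>k. real (k + 1) powr q" and ?T = "\<lambda>k. 2 * Ups S * exp (- Omg S * real k powr omg S)"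
  have [measurable]: "p \<in> borel_measurable borel" using p by (simp add: noise_class_def)
  have set [measurable]: "{y. real k \<le> \<bar>y\<bar>} \<in> sets borel" for k
    by measurable
  \<comment> \<open>The single term whose index is the integer part of \<open>\<bar>x\<bar>\<close>
    already dominates; the other terms are nonnegative.\<close>
  have pt: "ennreal (\<bar>x\<bar> powr q) \<le> (\<Sum>k. ennreal (?a k) * indicator {y. real k \<le> \<bar>y\<bar>} x)" for x
  proof -
    define k where "k = nat \<lfloor>\<bar>x\<bar>\<rfloor>"
    have k: "real k \<le> \<bar>x\<bar>" "\<bar>x\<bar> \<le> real (k + 1)" unfolding k_def by simp linarith
    have "ennreal (\<bar>x\<bar> powr q) \<le> ennreal (?a k) * indicator {y. real k \<le> \<bar>y\<bar>} x"
      using k q by (auto intro!: ennreal_leI powr_mono2)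
    also have "\<dots> \<le> (\<Sum>k. ennreal (?a k) * indicator {y. real k \<le> \<bar>y\<bar>} x)"
    proof -
      define g :: "nat \<Rightarrow> ennreal" where "g k = ennreal (?a k) * indicator {y. real k \<le> \<bar>y\<bar>} x" for k
      have "g k = sum g {k}" by simp
      also have "\<dots> \<le> suminf g" by (rule sum_le_suminf) auto
      finally show ?thesis by (simp only: g_def[abs_def])
    qed
    finally show ?thesis .
  qed
  have "(\<integral>\<^sup>+x. ennreal (\<bar>x\<bar> powr q) \<partial>?\<mu>) \<le> (\<integral>\<^sup>+x. (\<Sum>k. ennreal (?a k) * indicator {y. real k \<le> \<bar>y\<bar>} x) \<partial>?\<mu>)"
    by (intro nn_integral_mono pt)
  also have "\<dots> = (\<Sum>k. \<integral>\<^sup>+x. ennreal (?a k) * indicator {y. real k \<le> \<bar>y\<bar>} x \<partial>?\<mu>)"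
    by (rule nn_integral_suminf) measurable
  also have "\<dots> = (\<Sum>k. ennreal (?a k) * emeasure ?\<mu> {y. real k \<le> \<bar>y\<bar>})"
    by (simp add: nn_integral_cmult_indicator)
  also have "\<dots> \<le> (\<Sum>k. ennreal (?a k * ?T k))"
    using par noise_tail[OF p sym] by (intro suminf_le) (auto simp: ennreal_mult intro!: mult_left_mono)
  also have "\<dots> = ennreal (moment_bound S q)"
    unfolding moment_bound_def
    by (rule suminf_ennreal2) (use par summable_moment[of "Omg S" "omg S" q "2 * Ups S"] in \<open>auto simp: mult.assoc\<close>)
  finally show ?thesis .
qed

lemma moment_bound_nonneg: "0 < Ups S \<Longrightarrow> 0 < Omg S \<Longrightarrow> 0 < omg S \<Longrightarrow> 0 \<le> moment_bound S q"
  unfolding moment_bound_def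
  by (rule suminf_nonneg) (use summable_moment[of "Omg S" "omg S" q "2 * Ups S"] in \<open>auto simp: mult.assoc\<close>)

lemma
  assumes p: "p \<in> noise_class S" and sym: "symmetric_law (density lborel (\<lambda>x. ennreal (p x)))"
    and par: "0 < Ups S" "0 < Omg S" "0 < omg S"
  shows integrable_noise_square: "integrable lborel (\<lambda>x. x\<^sup>2 * p x)"
    and noise_square_le: "(LBINT x. x\<^sup>2 * p x) \<le> moment_bound S 2"
proof -
  have [measurable]: "p \<in> borel_measurable borel" and p0: "\<And>x. 0 \<le> p x"
    using p by (auto simp: noise_class_def)
  have "(\<integral>\<^sup>+x. ennreal (x\<^sup>2 * p x) \<partial>lborel) = (\<integral>\<^sup>+x. ennreal (\<bar>x\<bar> powr 2) \<partial>density lborel (\<lambda>x. ennreal (p x)))"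
    using p0 by (subst nn_integral_density) (auto simp: ennreal_mult mult.commute intro!: nn_integral_cong)
  also have "\<dots> \<le> ennreal (moment_bound S 2)"
    by (rule noise_moment[OF p sym par]) simp
  finally have le: "(\<integral>\<^sup>+x. ennreal (x\<^sup>2 * p x) \<partial>lborel) \<le> ennreal (moment_bound S 2)" .
  show int: "integrable lborel (\<lambda>x. x\<^sup>2 * p x)"
  proof (rule integrableI_bounded)
    have "(\<integral>\<^sup>+x. ennreal (norm (x\<^sup>2 * p x)) \<partial>lborel) = (\<integral>\<^sup>+x. ennreal (x\<^sup>2 * p x) \<partial>lborel)"
      using p0 by (simp add: abs_mult)
    also have "\<dots> < \<infinity>" using le by (rule order_le_less_trans) simp
    finally show "(\<integral>\<^sup>+x. ennreal (norm (x\<^sup>2 * p x)) \<partial>lborel) < \<infinity>" .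
  qed simp
  have "ennreal (LBINT x. x\<^sup>2 * p x) \<le> ennreal (moment_bound S 2)"
    using nn_integral_eq_integral[OF int] le p0 by simp
  then show "(LBINT x. x\<^sup>2 * p x) \<le> moment_bound S 2"
    using moment_bound_nonneg[OF par] by (simp add: ennreal_le_iff)
qed

text \<open>A real supremum dominates its members only when they are bounded above. The uniform
  second moment supplies this, so \<open>sigma2\<close> really bounds every variance in the
  class.\<close>

lemma
  assumes p: "p \<in> noise_class S" and sym: "symmetric_law (density lborel (\<lambda>x. ennreal (p x)))"
    and prob: "prob_space (density lborel (\<lambda>x. ennreal (p x)))"
    and par: "0 < Ups S" "0 < Omg S" "0 < omg S"
  shows noise_variance_le_sigma: "(LBINT x. x\<^sup>2 * p x) \<le> (sigma S)\<^sup>2"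
    and sigma_nonneg: "0 \<le> sigma S"
proof -
  have le: "(LBINT x. x\<^sup>2 * p x) \<le> sigma2 S"
    unfolding sigma2_def
  proof (rule cSUP_upper)
    show "bdd_above ((\<lambda>p. LBINT x. x\<^sup>2 * p x) ` {p \<in> noise_class S.
        prob_space (density lborel (\<lambda>x. ennreal (p x))) \<and> symmetric_law (density lborel (\<lambda>x. ennreal (p x)))})"
      by (rule bdd_aboveI2[where M = "moment_bound S 2"]) (blast intro: noise_square_le par)
  qed (use p sym prob in blast)
  have "0 \<le> (LBINT x. x\<^sup>2 * p x)"
    using p by (intro Bochner_Integration.integral_nonneg) (simp add: noise_class_def)
  with le show "(LBINT x. x\<^sup>2 * p x) \<le> (sigma S)\<^sup>2" "0 \<le> sigma S" by (simp_all add: sigma_def)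
qed

section \<open>Kernel and bias\<close>

locale procedure_setup =
  fixes S :: procedure
  assumes r: "1 \<le> rexp S"
    and noise_params: "0 < Ups S" "0 < Omg S" "Omg S \<le> 1" "0 < omg S"
    and kernel_sym: "\<forall>u. kern S (- u) = kern S u"
    and kernel_supp: "closure {u. kern S u \<noteq> 0} \<subseteq> {-1/2..1/2}"
    and kernel_int: "(LBINT u. kern S u) = 1"
    and kernel_lip: "0 < lipK S" "\<forall>u v. \<bar>kern S u - kern S v\<bar> \<le> lipK S * \<bar>u - v\<bar>"
    and glow: "0 < glow S" "glow S < 1"
    and design_nonneg: "\<forall>x. 0 \<le> design S x"
    and design_low: "glow S \<le> (INF x\<in>cbox (vec (-3)) (vec 3). design S x)"
begin

lemma design_ge_glow:
  assumes "x \<in> cbox (vec (-3)) (vec 3)"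
  shows "glow S \<le> design S x"
proof -
  have "(INF x\<in>cbox (vec (-3)) (vec 3). design S x) \<le> design S x"
    using assms design_nonneg by (intro cINF_lower bdd_belowI2[of _ 0]) auto
  then show ?thesis using design_low by simp
qed

lemma kern_lipschitz: "\<bar>kern S u - kern S v\<bar> \<le> lipK S * \<bar>u - v\<bar>"
  using kernel_lip by blast

text \<open>Strictly beyond 1/2 this is the support condition; the endpoints follow from continuity,
  by moving \<open>u\<close> outwards by \<open>e / lipK S\<close>.\<close>

lemma kern_eq_0:
  assumes "1/2 \<le> \<bar>u\<bar>"
  shows "kern S u = 0"
proof -
  have out: "kern S v = 0" if "1/2 < \<bar>v\<bar>" for v
    using that kernel_supp closure_subset[of "{u. kern S u \<noteq> 0}"] by (fastforce simp: abs_if split: if_splits)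
  have "\<bar>kern S u\<bar> \<le> 0 + e" if "0 < e" for e
  proof -
    define v where "v = u + sgn u * (e / lipK S)"
    have "0 < e / lipK S" using that kernel_lip by simp
    moreover have "v = (if 0 < u then u + e / lipK S else u - e / lipK S)"
      using assms by (auto simp: v_def sgn_if)
    ultimately have "1/2 < \<bar>v\<bar>" using assms by (cases "0 < u"; simp only: if_True if_False; linarith)
    then have "\<bar>kern S u\<bar> = \<bar>kern S u - kern S v\<bar>" using out by simp
    also have "\<dots> \<le> lipK S * \<bar>u - v\<bar>" by (rule kern_lipschitz)
    also have "\<bar>u - v\<bar> \<le> e / lipK S" using that kernel_lip by (simp add: v_def abs_mult sgn_if)
    finally show ?thesis using kernel_lip by (simp add: mult_left_mono)
  qed
  then have "\<bar>kern S u\<bar> \<le> 0" by (rule field_le_epsilon)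
  then show ?thesis by simp
qed

text \<open>Every point of the support is within 1/2 of an endpoint, where the kernel
  vanishes.\<close>

lemma kern_le_lipK: "\<bar>kern S u\<bar> \<le> lipK S / 2"
proof (cases "1/2 \<le> \<bar>u\<bar>")
  case True then show ?thesis using kern_eq_0 kernel_lip by simp
next
  case False
  define v :: real where "v = (if 0 \<le> u then 1/2 else -1/2)"
  have "\<bar>kern S u\<bar> = \<bar>kern S u - kern S v\<bar>" using kern_eq_0[of v] by (simp add: v_def)
  also have "\<dots> \<le> lipK S * \<bar>u - v\<bar>" by (rule kern_lipschitz)
  also have "\<dots> \<le> lipK S * (1/2)" using False kernel_lip by (intro mult_left_mono) (auto simp: v_def)
  finally show ?thesis by simp
qed

lemma kern_le_sup: "\<bar>kern S u\<bar> \<le> kernel_sup S"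
  unfolding kernel_sup_def by (rule cSUP_upper[OF _ bdd_aboveI2[OF kern_le_lipK]]) simp

lemma kernel_sup_le: "kernel_sup S \<le> lipK S / 2"
  unfolding kernel_sup_def by (rule cSUP_least[OF _ kern_le_lipK]) simp

lemma kernel_sup_nonneg: "0 \<le> kernel_sup S"
  using kern_le_sup[of 0] by simp

lemma continuous_kern: "continuous_on UNIV (kern S)"
proof (rule lipschitz_on_continuous_on)
  show "(lipK S)-lipschitz_on UNIV (kern S)"
    using kernel_lip by (intro lipschitz_onI) (auto simp: dist_real_def)
qed

lemma kern_borel [measurable]: "kern S \<in> borel_measurable borel"
  by (rule borel_measurable_continuous_onI) (rule continuous_kern)

lemma abs_kern_le_indicator: "\<bar>kern S u\<bar> \<le> kernel_sup S * indicator {-1/2..1/2} u"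
  using kern_le_sup[of u] kern_eq_0[of u] by (cases "u \<in> {-1/2..1/2}") (auto simp: abs_if split: if_splits)

lemma integrable_kern_times:
  assumes [measurable]: "g \<in> borel_measurable borel" and g: "\<And>u. \<bar>g u\<bar> \<le> C"
  shows "integrable lborel (\<lambda>u. kern S u * g u)"
proof (rule Bochner_Integration.integrable_bound)
  show "integrable lborel (\<lambda>u. kernel_sup S * C * indicator {-1/2..1/2::real} u)"
    by (intro integrable_mult_right) (simp add: integrable_indicator_iff)
  have "\<bar>kern S u * g u\<bar> \<le> (kernel_sup S * indicator {-1/2..1/2} u) * C" for u
    unfolding abs_mult using g[of u] abs_kern_le_indicator[of u] kernel_sup_nonneg by (intro mult_mono) auto
  moreover have "0 \<le> C" using g[of 0] by simp
  ultimately show "AE u in lborel. norm (kern S u * g u) \<le> norm (kernel_sup S * C * indicator {-1/2..1/2} u)"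
    using kernel_sup_nonneg by (auto simp: mult_ac abs_mult)
qed measurable

lemma integrable_kern: "integrable lborel (kern S)"
  using integrable_kern_times[of "\<lambda>_. 1" 1] by simp

text \<open>\<open>C\<close> secures integrability; the constant of the estimate is the bound
  \<open>B\<close> on the support of the kernel.\<close>

lemma integral_abs_kern_times_le:
  assumes [measurable]: "g \<in> borel_measurable borel" and g: "\<And>u. \<bar>g u\<bar> \<le> C"
    and le: "\<And>u. \<bar>u\<bar> \<le> 1/2 \<Longrightarrow> \<bar>g u\<bar> \<le> B" 
  shows "\<bar>LBINT u. kern S u * g u\<bar> \<le> kernel_L1 S * B"
proof -
  have "\<bar>LBINT u. kern S u * g u\<bar> \<le> (LBINT u. \<bar>kern S u * g u\<bar>)"
    by (rule integral_abs_bound)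
  also have "\<dots> \<le> (LBINT u. \<bar>kern S u\<bar> * B)"
  proof (rule integral_mono)
    show "integrable lborel (\<lambda>u. \<bar>kern S u * g u\<bar>)"
      by (intro integrable_abs integrable_kern_times[OF _ g]) measurable
    show "integrable lborel (\<lambda>u. \<bar>kern S u\<bar> * B)"
      using integrable_abs[OF integrable_kern] by simp
    show "\<bar>kern S u * g u\<bar> \<le> \<bar>kern S u\<bar> * B" for u
      using le[of u] kern_eq_0[of u] by (cases "\<bar>u\<bar> \<le> 1/2") (auto simp: abs_mult mult_left_mono)
  qed
  finally show ?thesis by (simp add: kernel_L1_def)
qed

lemma kernel_L1_le_sup: "kernel_L1 S \<le> kernel_sup S"
proof -
  have "kernel_L1 S \<le> (LBINT u. kernel_sup S * indicator {-1/2..1/2::real} u)"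
    unfolding kernel_L1_def using integrable_abs[OF integrable_kern] abs_kern_le_indicator
    by (intro integral_mono integrable_mult_right) (auto simp: integrable_indicator_iff)
  then show ?thesis by simp
qed

lemma kernel_L1_ge_1: "1 \<le> kernel_L1 S"
proof -
  have "\<bar>LBINT u. kern S u\<bar> \<le> (LBINT u. \<bar>kern S u\<bar>)" by (rule integral_abs_bound)
  then show ?thesis using kernel_int by (simp add: kernel_L1_def)
qed

lemma kernel_sup_ge_1: "1 \<le> kernel_sup S"
  using kernel_L1_ge_1 kernel_L1_le_sup by simp

text \<open>Unit mass forces the L1 norm, and hence the sup norm over a support of length one, to be
  at least 1; the sup norm is at most half the Lipschitz constant.\<close>

lemma lipK_ge_2: "2 \<le> lipK S"
  using kernel_sup_le kernel_sup_ge_1 by simp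

end

section \<open>Local errors of the link and their maximal function\<close>

locale link_setup = procedure_setup +
  fixes f :: "real \<Rightarrow> real" and M \<beta> :: real
  assumes f_bound: "\<bar>f y\<bar> \<le> M" and f_holder: "\<bar>f y - f z\<bar> \<le> M * \<bar>y - z\<bar> powr \<beta>"
    and \<beta>: "0 < \<beta>"
begin

lemma M_nonneg: "0 \<le> M"
  using f_bound[of 0] by simp

text \<open>Stated for a general function because \<open>f\<close>, \<open>local_dev\<close> and
  \<open>Delta\<close> share the Hoelder exponent.\<close>

lemma holder_imp_continuous:
  fixes g :: "real \<Rightarrow> real"
  assumes "\<And>y z. \<bar>g y - g z\<bar> \<le> C * \<bar>y - z\<bar> powr \<beta>"
  shows "continuous_on UNIV g"
proof -
  have "isCont g x" for x
  proof -
    have "((\<lambda>y. \<bar>y - x\<bar>) \<longlongrightarrow> \<bar>x - x\<bar>) (at x)"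
      by (intro tendsto_intros)
    then have "((\<lambda>y. \<bar>y - x\<bar> powr \<beta>) \<longlongrightarrow> \<bar>x - x\<bar> powr \<beta>) (at x)"
      by (rule tendsto_powr'[OF _ tendsto_const]) (use \<beta> in auto)
    then have "((\<lambda>y. C * \<bar>y - x\<bar> powr \<beta>) \<longlongrightarrow> 0) (at x)"
      using tendsto_mult_right_zero[of _ "at x" C] by simp
    then have "((\<lambda>y. g y - g x) \<longlongrightarrow> 0) (at x)"
      by (rule Lim_null_comparison[rotated]) (simp add: assms)
    then show ?thesis by (simp add: isCont_def LIM_zero_iff)
  qed
  then show ?thesis by (simp add: continuous_on_eq_continuous_at)
qed

lemma continuous_f: "continuous_on UNIV f"
  by (rule holder_imp_continuous) (rule f_holder)

lemma f_borel [measurable]: "f \<in> borel_measurable borel"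
  by (rule borel_measurable_continuous_onI) (rule continuous_f)

text \<open>The error of one-dimensional kernel smoothing at \<open>z\<close>, written after the
  substitution \<open>u = z + \<delta> * v\<close>. In this form it makes sense for \<delta> zero or
  negative, values that arise because the step is an inner product of directions.\<close>

definition local_dev :: "real \<Rightarrow> real \<Rightarrow> real" where
  "local_dev \<delta> z = (LBINT v. kern S v * (f (z + \<delta> * v) - f z))"

lemma f_diff_le: "\<bar>f y - f z\<bar> \<le> 2 * M"
  using f_bound[of y] f_bound[of z] by linarith

lemma Delta_eq: "Delta S f h z = (SUP \<delta>\<in>{0<..h}. \<bar>local_dev \<delta> z\<bar>)"
  unfolding Delta_def
proof (rule SUP_cong[OF refl])
  fix \<delta> assume "\<delta> \<in> {0<..h}"
  then show "\<bar>1 / \<delta> * (LBINT u. kern S ((u - z) / \<delta>) * (f u - f z))\<bar> = \<bar>local_dev \<delta> z\<bar>"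
    by (subst lborel_integral_real_affine[where t = z and c = \<delta>]) (auto simp: local_dev_def)
qed

text \<open>The substitution \<open>v\<close> to \<open>- v\<close> leaves an even kernel
  unchanged.\<close>

lemma local_dev_uminus: "local_dev (- \<delta>) z = local_dev \<delta> z"
  unfolding local_dev_def
  by (subst lborel_integral_real_affine[where t = 0 and c = "-1"]) (simp_all add: kernel_sym)

lemma local_dev_zero: "local_dev 0 z = 0"
  by (simp add: local_dev_def)

lemma local_dev_le: "0 \<le> \<delta> \<Longrightarrow> \<bar>local_dev \<delta> z\<bar> \<le> kernel_L1 S * (M * (\<delta> / 2) powr \<beta>)"
  unfolding local_dev_def
proof (rule integral_abs_kern_times_le)
  show "\<bar>f (z + \<delta> * u) - f z\<bar> \<le> 2 * M" for u by (rule f_diff_le)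
next
  fix u :: real assume u: "\<bar>u\<bar> \<le> 1/2" and \<delta>: "0 \<le> \<delta>"
  have "\<bar>f (z + \<delta> * u) - f z\<bar> \<le> M * \<bar>\<delta> * u\<bar> powr \<beta>"
    using f_holder[of "z + \<delta> * u" z] by simp
  also have "\<dots> \<le> M * (\<delta> / 2) powr \<beta>"
  proof (intro mult_left_mono powr_mono2)
    show "\<bar>\<delta> * u\<bar> \<le> \<delta> / 2" using mult_left_mono[OF u \<delta>] \<delta> by (simp add: abs_mult)
  qed (use \<beta> M_nonneg in auto)
  finally show "\<bar>f (z + \<delta> * u) - f z\<bar> \<le> M * (\<delta> / 2) powr \<beta>" .
qed measurable

text \<open>The constant does not depend on \<delta>, so the supremum over \<delta> inherits it.
  This makes \<open>Delta\<close> continuous and its averages over intervals genuine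
  integrals.\<close>

lemma local_dev_holder: "\<bar>local_dev \<delta> z - local_dev \<delta> z'\<bar> \<le> kernel_L1 S * (2 * M * \<bar>z - z'\<bar> powr \<beta>)"
proof -
  have int: "integrable lborel (\<lambda>v. kern S v * (f (z + \<delta> * v) - f z))" for z
    by (rule integrable_kern_times[OF _ f_diff_le]) measurable
  have "local_dev \<delta> z - local_dev \<delta> z' = (LBINT v. kern S v * ((f (z + \<delta> * v) - f (z' + \<delta> * v)) - (f z - f z')))"
    unfolding local_dev_def by (subst Bochner_Integration.integral_diff[OF int int, symmetric]) (simp add: algebra_simps)
  also have "\<bar>\<dots>\<bar> \<le> kernel_L1 S * (2 * M * \<bar>z - z'\<bar> powr \<beta>)"
  proof (rule integral_abs_kern_times_le)
    show "\<bar>f (z + \<delta> * u) - f (z' + \<delta> * u) - (f z - f z')\<bar> \<le> 2 * M * \<bar>z - z'\<bar> powr \<beta>" for u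
      using f_holder[of "z + \<delta> * u" "z' + \<delta> * u"] f_holder[of z z'] by simp
    then show "\<bar>f (z + \<delta> * u) - f (z' + \<delta> * u) - (f z - f z')\<bar> \<le> 2 * M * \<bar>z - z'\<bar> powr \<beta>" for u .
  qed measurable
  finally show ?thesis .
qed

lemma bdd_local_dev: "bdd_above ((\<lambda>\<delta>. \<bar>local_dev \<delta> z\<bar>) ` {0<..h})"
proof (rule bdd_aboveI2)
  fix \<delta> assume "\<delta> \<in> {0<..h}"
  then have "M * (\<delta> / 2) powr \<beta> \<le> M * (h / 2) powr \<beta>"
    using M_nonneg \<beta> by (intro mult_left_mono powr_mono2) auto
  with \<open>\<delta> \<in> {0<..h}\<close> show "\<bar>local_dev \<delta> z\<bar> \<le> kernel_L1 S * (M * (h / 2) powr \<beta>)"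
    using local_dev_le[of \<delta> z] kernel_L1_ge_1 by (smt (verit) mult_left_mono greaterThanAtMost_iff)
qed

lemma local_dev_le_Delta: "0 < h \<Longrightarrow> \<bar>\<delta>\<bar> \<le> h \<Longrightarrow> \<bar>local_dev \<delta> z\<bar> \<le> Delta S f h z"
proof -
  assume h: "0 < h" and \<delta>: "\<bar>\<delta>\<bar> \<le> h"
  have pos: "\<bar>local_dev \<delta>' z\<bar> \<le> Delta S f h z" if "0 < \<delta>'" "\<delta>' \<le> h" for \<delta>'
    unfolding Delta_eq using that by (intro cSUP_upper bdd_local_dev) auto
  consider "\<delta> = 0" | "0 < \<delta>" | "\<delta> < 0" by linarith
  then show ?thesis
  proof cases
    case 1 then show ?thesis using pos[of h] h by (simp add: local_dev_zero)
  next
    case 2 then show ?thesis using pos[of \<delta>] \<delta> by simp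
  next
    case 3 then show ?thesis using pos[of "- \<delta>"] \<delta> by (simp add: local_dev_uminus)
  qed
qed

lemma Delta_nonneg: "0 < h \<Longrightarrow> 0 \<le> Delta S f h z"
  using local_dev_le_Delta[of h 0 z] by simp

lemma Delta_least:
  assumes "0 < h" "\<And>\<delta>. 0 < \<delta> \<Longrightarrow> \<delta> \<le> h \<Longrightarrow> \<bar>local_dev \<delta> z\<bar> \<le> C"
  shows "Delta S f h z \<le> C"
  unfolding Delta_eq using assms by (intro cSUP_least) auto

lemma Delta_le: "0 < h \<Longrightarrow> Delta S f h z \<le> kernel_L1 S * (M * (h / 2) powr \<beta>)"
proof (rule Delta_least)
  fix \<delta> assume "0 < \<delta>" "\<delta> \<le> h"
  then have "M * (\<delta> / 2) powr \<beta> \<le> M * (h / 2) powr \<beta>"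
    using M_nonneg \<beta> by (intro mult_left_mono powr_mono2) auto
  then show "\<bar>local_dev \<delta> z\<bar> \<le> kernel_L1 S * (M * (h / 2) powr \<beta>)"
    using local_dev_le[of \<delta> z] kernel_L1_ge_1 \<open>0 < \<delta>\<close> by (smt (verit) mult_left_mono)
qed

lemma Delta_mono: "0 < h \<Longrightarrow> h \<le> h' \<Longrightarrow> Delta S f h z \<le> Delta S f h' z"
  by (rule Delta_least) (auto intro!: local_dev_le_Delta)

lemma Delta_holder:
  assumes h: "0 < h"
  shows "\<bar>Delta S f h y - Delta S f h z\<bar> \<le> (kernel_L1 S * 2 * M) * \<bar>y - z\<bar> powr \<beta>"
proof -
  have "Delta S f h y \<le> Delta S f h z + (kernel_L1 S * 2 * M) * \<bar>y - z\<bar> powr \<beta>" for y z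
  proof (rule Delta_least[OF h])
    fix \<delta> assume "0 < \<delta>" "\<delta> \<le> h"
    then show "\<bar>local_dev \<delta> y\<bar> \<le> Delta S f h z + (kernel_L1 S * 2 * M) * \<bar>y - z\<bar> powr \<beta>"
      using local_dev_holder[of \<delta> y z] local_dev_le_Delta[OF h, of \<delta> z] by (simp add: mult.assoc)
  qed
  from this[of y z] this[of z y] show ?thesis by (simp add: abs_minus_commute abs_le_iff)
qed

lemma continuous_Delta: "0 < h \<Longrightarrow> continuous_on A (Delta S f h)"
  by (rule continuous_on_subset[OF holder_imp_continuous]) (auto intro: Delta_holder)

lemma set_integrable_Delta: "0 < h \<Longrightarrow> set_integrable lborel {a..b} (Delta S f h)"
  by (rule borel_integrable_atLeastAtMost') (rule continuous_Delta)

lemma Delta_average_bounds: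
  assumes h: "0 < h" and a: "0 < a" and le: "\<And>z. \<bar>z - y\<bar> \<le> a \<Longrightarrow> lo \<le> Delta S f h z \<and> Delta S f h z \<le> C"
  shows "lo \<le> (1 / (2 * a)) * (LBINT z:{y - a..y + a}. Delta S f h z)"
    and "(1 / (2 * a)) * (LBINT z:{y - a..y + a}. Delta S f h z) \<le> C"
proof -
  have c: "(LBINT z:{y - a..y + a}. c) = 2 * a * c" for c :: real
    using a by (simp add: set_lebesgue_integral_def)
  have i: "set_integrable lborel {y - a..y + a} (\<lambda>_. c)" for c :: real
    by (rule borel_integrable_atLeastAtMost') simp
  have "(LBINT z:{y - a..y + a}. Delta S f h z) \<le> (LBINT z:{y - a..y + a}. C)"
    by (rule set_integral_mono[OF set_integrable_Delta[OF h] i]) (use le in \<open>auto simp: abs_le_iff\<close>)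
  then show "(1 / (2 * a)) * (LBINT z:{y - a..y + a}. Delta S f h z) \<le> C"
    using a by (simp only: c) (simp add: field_simps)
  have "(LBINT z:{y - a..y + a}. lo) \<le> (LBINT z:{y - a..y + a}. Delta S f h z)"
    by (rule set_integral_mono[OF i set_integrable_Delta[OF h]]) (use le in \<open>auto simp: abs_le_iff\<close>)
  then show "lo \<le> (1 / (2 * a)) * (LBINT z:{y - a..y + a}. Delta S f h z)"
    using a by (simp only: c) (simp add: field_simps)
qed

lemma Delta_average_le_star:
  assumes h: "0 < h" and a: "0 < a"
  shows "(1 / (2 * a)) * (LBINT z:{y - a..y + a}. Delta S f h z) \<le> Delta_star S f h y"
  unfolding Delta_star_def
proof (rule cSUP_upper)
  show "bdd_above ((\<lambda>a. (1 / (2 * a)) * (LBINT z:{y - a..y + a}. Delta S f h z)) ` {0<..})"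
    by (rule bdd_aboveI2[where M = "kernel_L1 S * (M * (h / 2) powr \<beta>)"])
      (rule Delta_average_bounds(2)[OF h, where lo = 0]; use h in \<open>auto intro!: Delta_le Delta_nonneg\<close>)
qed (use a in simp)

lemma Delta_star_least:
  assumes "\<And>a. 0 < a \<Longrightarrow> (1 / (2 * a)) * (LBINT z:{y - a..y + a}. Delta S f h z) \<le> C"
  shows "Delta_star S f h y \<le> C"
  unfolding Delta_star_def by (rule cSUP_least) (use assms in auto)

lemma Delta_star_le: "0 < h \<Longrightarrow> Delta_star S f h y \<le> kernel_L1 S * (M * (h / 2) powr \<beta>)"
  by (rule Delta_star_least, rule Delta_average_bounds(2)[where lo = 0]) (auto intro!: Delta_le Delta_nonneg)

lemma Delta_star_mono:
  assumes "0 < h" "h \<le> h'"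
  shows "Delta_star S f h y \<le> Delta_star S f h' y"
proof (rule Delta_star_least)
  fix a :: real assume a: "0 < a"
  have "(LBINT z:{y - a..y + a}. Delta S f h z) \<le> (LBINT z:{y - a..y + a}. Delta S f h' z)"
    using assms by (intro set_integral_mono set_integrable_Delta Delta_mono) auto
  then have "(1 / (2 * a)) * (LBINT z:{y - a..y + a}. Delta S f h z) \<le> (1 / (2 * a)) * (LBINT z:{y - a..y + a}. Delta S f h' z)"
    using a by (intro mult_left_mono) auto
  also have "\<dots> \<le> Delta_star S f h' y" using assms a by (intro Delta_average_le_star) auto
  finally show "(1 / (2 * a)) * (LBINT z:{y - a..y + a}. Delta S f h z) \<le> Delta_star S f h' y" .
qed

text \<open>A continuous function is the limit of its averages over shrinking centred
  intervals.\<close>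

lemma Delta_le_star:
  assumes h: "0 < h"
  shows "Delta S f h y \<le> Delta_star S f h y"
proof (rule field_le_epsilon)
  fix e :: real assume e: "0 < e"
  define C where "C = kernel_L1 S * 2 * M + 1"
  have C: "0 < C" using kernel_L1_ge_1 M_nonneg by (simp add: C_def add_nonneg_pos)
  \<comment> \<open>The radius at which the Hoelder modulus equals \<open>e\<close>; the summand 1
    in \<open>C\<close> avoids division by zero when \<open>M\<close> is zero.\<close>
  define a where "a = (e / C) powr (1 / \<beta>)"
  have a: "0 < a" "a powr \<beta> = e / C" using e C \<beta> by (auto simp: a_def powr_powr)
  have "Delta S f h y - e \<le> (1 / (2 * a)) * (LBINT z:{y - a..y + a}. Delta S f h z)"
  proof (rule Delta_average_bounds(1)[OF h a(1)])
    fix z assume z: "\<bar>z - y\<bar> \<le> a"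
    have "\<bar>Delta S f h z - Delta S f h y\<bar> \<le> (kernel_L1 S * 2 * M) * \<bar>z - y\<bar> powr \<beta>"
      by (rule Delta_holder[OF h])
    also have "\<dots> \<le> C * a powr \<beta>"
      using z \<beta> a kernel_L1_ge_1 M_nonneg by (intro mult_mono powr_mono2) (auto simp: C_def)
    also have "\<dots> = e" using a C by simp
    finally show "Delta S f h y - e \<le> Delta S f h z \<and> Delta S f h z \<le> kernel_L1 S * (M * (h / 2) powr \<beta>)"
      using Delta_le[OF h] by auto
  qed
  also have "\<dots> \<le> Delta_star S f h y" by (rule Delta_average_le_star[OF h a(1)])
  finally show "Delta S f h y \<le> Delta_star S f h y + e" by simp
qed

text \<open>As \<open>u\<close> runs through the support of the kernel, \<open>y + b * u\<close>
  runs through the interval of radius \<open>\<bar>b\<bar> / 2\<close> about \<open>y\<close>, so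
  the integral is one of the averages in \<open>Delta_star\<close>. The supremum over all radii
  there makes the bound uniform in \<open>b\<close>. For \<open>b = 0\<close> the average
  degenerates to the value at \<open>y\<close>.\<close>

lemma integral_Delta_segment:
  assumes h: "0 < h"
  shows "(LBINT u:{-1/2..1/2}. Delta S f h (y + b * u)) \<le> Delta_star S f h y"
proof (cases "b = 0")
  case True
  then show ?thesis using Delta_le_star[OF h] by (simp add: set_lebesgue_integral_def)
next
  case False
  define a where "a = \<bar>b\<bar> / 2"
  have a: "0 < a" using False by (simp add: a_def)
  have ind: "indicator {y - a..y + a} (y + b * u) = (indicator {-1/2..1/2} u :: real)" for u
  proof -
    have "y + b * u \<in> {y - a..y + a} \<longleftrightarrow> \<bar>b\<bar> * \<bar>u\<bar> \<le> \<bar>b\<bar> * (1/2)"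
      by (auto simp: a_def abs_le_iff simp flip: abs_mult)
    also have "\<dots> \<longleftrightarrow> u \<in> {-1/2..1/2}" using False by (auto simp: abs_le_iff)
    finally show ?thesis by (simp add: indicator_def)
  qed
  have "(LBINT z:{y - a..y + a}. Delta S f h z)
      = \<bar>b\<bar> * (LBINT u. indicator {y - a..y + a} (y + b * u) * Delta S f h (y + b * u))"
    unfolding set_lebesgue_integral_def
    by (subst lborel_integral_real_affine[where t = y and c = b]) (use False in auto)
  then have "(LBINT z:{y - a..y + a}. Delta S f h z) = \<bar>b\<bar> * (LBINT u:{-1/2..1/2}. Delta S f h (y + b * u))"
    by (simp add: ind set_lebesgue_integral_def)
  then have "(LBINT u:{-1/2..1/2}. Delta S f h (y + b * u)) = (1 / (2 * a)) * (LBINT z:{y - a..y + a}. Delta S f h z)"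
    using False by (simp add: a_def)
  also have "\<dots> \<le> Delta_star S f h y" by (rule Delta_average_le_star[OF h a])
  finally show ?thesis .
qed

text \<open>The mean of an estimator, seen from the projection \<open>y\<close> of the point:
  \<open>a\<close> is the step of the projection along the smoothing direction and \<open>b\<close>
  the step across it. \<open>smooth1\<close> is the case \<open>a = 0\<close>.\<close>

definition smooth2 :: "real \<Rightarrow> real \<Rightarrow> real \<Rightarrow> real" where
  "smooth2 a b y = (LBINT v. kern S v * (LBINT u. kern S u * f (y + a * u + b * v)))"

definition smooth1 :: "real \<Rightarrow> real \<Rightarrow> real" where
  "smooth1 b y = (LBINT v. kern S v * f (y + b * v))"

lemma smooth_inner: "(LBINT u. kern S u * f (z + a * u)) = f z + local_dev a z"
proof -
  have "(LBINT u. kern S u * f (z + a * u)) = (LBINT u. kern S u * (f (z + a * u) - f z) + kern S u * f z)"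
    by (simp add: algebra_simps)
  also have "\<dots> = local_dev a z + (LBINT u. kern S u * f z)"
    unfolding local_dev_def
    by (rule Bochner_Integration.integral_add)
      (auto intro!: integrable_kern_times[OF _ f_diff_le] integrable_kern)
  finally show ?thesis using kernel_int by simp
qed

lemma continuous_local_dev: "continuous_on UNIV (local_dev \<delta>)"
  using local_dev_holder by (intro holder_imp_continuous[where C = "kernel_L1 S * (2 * M)"]) (simp add: mult.assoc)

lemma local_dev_borel [measurable]: "local_dev \<delta> \<in> borel_measurable borel"
  by (rule borel_measurable_continuous_onI) (rule continuous_local_dev)

text \<open>The inner integral is \<open>f + local_dev a\<close> at \<open>y + b * v\<close>. The
  first part gives \<open>smooth1\<close>; the second is at most \<open>Delta\<close> along the
  segment, whose integral is controlled for every \<open>b\<close> at once.\<close>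

lemma smooth2_smooth1:
  assumes h: "0 < h" and a: "\<bar>a\<bar> \<le> h"
  shows "\<bar>smooth2 a b y - smooth1 b y\<bar> \<le> kernel_sup S * Delta_star S f h y"
proof -
  let ?C = "kernel_L1 S * (M * (h / 2) powr \<beta>)"
  have bd: "\<bar>local_dev a z\<bar> \<le> ?C" for z
    using local_dev_le_Delta[OF h a] Delta_le[OF h] by (rule order_trans)
  have i1: "integrable lborel (\<lambda>v. kern S v * local_dev a (y + b * v))"
    by (rule integrable_kern_times[OF _ bd]) measurable
  have i2: "integrable lborel (\<lambda>v. kern S v * f (y + b * v))"
    by (rule integrable_kern_times[OF _ f_bound]) measurable
  have "smooth2 a b y = (LBINT v. kern S v * (LBINT u. kern S u * f ((y + b * v) + a * u)))"
    by (simp add: smooth2_def add_ac)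
  also have "\<dots> = (LBINT v. kern S v * f (y + b * v) + kern S v * local_dev a (y + b * v))"
    by (simp only: smooth_inner distrib_left)
  also have "\<dots> = smooth1 b y + (LBINT v. kern S v * local_dev a (y + b * v))"
    unfolding smooth1_def by (rule Bochner_Integration.integral_add[OF i2 i1])
  finally have "\<bar>smooth2 a b y - smooth1 b y\<bar> = \<bar>LBINT v. kern S v * local_dev a (y + b * v)\<bar>" by simp
  also have "\<dots> \<le> (LBINT v. \<bar>kern S v * local_dev a (y + b * v)\<bar>)" by (rule integral_abs_bound)
  also have "\<dots> \<le> (LBINT v. kernel_sup S * (indicator {-1/2..1/2} v * Delta S f h (y + b * v)))"
  proof (rule integral_mono)
    show "integrable lborel (\<lambda>v. \<bar>kern S v * local_dev a (y + b * v)\<bar>)" by (rule integrable_abs[OF i1])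
    have "continuous_on {-1/2..1/2} (\<lambda>v. Delta S f h (y + b * v))"
      by (rule continuous_on_compose2[OF continuous_Delta[OF h, of UNIV]]) (auto intro!: continuous_intros)
    from borel_integrable_atLeastAtMost'[OF this]
    show "integrable lborel (\<lambda>v. kernel_sup S * (indicator {-1/2..1/2} v * Delta S f h (y + b * v)))"
      by (intro integrable_mult_right) (simp only: set_integrable_def real_scaleR_def)
    fix v
    have "\<bar>kern S v\<bar> * \<bar>local_dev a (y + b * v)\<bar> \<le> (kernel_sup S * indicator {-1/2..1/2} v) * Delta S f h (y + b * v)"
      by (intro mult_mono abs_kern_le_indicator local_dev_le_Delta h a) (auto simp: kernel_sup_nonneg)
    then show "\<bar>kern S v * local_dev a (y + b * v)\<bar> \<le> kernel_sup S * (indicator {-1/2..1/2} v * Delta S f h (y + b * v))"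
      by (simp add: abs_mult mult.assoc)
  qed
  also have "\<dots> = kernel_sup S * (LBINT u:{-1/2..1/2}. Delta S f h (y + b * u))"
    by (simp add: set_lebesgue_integral_def)
  also have "\<dots> \<le> kernel_sup S * Delta_star S f h y"
    by (intro mult_left_mono integral_Delta_segment h kernel_sup_nonneg)
  finally show ?thesis .
qed

lemma smooth1_zero: "smooth1 0 y = f y"
  using kernel_int by (simp add: smooth1_def)

end

section \<open>The oracle inequality on a fixed data set\<close>

text \<open>The inner product of \<open>x\<close> with \<open>w\<close> turned by a right angle,
  which is the second row of \<open>E_single w h\<close>.\<close>

definition cross :: "real^2 \<Rightarrow> real^2 \<Rightarrow> real" where
  "cross w x = w$1 * x$2 - w$2 * x$1"

lemma powr_neg_half: "0 \<le> (x :: real) \<Longrightarrow> x powr (-1/2) = 1 / sqrt x"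
  using powr_minus[of x "1/2"] by (simp add: powr_half_sqrt inverse_eq_divide)

lemma inner_real2: "x \<bullet> y = x$1 * y$1 + x$2 * (y :: real^2)$2"
  by (simp add: inner_vec_def sum_2)

lemma norm_real2_square: "(norm (x :: real^2))\<^sup>2 = (x$1)\<^sup>2 + (x$2)\<^sup>2"
  unfolding power2_norm_eq_inner inner_real2 by (simp add: power2_eq_square)

lemma det_E_single: "det (E_single w h) = (norm w)\<^sup>2 / h"
  unfolding norm_real2_square by (simp add: E_single_def det_2 power2_eq_square add_divide_distrib)

lemma E_single_mult:
  "(E_single w h *v x)$1 = (w \<bullet> x) / h" "(E_single w h *v x)$2 = cross w x"
  by (simp_all add: E_single_def matrix_vector_mult_def sum_2 inner_real2 cross_def add_divide_distrib)

text \<open>Expansion of \<open>x \<bullet> y\<close> in the orthogonal frame formed by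
  \<open>w\<close> and its rotation.\<close>

lemma inner_cross_identity: "(w \<bullet> x) * (w \<bullet> y) + cross w x * cross w y = (norm w)\<^sup>2 * (x \<bullet> y)"
  unfolding norm_real2_square inner_real2 cross_def by (simp add: algebra_simps power2_eq_square[of "_ $ _"])

text \<open>The sign makes the angle between the two summands at most a right angle, so that the
  vector stays away from zero.\<close>

definition pair_vec :: "real^2 \<Rightarrow> real^2 \<Rightarrow> real^2" where
  "pair_vec \<theta> \<nu> = (1 / (2 * (1 + \<bar>\<nu> \<bullet> \<theta>\<bar>))) *\<^sub>R ((if 0 \<le> \<nu> \<bullet> \<theta> then \<theta> else - \<theta>) + \<nu>)"

lemma E_pair_eq: "E_pair \<theta> \<nu> h = E_single (pair_vec \<theta> \<nu>) h"
  by (simp add: E_pair_def E_bar_def E_single_def pair_vec_def mult_ac)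
    (simp add: minus_divide_left)

lemma Fhat_pair_eq: "Fhat_pair S n d \<theta> \<nu> h t = Fhat S n d (pair_vec \<theta> \<nu>) h t"
  by (simp add: Fhat_pair_def Fhat_def E_pair_eq)

lemma norm_pair_vec_square:
  assumes "norm \<theta> = 1" "norm \<nu> = 1"
  shows "(norm (pair_vec \<theta> \<nu>))\<^sup>2 = 1 / (2 * (1 + \<bar>\<nu> \<bullet> \<theta>\<bar>))"
proof -
  define s where "s = (if 0 \<le> \<nu> \<bullet> \<theta> then \<theta> else - \<theta>)"
  define k where "k = 2 * (1 + \<bar>\<nu> \<bullet> \<theta>\<bar>)"
  have "\<theta> \<bullet> \<theta> = 1" "\<nu> \<bullet> \<nu> = 1" using assms by (simp_all add: norm_eq_1)
  then have s: "(s + \<nu>) \<bullet> (s + \<nu>) = k"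
    by (simp add: s_def k_def inner_add inner_commute)
  have "pair_vec \<theta> \<nu> = (1 / k) *\<^sub>R (s + \<nu>)" by (simp add: pair_vec_def s_def k_def)
  then have "(norm (pair_vec \<theta> \<nu>))\<^sup>2 = (1 / k) * ((1 / k) * ((s + \<nu>) \<bullet> (s + \<nu>)))"
    unfolding power2_norm_eq_inner by (simp only: inner_scaleR_left inner_scaleR_right)
  then show ?thesis unfolding s by (simp add: k_def)
qed

lemma norm_pair_vec_bounds:
  assumes "norm \<theta> = 1" "norm \<nu> = 1"
  shows "1/2 \<le> norm (pair_vec \<theta> \<nu>)" "norm (pair_vec \<theta> \<nu>) \<le> 1"
proof -
  have c: "\<bar>\<nu> \<bullet> \<theta>\<bar> \<le> 1" using Cauchy_Schwarz_ineq2[of \<nu> \<theta>] assms by simp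
  have "(1/2)\<^sup>2 \<le> (norm (pair_vec \<theta> \<nu>))\<^sup>2"
    unfolding norm_pair_vec_square[OF assms] using c by (simp add: field_simps power2_eq_square)
  then show "1/2 \<le> norm (pair_vec \<theta> \<nu>)" by (rule power2_le_imp_le) simp
  have "(norm (pair_vec \<theta> \<nu>))\<^sup>2 \<le> 1\<^sup>2"
    unfolding norm_pair_vec_square[OF assms] using c by (simp add: field_simps)
  then show "norm (pair_vec \<theta> \<nu>) \<le> 1" by (rule power2_le_imp_le) simp
qed

text \<open>The summand \<open>\<plusminus>\<theta>\<close> contributes nothing to the cross product
  with \<theta>, and the prefactor cancels against the squared norm: this is the common
  \<open>b\<close> of the two compared estimators. The bound 2 is the reason why
  \<open>Delta_star\<close> is taken at twice the bandwidth below.\<close>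

lemma pair_vec_scaled:
  assumes "norm \<theta> = 1" "norm \<nu> = 1"
  shows "\<bar>(pair_vec \<theta> \<nu> \<bullet> \<theta>) / (norm (pair_vec \<theta> \<nu>))\<^sup>2\<bar> \<le> 2"
    "cross (pair_vec \<theta> \<nu>) \<theta> / (norm (pair_vec \<theta> \<nu>))\<^sup>2 = cross \<nu> \<theta>"
proof -
  define s where "s = (if 0 \<le> \<nu> \<bullet> \<theta> then \<theta> else - \<theta>) + \<nu>"
  define k where "k = 2 * (1 + \<bar>\<nu> \<bullet> \<theta>\<bar>)"
  have k: "0 < k" by (simp add: k_def add_pos_nonneg)
  have p: "pair_vec \<theta> \<nu> = (1 / k) *\<^sub>R s" by (simp add: pair_vec_def s_def k_def)
  have q: "(norm (pair_vec \<theta> \<nu>))\<^sup>2 = 1 / k" using norm_pair_vec_square[OF assms] by (simp add: k_def)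
  have "\<bar>\<nu> \<bullet> \<theta>\<bar> \<le> 1" "\<theta> \<bullet> \<theta> = 1" using Cauchy_Schwarz_ineq2[of \<nu> \<theta>] assms by (simp_all add: norm_eq_1)
  then have "\<bar>s \<bullet> \<theta>\<bar> \<le> 2" by (auto simp: s_def inner_add_left)
  then show "\<bar>(pair_vec \<theta> \<nu> \<bullet> \<theta>) / (norm (pair_vec \<theta> \<nu>))\<^sup>2\<bar> \<le> 2"
    unfolding q unfolding p using k by simp
  have "cross ((1 / k) *\<^sub>R s) \<theta> = (1 / k) * cross s \<theta>" by (simp add: cross_def algebra_simps)
  moreover have "cross s \<theta> = cross \<nu> \<theta>" by (simp add: cross_def s_def algebra_simps)
  ultimately show "cross (pair_vec \<theta> \<nu>) \<theta> / (norm (pair_vec \<theta> \<nu>))\<^sup>2 = cross \<nu> \<theta>"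
    unfolding q unfolding p using k by simp
qed

text \<open>The outer variable is the second coordinate, as in \<open>smooth2\<close>.\<close>

lemma lborel_integral_real2_swap:
  fixes f :: "real^2 \<Rightarrow> real"
  assumes f: "integrable lborel f"
  shows "(LBINT x. f x) = (LBINT b. LBINT a. f (vector [a, b]))"
proof -
  have [measurable]: "f \<in> borel_measurable borel" using f by auto
  have int: "integrable (lborel \<Otimes>\<^sub>M lborel) (case_prod (\<lambda>a b. f (vector [a, b])))"
    using lborel_integrable_real2[OF f] .
  show ?thesis
    unfolding lborel_integral_real2[OF f] by (rule lborel_pair.Fubini_integral[OF int, symmetric])
qed

section \<open>Kernel integrals and the comparison terms of the selection rule\<close>

context procedure_setup
begin

lemma kernel2_borel [measurable]: "kernel2 S \<in> borel_measurable borel"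
  unfolding kernel2_def[abs_def] by measurable

lemma kernel2_E_single: "kernel2 S (E_single w h *v x) = kern S ((w \<bullet> x) / h) * kern S (cross w x)"
  by (simp add: kernel2_def E_single_mult)

lemma abs_kernel2_le: "\<bar>kernel2 S x\<bar> \<le> (kernel_sup S)\<^sup>2"
  unfolding kernel2_def abs_mult power2_eq_square
  by (intro mult_mono kern_le_sup) (auto simp: kernel_sup_nonneg)

lemma kernel2_eq_0:
  assumes "x \<notin> cbox (vec (-1/2)) (vec (1/2))"
  shows "kernel2 S x = 0"
proof -
  have "1/2 < \<bar>x$1\<bar> \<or> 1/2 < \<bar>x$2\<bar>" using assms by (auto simp: mem_box_cart forall_2 abs_if)
  then show ?thesis using kern_eq_0[of "x$1"] kern_eq_0[of "x$2"] by (auto simp: kernel2_def)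
qed

lemma abs_kernel2_le_indicator:
  "\<bar>kernel2 S x\<bar> \<le> (kernel_sup S)\<^sup>2 * indicator (cbox (vec (-1/2)) (vec (1/2))) x"
  using abs_kernel2_le[of x] kernel2_eq_0[of x] by (auto split: split_indicator)

lemma measure_unit_cbox: "measure lborel (cbox (vec (-1/2)) (vec (1/2) :: real^2)) = 1"
  by (subst measure_lborel_cbox_eq) (auto simp: Basis_real2 inner_axis axis_eq_axis)

lemma integrable_indicator_cbox: "integrable lborel (indicator (cbox a b) :: real^2 \<Rightarrow> real)"
  by (simp add: integrable_indicator_iff emeasure_bounded_finite[OF bounded_cbox, unfolded infinity_ennreal_def])

lemma integrable_kernel2_times:
  assumes [measurable]: "g \<in> borel_measurable borel" and g: "\<And>u. \<bar>g u\<bar> \<le> C"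
  shows "integrable lborel (\<lambda>u. kernel2 S u * g u)"
proof (rule Bochner_Integration.integrable_bound)
  show "integrable lborel (\<lambda>u :: real^2. (kernel_sup S)\<^sup>2 * C * indicator (cbox (vec (-1/2)) (vec (1/2))) u)"
    by (intro integrable_mult_right integrable_indicator_cbox)
  have "\<bar>kernel2 S u * g u\<bar> \<le> ((kernel_sup S)\<^sup>2 * indicator (cbox (vec (-1/2)) (vec (1/2))) u) * C" for u
    unfolding abs_mult by (rule mult_mono[OF abs_kernel2_le_indicator g]) auto
  moreover have "0 \<le> C" using g[of 0] by simp
  ultimately show "AE u in lborel. norm (kernel2 S u * g u)
      \<le> norm ((kernel_sup S)\<^sup>2 * C * indicator (cbox (vec (-1/2)) (vec (1/2))) u)"
    by (auto simp: mult_ac abs_mult)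
qed measurable

lemma integral_kernel2_square: "(LBINT u. (kernel2 S u)\<^sup>2) \<le> (kernel_sup S) ^ 4"
proof -
  have "(LBINT u. (kernel2 S u)\<^sup>2) \<le> (LBINT u. (kernel_sup S) ^ 4 * indicator (cbox (vec (-1/2)) (vec (1/2))) (u :: real^2))"
  proof (rule integral_mono)
    show "integrable lborel (\<lambda>u. (kernel2 S u)\<^sup>2)"
      using integrable_kernel2_times[OF kernel2_borel abs_kernel2_le] by (simp add: power2_eq_square)
    show "integrable lborel (\<lambda>u :: real^2. (kernel_sup S) ^ 4 * indicator (cbox (vec (-1/2)) (vec (1/2))) u)"
      by (intro integrable_mult_right integrable_indicator_cbox)
    fix u :: "real^2"
    have "\<bar>kernel2 S u\<bar>\<^sup>2 \<le> ((kernel_sup S)\<^sup>2)\<^sup>2"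
      using abs_kernel2_le[of u] by (rule power_mono) simp
    then show "(kernel2 S u)\<^sup>2 \<le> (kernel_sup S) ^ 4 * indicator (cbox (vec (-1/2)) (vec (1/2))) u"
      using kernel2_eq_0[of u] by (auto split: split_indicator)
  qed
  also have "\<dots> = (kernel_sup S) ^ 4"
    using measure_unit_cbox by simp
  finally show ?thesis .
qed

lemma Fhat_uminus: "Fhat S n d (- w) h t = Fhat S n d w h t"
proof -
  have "kernel2 S (E_single (- w) h *v x) = kernel2 S (E_single w h *v x)" for x
  proof -
    have "cross (- w) x = - cross w x" by (simp add: cross_def)
    then show ?thesis by (simp add: kernel2_E_single kernel_sym)
  qed
  then show ?thesis by (simp add: Fhat_def Fhat_mat_def det_E_single)
qed

text \<open>For an obtuse angle the two vectors are opposite, and the even kernel does not see the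
  sign. The true direction can therefore take either place in a pair.\<close>

lemma Fhat_pair_commute: "Fhat S n d (pair_vec \<theta> \<nu>) h t = Fhat S n d (pair_vec \<nu> \<theta>) h t"
proof (cases "0 \<le> \<nu> \<bullet> \<theta>")
  case True
  then have "pair_vec \<theta> \<nu> = pair_vec \<nu> \<theta>" by (simp add: pair_vec_def inner_commute add.commute)
  then show ?thesis by simp
next
  case False
  then have "pair_vec \<theta> \<nu> = - pair_vec \<nu> \<theta>"
    by (simp add: pair_vec_def inner_commute flip: scaleR_minus_right)
  then show ?thesis by (simp add: Fhat_uminus)
qed

text \<open>This lets the real suprema over directions dominate their members; for that purpose the
  bound may depend on the data and on \<open>h\<close>.\<close>

lemma Fhat_bounded:
  "\<exists>B. \<forall>w. norm w \<le> 1 \<longrightarrow> \<bar>Fhat S n d w h t\<bar> \<le> B"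
proof (intro exI allI impI)
  fix w :: "real^2" assume w: "norm w \<le> 1"
  have "\<bar>det (E_single w h) / n\<bar> \<le> 1 / \<bar>h\<bar> / n"
  proof -
    have "(norm w)\<^sup>2 \<le> 1" using power_mono[OF w, of 2] by simp
    then have "(norm w)\<^sup>2 / \<bar>h\<bar> / n \<le> 1 / \<bar>h\<bar> / n" by (intro divide_right_mono) auto
    then show ?thesis by (simp add: det_E_single abs_mult)
  qed
  moreover have "\<bar>\<Sum>i<n. kernel2 S (E_single w h *v (fst (d i) - t)) / design S (fst (d i)) * snd (d i)\<bar>
      \<le> (\<Sum>i<n. (kernel_sup S)\<^sup>2 / \<bar>design S (fst (d i))\<bar> * \<bar>snd (d i)\<bar>)"
    by (rule order_trans[OF sum_abs sum_mono])
      (auto simp: abs_mult abs_divide intro!: mult_right_mono divide_right_mono abs_kernel2_le)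
  ultimately show "\<bar>Fhat S n d w h t\<bar> \<le> 1 / \<bar>h\<bar> / n * (\<Sum>i<n. (kernel_sup S)\<^sup>2 / \<bar>design S (fst (d i))\<bar> * \<bar>snd (d i)\<bar>)"
    unfolding Fhat_def Fhat_mat_def abs_mult by (intro mult_mono) auto
qed

lemma hmin_pos: "2 \<le> n \<Longrightarrow> 0 < hmin S n"
  by (simp add: hmin_def)

lemma bandwidths_pos: "h \<in> bandwidths S n \<Longrightarrow> 0 < h"
  by (auto simp: bandwidths_def)

lemma finite_bandwidths:
  assumes n: "2 \<le> n"
  shows "finite (bandwidths S n)"
proof -
  obtain k0 where k0: "(1/2 :: real) ^ k0 < hmin S n / 2"
    using real_arch_pow_inv[of "hmin S n / 2" "1/2"] hmin_pos[OF n] by auto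
  have "bandwidths S n \<subseteq> (\<lambda>k. (1/2)^k) ` {..<k0}"
  proof
    fix h assume "h \<in> bandwidths S n"
    then obtain k where k: "h = (1/2)^k" "hmin S n / 2 \<le> h" by (auto simp: bandwidths_def)
    have "k < k0"
    proof (rule ccontr)
      assume "\<not> k < k0"
      then have "(1/2 :: real)^k \<le> (1/2)^k0" by (intro power_decreasing) auto
      then show False using k k0 by linarith
    qed
    then show "h \<in> (\<lambda>k. (1/2)^k) ` {..<k0}" using k by auto
  qed
  then show ?thesis by (rule finite_subset) simp
qed

lemma R1_lower:
  assumes n: "2 \<le> n" and \<theta>: "norm \<theta> = 1" and \<nu>: "norm \<nu> = 1" and \<eta>: "\<eta> \<in> bandwidths S n" "\<eta> \<le> h"
  shows "\<bar>Fhat S n d (pair_vec \<theta> \<nu>) \<eta> t - Fhat S n d \<nu> \<eta> t\<bar> \<le> R1 S n d t \<theta> h + TH S n d \<eta>"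
proof -
  obtain B where B: "\<And>w. norm w \<le> 1 \<Longrightarrow> \<bar>Fhat S n d w \<eta> t\<bar> \<le> B" using Fhat_bounded by blast
  have "\<bar>Fhat_pair S n d \<theta> \<nu> \<eta> t - Fhat S n d \<nu> \<eta> t\<bar> \<le> (SUP \<nu>\<in>sphere 0 1. \<bar>Fhat_pair S n d \<theta> \<nu> \<eta> t - Fhat S n d \<nu> \<eta> t\<bar>)"
  proof (rule cSUP_upper)
    show "bdd_above ((\<lambda>\<nu>. \<bar>Fhat_pair S n d \<theta> \<nu> \<eta> t - Fhat S n d \<nu> \<eta> t\<bar>) ` sphere 0 1)"
    proof (rule bdd_aboveI2)
      fix \<mu> :: "real^2" assume "\<mu> \<in> sphere 0 1"
      then have \<mu>: "norm \<mu> = 1" by simp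
      show "\<bar>Fhat_pair S n d \<theta> \<mu> \<eta> t - Fhat S n d \<mu> \<eta> t\<bar> \<le> B + B"
        using B[of "pair_vec \<theta> \<mu>"] B[of \<mu>] norm_pair_vec_bounds[OF \<theta> \<mu>] \<mu> by (simp add: Fhat_pair_eq)
    qed
  qed (use \<nu> in simp)
  moreover have "max 0 ((SUP \<nu>\<in>sphere 0 1. \<bar>Fhat_pair S n d \<theta> \<nu> \<eta> t - Fhat S n d \<nu> \<eta> t\<bar>) - TH S n d \<eta>) \<le> R1 S n d t \<theta> h"
    unfolding R1_def by (rule cSUP_upper) (use \<eta> finite_bandwidths[OF n] in auto)
  ultimately show ?thesis by (simp add: Fhat_pair_eq)
qed

lemma R2_lower:
  assumes n: "2 \<le> n" and \<theta>: "norm \<theta> = 1" and \<eta>: "\<eta> \<in> bandwidths S n" "\<eta> \<le> h"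
  shows "\<bar>Fhat S n d \<theta> h t - Fhat S n d \<theta> \<eta> t\<bar> \<le> R2 S n d t h + TH S n d \<eta>"
proof -
  obtain B where B: "\<And>w. norm w \<le> 1 \<Longrightarrow> \<bar>Fhat S n d w \<eta> t\<bar> \<le> B" using Fhat_bounded by blast
  obtain B' where B': "\<And>w. norm w \<le> 1 \<Longrightarrow> \<bar>Fhat S n d w h t\<bar> \<le> B'" using Fhat_bounded by blast
  have "\<bar>Fhat S n d \<theta> h t - Fhat S n d \<theta> \<eta> t\<bar> \<le> (SUP \<theta>\<in>sphere 0 1. \<bar>Fhat S n d \<theta> h t - Fhat S n d \<theta> \<eta> t\<bar>)"
  proof (rule cSUP_upper)
    show "bdd_above ((\<lambda>\<theta>. \<bar>Fhat S n d \<theta> h t - Fhat S n d \<theta> \<eta> t\<bar>) ` sphere 0 1)"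
    proof (rule bdd_aboveI2)
      fix \<mu> :: "real^2" assume "\<mu> \<in> sphere 0 1"
      then show "\<bar>Fhat S n d \<mu> h t - Fhat S n d \<mu> \<eta> t\<bar> \<le> B' + B"
        using B[of \<mu>] B'[of \<mu>] by simp
    qed
  qed (use \<theta> in simp)
  moreover have "max 0 ((SUP \<theta>\<in>sphere 0 1. \<bar>Fhat S n d \<theta> h t - Fhat S n d \<theta> \<eta> t\<bar>) - TH S n d \<eta>) \<le> R2 S n d t h"
    unfolding R2_def by (rule cSUP_upper) (use \<eta> finite_bandwidths[OF n] in auto)
  ultimately show ?thesis by simp
qed

lemma sphere_real2_nonempty: "sphere (0 :: real^2) 1 \<noteq> {}"
proof -
  have "axis 1 1 \<in> sphere (0 :: real^2) 1" by (simp add: norm_axis_1)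
  then show ?thesis by blast
qed

lemma R1_eq_0:
  assumes h: "h \<in> bandwidths S n" and \<theta>: "norm \<theta> = 1"
    and le: "\<And>\<eta> \<nu>. \<eta> \<in> bandwidths S n \<Longrightarrow> \<eta> \<le> h \<Longrightarrow> norm \<nu> = 1 \<Longrightarrow>
      \<bar>Fhat S n d (pair_vec \<theta> \<nu>) \<eta> t - Fhat S n d \<nu> \<eta> t\<bar> \<le> TH S n d \<eta>"
  shows "R1 S n d t \<theta> h = 0"
proof -
  have "max 0 ((SUP \<nu>\<in>sphere 0 1. \<bar>Fhat_pair S n d \<theta> \<nu> \<eta> t - Fhat S n d \<nu> \<eta> t\<bar>) - TH S n d \<eta>) = 0"
    if "\<eta> \<in> {\<eta> \<in> bandwidths S n. \<eta> \<le> h}" for \<eta>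
  proof -
    have "(SUP \<nu>\<in>sphere 0 1. \<bar>Fhat_pair S n d \<theta> \<nu> \<eta> t - Fhat S n d \<nu> \<eta> t\<bar>) \<le> TH S n d \<eta>"
      using that by (intro cSUP_least[OF sphere_real2_nonempty]) (simp add: Fhat_pair_eq le)
    then show ?thesis by simp
  qed
  then have "R1 S n d t \<theta> h = (SUP \<eta>\<in>{\<eta> \<in> bandwidths S n. \<eta> \<le> h}. 0)"
    unfolding R1_def by (intro SUP_cong) auto
  also have "\<dots> = 0" using h by (subst cSUP_const) auto
  finally show ?thesis .
qed

lemma R2_eq_0:
  assumes h: "h \<in> bandwidths S n"
    and le: "\<And>\<eta> \<theta>. \<eta> \<in> bandwidths S n \<Longrightarrow> \<eta> \<le> h \<Longrightarrow> norm \<theta> = 1 \<Longrightarrow>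
      \<bar>Fhat S n d \<theta> h t - Fhat S n d \<theta> \<eta> t\<bar> \<le> TH S n d \<eta>"
  shows "R2 S n d t h = 0"
proof -
  have "max 0 ((SUP \<theta>\<in>sphere 0 1. \<bar>Fhat S n d \<theta> h t - Fhat S n d \<theta> \<eta> t\<bar>) - TH S n d \<eta>) = 0"
    if "\<eta> \<in> {\<eta> \<in> bandwidths S n. \<eta> \<le> h}" for \<eta>
  proof -
    have "(SUP \<theta>\<in>sphere 0 1. \<bar>Fhat S n d \<theta> h t - Fhat S n d \<theta> \<eta> t\<bar>) \<le> TH S n d \<eta>"
      using that by (intro cSUP_least[OF sphere_real2_nonempty]) (simp add: le)
    then show ?thesis by simp
  qed
  then have "R2 S n d t h = (SUP \<eta>\<in>{\<eta> \<in> bandwidths S n. \<eta> \<le> h}. 0)"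
    unfolding R2_def by (intro SUP_cong) auto
  also have "\<dots> = 0" using h by (subst cSUP_const) auto
  finally show ?thesis .
qed

text \<open>The least exponent whose power is below \<open>x\<close>: its predecessor still reaches
  \<open>x\<close>, which costs a factor 2.\<close>

lemma ex_dyadic:
  assumes "0 < x" "x \<le> 1"
  shows "\<exists>k. x / 2 \<le> (1/2)^k \<and> (1/2 :: real)^k < x"
proof -
  have ex: "\<exists>k. (1/2 :: real)^k < x" using assms real_arch_pow_inv[of x "1/2"] by auto
  define k where "k = (LEAST k. (1/2 :: real)^k < x)"
  have k: "(1/2 :: real)^k < x" unfolding k_def by (rule LeastI_ex) (rule ex)
  then have "k \<noteq> 0" using assms by (intro notI) auto
  then obtain j where j: "k = Suc j" by (cases k) auto
  have "\<not> (1/2 :: real)^j < x" using not_less_Least[of j "\<lambda>k. (1/2 :: real)^k < x"] j by (simp add: k_def)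
  then have "x / 2 \<le> (1/2)^k" by (simp add: j)
  with k show ?thesis by blast
qed

end

section \<open>Means of the estimators and the oracle bandwidth\<close>

context link_setup
begin

text \<open>With \<open>u = E (x - t)\<close>, the expansion in the frame of \<open>w\<close> reads
  \<open>x \<bullet> \<theta> = t \<bullet> \<theta> + a * u$1 + b * u$2\<close>, which is where the
  two coefficients come from.\<close>

lemma integral_kernel2_link:
  assumes h: "0 < h" and w: "w \<noteq> 0"
  shows "(LBINT x. det (E_single w h) * kernel2 S (E_single w h *v (x - t)) * f (x \<bullet> \<theta>))
    = smooth2 (h * (w \<bullet> \<theta>) / (norm w)\<^sup>2) (cross w \<theta> / (norm w)\<^sup>2) (t \<bullet> \<theta>)"
proof -
  let ?E = "E_single w h"
  define a where "a = h * (w \<bullet> \<theta>) / (norm w)\<^sup>2"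
  define b where "b = cross w \<theta> / (norm w)\<^sup>2"
  define g where "g u = f (t \<bullet> \<theta> + a * u$1 + b * u$2)" for u :: "real^2"
  have det: "0 < det ?E" using h w by (simp add: det_E_single)
  have [measurable]: "g \<in> borel_measurable borel" unfolding g_def by measurable
  have int: "integrable lborel (\<lambda>u. kernel2 S u * g u)"
    by (rule integrable_kernel2_times[where C = M]) (simp_all add: g_def f_bound)
  have g: "g (?E *v (x - t)) = f (x \<bullet> \<theta>)" for x
  proof -
    have "a * ((w \<bullet> (x - t)) / h) + b * cross w (x - t)
        = ((w \<bullet> \<theta>) * (w \<bullet> (x - t)) + cross w \<theta> * cross w (x - t)) / (norm w)\<^sup>2"
      using h by (simp add: a_def b_def add_divide_distrib)
    also have "\<dots> = \<theta> \<bullet> (x - t)" using w by (simp add: inner_cross_identity)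
    finally have "t \<bullet> \<theta> + a * ((w \<bullet> (x - t)) / h) + b * cross w (x - t) = t \<bullet> \<theta> + \<theta> \<bullet> (x - t)" by simp
    also have "\<dots> = x \<bullet> \<theta>" by (simp add: inner_diff_right inner_commute)
    finally show ?thesis by (simp only: g_def E_single_mult)
  qed
  have "(LBINT x. det ?E * kernel2 S (?E *v (x - t)) * f (x \<bullet> \<theta>))
      = (LBINT x. det ?E * (kernel2 S (?E *v (x - t)) * g (?E *v (x - t))))"
    by (simp add: g mult.assoc)
  also have "\<dots> = (LBINT u. kernel2 S u * g u)"
    by (rule lborel_integral_linear_image[OF det, of "\<lambda>u. kernel2 S u * g u"]) measurable
  also have "\<dots> = (LBINT v. LBINT u. kernel2 S (vector [u, v]) * g (vector [u, v]))"
    by (rule lborel_integral_real2_swap[OF int])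
  also have "\<dots> = (LBINT v. LBINT u. kern S v * (kern S u * f (t \<bullet> \<theta> + a * u + b * v)))"
    by (simp add: kernel2_def g_def mult_ac)
  also have "\<dots> = smooth2 a b (t \<bullet> \<theta>)"
    by (simp add: smooth2_def)
  finally show ?thesis by (simp add: a_def b_def)
qed

text \<open>This is the purpose of the second condition in \<open>n0\<close>: up to
  \<open>hmin\<close> the Hoelder bias is at most \<open>M * hmin powr \<beta>\<close>, hence at
  most \<open>ln n powr (- 1 / omg S)\<close>, and this power is exactly the stochastic level
  \<open>sqrt (ln n / (n * hmin))\<close>. Doubling the argument cancels the half in the Hoelder
  bound on \<open>Delta_star\<close>.\<close>

lemma Delta_star_small:
  assumes n: "3 \<le> n" and cond: "max M 1 * (ln (real n) powr (1 / omg S) * hmin S n powr \<beta>) \<le> 1"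
    and \<eta>: "0 < \<eta>" "\<eta> \<le> hmin S n"
  shows "Delta_star S f (2 * \<eta>) y \<le> kernel_sup S * sqrt (ln n / (n * \<eta>))"
proof -
  let ?l = "ln (real n)"
  have l: "0 < ?l" using n by simp
  have o: "0 < omg S" by (rule noise_params)
  have "M * (?l powr (1 / omg S) * hmin S n powr \<beta>) \<le> 1"
    using cond by (rule order_trans[rotated]) (intro mult_right_mono, auto)
  then have "M * hmin S n powr \<beta> \<le> ?l powr (- (1 / omg S))"
    using l by (simp add: powr_minus field_simps)
  also have "\<dots> = sqrt (?l / (n * hmin S n))"
  proof -
    have "?l / (n * hmin S n) = ?l / ?l powr (1 + 2 / omg S)" using n by (simp add: hmin_def)
    also have "\<dots> = ?l powr (- (2 / omg S))" using l by (simp add: powr_add powr_minus field_simps)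
    finally show ?thesis using l by (simp add: powr_half_sqrt[symmetric] powr_powr)
  qed
  also have "\<dots> \<le> sqrt (?l / (n * \<eta>))"
    using \<eta> n l by (intro real_sqrt_le_mono divide_left_mono mult_left_mono mult_pos_pos) auto
  finally have *: "M * hmin S n powr \<beta> \<le> sqrt (?l / (n * \<eta>))" .
  have "Delta_star S f (2 * \<eta>) y \<le> kernel_L1 S * (M * (2 * \<eta> / 2) powr \<beta>)"
    using \<eta> by (intro Delta_star_le) auto
  also have "\<dots> \<le> kernel_sup S * (M * hmin S n powr \<beta>)"
    using \<eta> \<beta> M_nonneg kernel_L1_le_sup kernel_sup_nonneg by (intro mult_mono powr_mono2) auto
  also have "\<dots> \<le> kernel_sup S * sqrt (?l / (n * \<eta>))"
    using * kernel_sup_nonneg by (intro mult_left_mono)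
  finally show ?thesis .
qed

lemma oracle_bandwidth:
  assumes n: "3 \<le> n" and cond: "max M 1 * (ln (real n) powr (1 / omg S) * hmin S n powr \<beta>) \<le> 1"
    and hmin: "hmin S n \<le> 1"
  shows "hmin S n \<le> h_star S n f y" "h_star S n f y \<le> 1"
    "\<exists>h\<in>bandwidths S n. h_star S n f y / 4 \<le> h \<and>
      (\<forall>\<eta>::real. 0 < \<eta> \<longrightarrow> \<eta> \<le> h \<longrightarrow> Delta_star S f (2 * \<eta>) y \<le> kernel_sup S * sqrt (ln n / (n * \<eta>)))"
proof -
  define A where "A = {h \<in> {hmin S n..1}. sqrt (real n * h) * Delta_star S f h y \<le> kernel_sup S * sqrt (ln (real n))}"
  have hs: "h_star S n f y = Sup A" by (simp add: h_star_def A_def)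
  have hp: "0 < hmin S n" using hmin_pos[of n] n by simp
  have A_iff: "h \<in> A \<longleftrightarrow> hmin S n \<le> h \<and> h \<le> 1 \<and> Delta_star S f h y \<le> kernel_sup S * sqrt (ln n / (n * h))" for h :: real
  proof (cases "hmin S n \<le> h")
    case True
    then have "0 < real n * h" using hp n by simp
    then show ?thesis by (auto simp: A_def real_sqrt_divide field_simps)
  qed (simp add: A_def)
  have "Delta_star S f (hmin S n) y \<le> Delta_star S f (2 * hmin S n) y"
    using hp by (intro Delta_star_mono) auto
  also have "\<dots> \<le> kernel_sup S * sqrt (ln n / (n * hmin S n))"
    by (rule Delta_star_small[OF n cond hp]) simp
  \<comment> \<open>Together with boundedness this makes the supremum defining \<open>h_star\<close>
    meaningful.\<close>
  finally have inA: "hmin S n \<in> A" unfolding A_iff using hmin by simp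
  have bdd: "bdd_above A" by (rule bdd_aboveI[of _ 1]) (simp add: A_iff)
  show ge: "hmin S n \<le> h_star S n f y" unfolding hs by (rule cSup_upper[OF inA bdd])
  show le1: "h_star S n f y \<le> 1" unfolding hs using inA by (intro cSup_least) (auto simp: A_iff)
  \<comment> \<open>The oracle is a grid point in \<open>[H / 2, H)\<close>. The half allows for the
    doubled argument: if \<open>H = h_star / 2\<close>, then \<open>2 * \<eta>\<close> is below
    \<open>h_star\<close>; otherwise \<eta> is below \<open>hmin\<close>. As \<open>H\<close> is at
    least \<open>hmin\<close>, a grid that starts at \<open>hmin / 2\<close> contains such a
    point.\<close>
  define H where "H = max (h_star S n f y / 2) (hmin S n)"
  have H: "0 < H" "H \<le> 1" using hp hmin le1 by (auto simp: H_def)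
  obtain k where k: "H / 2 \<le> (1/2)^k" "(1/2 :: real)^k < H" using ex_dyadic[OF H] by blast
  show "\<exists>h\<in>bandwidths S n. h_star S n f y / 4 \<le> h \<and>
      (\<forall>\<eta>::real. 0 < \<eta> \<longrightarrow> \<eta> \<le> h \<longrightarrow> Delta_star S f (2 * \<eta>) y \<le> kernel_sup S * sqrt (ln n / (n * \<eta>)))"
  proof (rule bexI[of _ "(1/2)^k"], intro conjI allI impI)
    have "hmin S n \<le> H" "h_star S n f y / 2 \<le> H" by (simp_all add: H_def)
    then show "(1/2)^k \<in> bandwidths S n" "h_star S n f y / 4 \<le> (1/2)^k"
      using k H by (auto simp: bandwidths_def)
    fix \<eta> :: real assume \<eta>: "0 < \<eta>" "\<eta> \<le> (1/2)^k"
    show "Delta_star S f (2 * \<eta>) y \<le> kernel_sup S * sqrt (ln n / (n * \<eta>))"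
    proof (cases "\<eta> \<le> hmin S n")
      case True
      then show ?thesis by (rule Delta_star_small[OF n cond \<eta>(1)])
    next
      case False
      then have "2 * \<eta> < Sup A" using \<eta> k hs by (auto simp: H_def max_def split: if_splits)
      \<comment> \<open>One member of \<open>A\<close> beyond \<open>2 * \<eta>\<close> suffices,
        even if \<open>A\<close> is not an interval, because \<open>Delta_star\<close> increases and
        the stochastic level decreases with the bandwidth.\<close>
      then obtain h' where h': "h' \<in> A" "2 * \<eta> < h'"
        using less_cSup_iff[OF _ bdd] inA by blast
      have "Delta_star S f (2 * \<eta>) y \<le> Delta_star S f h' y" using \<eta> h' by (intro Delta_star_mono) auto
      also have "\<dots> \<le> kernel_sup S * sqrt (ln n / (n * h'))" using h' by (simp add: A_iff)
      also have "\<dots> \<le> kernel_sup S * sqrt (ln n / (n * \<eta>))"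
        using \<eta> h' n kernel_sup_nonneg
        by (intro mult_left_mono real_sqrt_le_mono divide_left_mono mult_pos_pos) auto
      finally show ?thesis .
    qed
  qed
qed

text \<open>The chain leads from the selected estimator to \<open>(\<theta>', h)\<close>, then to
  the pair of \<theta>' and \<theta>s, to \<open>(\<theta>s, h)\<close> and to the value of
  \<open>f\<close>. Its four links cost 2, 1, 2 and 1 thresholds, and the constant 7 leaves room.
  The unknown scale \<open>L\<close> enters the thresholds only through
  \<open>L \<le> Fhat_inf\<close>.\<close>

lemma oracle_inequality:
  fixes d :: dataset
  assumes n: "3 \<le> n" and cond: "max M 1 * (ln (real n) powr (1 / omg S) * hmin S n powr \<beta>) \<le> 1"
    and hmin: "hmin S n \<le> 1"
    and \<theta>s: "norm \<theta>s = 1"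
    and dev: "\<And>\<eta> w. \<eta> \<in> bandwidths S n \<Longrightarrow> 1/2 \<le> norm w \<Longrightarrow> norm w \<le> 1 \<Longrightarrow>
      \<bar>Fhat S n d w \<eta> t - smooth2 (\<eta> * (w \<bullet> \<theta>s) / (norm w)\<^sup>2) (cross w \<theta>s / (norm w)\<^sup>2) (t \<bullet> \<theta>s)\<bar>
      \<le> (L * C1 S n + C2 S n) * (\<eta> * real n) powr (-1/2)"
    and L: "0 \<le> L" "L \<le> Fhat_inf S n d" and C: "0 \<le> C1 S n" "0 \<le> C2 S n"
    and sel: "norm \<theta>' = 1" "h' \<in> bandwidths S n"
    and min: "\<And>\<theta> h. norm \<theta> = 1 \<Longrightarrow> h \<in> bandwidths S n \<Longrightarrow> criterion S n d t \<theta>' h' \<le> criterion S n d t \<theta> h"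
  shows "\<exists>h\<in>bandwidths S n. h_star S n f (t \<bullet> \<theta>s) / 4 \<le> h \<and>
    \<bar>Fhat S n d \<theta>' h' t - f (t \<bullet> \<theta>s)\<bar> \<le> 7 * TH S n d h"
proof -
  have n2: "2 \<le> n" using n by simp
  let ?y = "t \<bullet> \<theta>s" and ?\<kappa> = "kernel_sup S"
  let ?D = "L * C1 S n + C2 S n"
  obtain h where h: "h \<in> bandwidths S n" "h_star S n f ?y / 4 \<le> h"
    and small: "\<And>\<eta> :: real. 0 < \<eta> \<Longrightarrow> \<eta> \<le> h \<Longrightarrow> Delta_star S f (2 * \<eta>) ?y \<le> ?\<kappa> * sqrt (ln n / (n * \<eta>))"
    using oracle_bandwidth(3)[OF n cond hmin] by blast
  define rt where "rt \<eta> = (\<eta> * real n) powr (-1/2)" for \<eta>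
  define B where "B = ?\<kappa>\<^sup>2 * sqrt (ln n)"
  have B0: "0 \<le> B" using n by (simp add: B_def)
  have rt0: "0 \<le> rt \<eta>" for \<eta> by (simp add: rt_def)
  have rt_mono: "rt \<eta>' \<le> rt \<eta>" if "0 < \<eta>" "\<eta> \<le> \<eta>'" for \<eta> \<eta>'
    unfolding rt_def using that n by (intro powr_mono2') auto
  have TH: "TH S n d \<eta> = 2 * (B + Fhat_inf S n d * C1 S n + C2 S n) * rt \<eta>" for \<eta>
    by (simp add: TH_def B_def rt_def)
  have coef: "B + ?D \<le> B + Fhat_inf S n d * C1 S n + C2 S n"
    using mult_right_mono[OF L(2) C(1)] by simp
  have D0: "0 \<le> ?D" using L C by simp
  \<comment> \<open>The factor 2 in \<open>TH\<close> covers a difference of two estimators, each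
    with one bias term and one stochastic term.\<close>
  have TH_ge: "2 * B * rt \<eta> + 2 * ?D * rt \<eta> \<le> TH S n d \<eta>" for \<eta>
    using mult_right_mono[OF coef rt0[of \<eta>]] by (simp add: TH algebra_simps)
  have TH0: "0 \<le> TH S n d \<eta>" for \<eta>
    using TH_ge[of \<eta>] mult_nonneg_nonneg[OF B0 rt0[of \<eta>]] mult_nonneg_nonneg[OF D0 rt0[of \<eta>]] by linarith
  have TH_mono: "TH S n d \<eta>' \<le> TH S n d \<eta>" if "0 < \<eta>" "\<eta> \<le> \<eta>'" for \<eta> \<eta>'
    unfolding TH using rt_mono[OF that] B0 D0 coef by (intro mult_left_mono) auto
  \<comment> \<open>One factor \<open>?\<kappa>\<close> comes from \<open>smooth2_smooth1\<close>,
    the other from the definition of \<open>h_star\<close>; hence the square in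
    \<open>TH\<close>.\<close>
  have bias2: "?\<kappa> * Delta_star S f (2 * \<eta>) ?y \<le> B * rt \<eta>" if "0 < \<eta>" "\<eta> \<le> h" for \<eta>
  proof -
    have "sqrt (ln n / (n * \<eta>)) = sqrt (ln n) * rt \<eta>"
    proof -
      have "rt \<eta> = 1 / sqrt (\<eta> * n)" unfolding rt_def using that by (intro powr_neg_half) simp
      then show ?thesis by (simp add: real_sqrt_divide mult.commute)
    qed
    moreover have "?\<kappa> * Delta_star S f (2 * \<eta>) ?y \<le> ?\<kappa> * (?\<kappa> * sqrt (ln n / (n * \<eta>)))"
      using small[OF that] kernel_sup_nonneg by (rule mult_left_mono)
    ultimately show ?thesis by (simp add: B_def power2_eq_square mult.assoc)
  qed
  have bias: "\<bar>smooth2 a b ?y - smooth1 b ?y\<bar> \<le> B * rt \<eta>" if "0 < \<eta>" "\<eta> \<le> h" "\<bar>a\<bar> \<le> 2 * \<eta>" for a b \<eta>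
    using smooth2_smooth1[of "2 * \<eta>" a b ?y] bias2[OF that(1,2)] that by simp
  have hpos: "0 < \<eta>" if "\<eta> \<in> bandwidths S n" for \<eta> using bandwidths_pos that .
  have single: "\<bar>Fhat S n d \<nu> \<eta> t - smooth1 (cross \<nu> \<theta>s) ?y\<bar> \<le> B * rt \<eta> + ?D * rt \<eta>"
    if "\<eta> \<in> bandwidths S n" "\<eta> \<le> h" "norm \<nu> = 1" for \<eta> \<nu>
  proof -
    have c: "\<bar>\<nu> \<bullet> \<theta>s\<bar> \<le> 1" using Cauchy_Schwarz_ineq2[of \<nu> \<theta>s] that \<theta>s by simp
    have "\<bar>\<eta> * (\<nu> \<bullet> \<theta>s)\<bar> \<le> 2 * \<eta>"
      using mult_left_mono[OF c, of \<eta>] hpos[OF that(1)] by (simp add: abs_mult)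
    from bias[OF hpos[OF that(1)] that(2) this, of "cross \<nu> \<theta>s"] dev[OF that(1), of \<nu>] that
    show ?thesis by (simp add: rt_def)
  qed
  have pair: "\<bar>Fhat S n d (pair_vec \<theta>s \<nu>) \<eta> t - smooth1 (cross \<nu> \<theta>s) ?y\<bar> \<le> B * rt \<eta> + ?D * rt \<eta>"
    if "\<eta> \<in> bandwidths S n" "\<eta> \<le> h" "norm \<nu> = 1" for \<eta> \<nu>
  proof -
    let ?w = "pair_vec \<theta>s \<nu>"
    note pv = pair_vec_scaled[OF \<theta>s that(3)] and nb = norm_pair_vec_bounds[OF \<theta>s that(3)]
    have "\<bar>\<eta> * (?w \<bullet> \<theta>s) / (norm ?w)\<^sup>2\<bar> = \<eta> * \<bar>(?w \<bullet> \<theta>s) / (norm ?w)\<^sup>2\<bar>"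
      using hpos[OF that(1)] by (simp add: abs_mult)
    also have "\<dots> \<le> 2 * \<eta>" using mult_left_mono[OF pv(1), of \<eta>] hpos[OF that(1)] by simp
    finally have "\<bar>\<eta> * (?w \<bullet> \<theta>s) / (norm ?w)\<^sup>2\<bar> \<le> 2 * \<eta>" .
    from bias[OF hpos[OF that(1)] that(2) this, of "cross ?w \<theta>s / (norm ?w)\<^sup>2"] dev[OF that(1) nb]
    show ?thesis by (simp add: rt_def pv(2))
  qed
  have R1: "R1 S n d t \<theta>s h = 0"
  proof (rule R1_eq_0[OF h(1) \<theta>s])
    fix \<eta> and \<nu> :: "real^2" assume *: "\<eta> \<in> bandwidths S n" "\<eta> \<le> h" "norm \<nu> = 1"
    show "\<bar>Fhat S n d (pair_vec \<theta>s \<nu>) \<eta> t - Fhat S n d \<nu> \<eta> t\<bar> \<le> TH S n d \<eta>"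
      using single[OF *] pair[OF *] TH_ge[of \<eta>] by linarith
  qed
  have R2: "R2 S n d t h = 0"
  proof (rule R2_eq_0[OF h(1)])
    fix \<eta> and \<nu> :: "real^2" assume *: "\<eta> \<in> bandwidths S n" "\<eta> \<le> h" "norm \<nu> = 1"
    have "B * rt h + ?D * rt h \<le> B * rt \<eta> + ?D * rt \<eta>"
      using rt_mono[OF hpos[OF *(1)] *(2)] B0 D0 by (intro add_mono mult_left_mono)
    then show "\<bar>Fhat S n d \<nu> h t - Fhat S n d \<nu> \<eta> t\<bar> \<le> TH S n d \<eta>"
      using single[OF *] single[OF h(1) order_refl *(3)] TH_ge[of \<eta>] by linarith
  qed
  \<comment> \<open>The true direction with bandwidth \<open>h\<close> has criterion
    \<open>TH h\<close>, so minimality bounds each of the nonnegative terms at the selected pair by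
    it.\<close>
  have crit: "R1 S n d t \<theta>' h' + R2 S n d t h' + TH S n d h' \<le> TH S n d h"
    using min[OF \<theta>s h(1)] by (simp add: criterion_def R1 R2)
  have R1': "0 \<le> R1 S n d t \<theta>' h'" and R2': "0 \<le> R2 S n d t h'"
  proof -
    have ne: "h' \<in> {\<eta> \<in> bandwidths S n. \<eta> \<le> h'}" using sel by simp
    have fin: "bdd_above (F ` {\<eta> \<in> bandwidths S n. \<eta> \<le> h'})" for F :: "real \<Rightarrow> real"
      using finite_bandwidths[OF n2] by simp
    show "0 \<le> R1 S n d t \<theta>' h'" unfolding R1_def by (rule cSUP_upper2[OF fin ne]) simp
    show "0 \<le> R2 S n d t h'" unfolding R2_def by (rule cSUP_upper2[OF fin ne]) simp
  qed
  \<comment> \<open>For \<open>h \<le> h'\<close> the comparison is part of \<open>R2\<close> at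
    \<open>h'\<close>. For \<open>h' < h\<close> it is part of \<open>R2\<close> at
    \<open>h\<close>, which vanishes, and \<open>TH h'\<close> is at most \<open>TH h\<close> by
    minimality.\<close>
  have "\<bar>Fhat S n d \<theta>' h' t - Fhat S n d \<theta>' h t\<bar> \<le> 2 * TH S n d h"
  proof (cases "h \<le> h'")
    case True
    then show ?thesis using R2_lower[OF n2 sel(1) h(1) True, of d t] crit R1' TH0[of h'] by linarith
  next
    case False
    then show ?thesis using R2_lower[OF n2 sel(1) sel(2), of h d t] crit R1' R2' R2 TH0[of h] by linarith
  qed
  moreover have "\<bar>Fhat S n d (pair_vec \<theta>' \<theta>s) h t - Fhat S n d \<theta>s h t\<bar> \<le> 2 * TH S n d h"
  proof (cases "h \<le> h'")
    case True
    then show ?thesis using R1_lower[OF n2 sel(1) \<theta>s h(1) True, of d t] crit R2' TH0[of h'] by linarith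
  next
    case False
    \<comment> \<open>This case is contradictory: \<open>TH\<close> is strictly decreasing because
      \<open>B\<close> is positive, while minimality gives \<open>TH h' \<le> TH h\<close>.\<close>
    then have "rt h \<le> rt h'" using rt_mono hpos[OF sel(2)] by simp
    have eq: "TH S n d h' = TH S n d h"
      using TH_mono[OF hpos[OF sel(2)], of h] False crit R1' R2' by linarith
    have "rt h < rt h'"
      unfolding rt_def using False hpos[OF sel(2)] n by (intro powr_less_mono2_neg) auto
    moreover have "2 * (B + Fhat_inf S n d * C1 S n + C2 S n) * (rt h' - rt h) = 0"
      using eq by (simp add: TH algebra_simps)
    moreover have "0 < B" using n kernel_sup_ge_1 by (simp add: B_def)
    ultimately show ?thesis using coef D0 by simp
  qed
  moreover have "\<bar>Fhat S n d (pair_vec \<theta>' \<theta>s) h t - Fhat S n d \<theta>' h t\<bar> \<le> TH S n d h"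
    using R1_lower[OF n2 \<theta>s sel(1) h(1) order_refl, of d t] R1 by (simp add: Fhat_pair_commute[of n d \<theta>s])
  moreover have "\<bar>Fhat S n d \<theta>s h t - f ?y\<bar> \<le> TH S n d h"
  proof -
    \<comment> \<open>For the true direction the orthogonal coefficient vanishes and the limit
      \<open>smooth1\<close> is \<open>f\<close> itself.\<close>
    have "cross \<theta>s \<theta>s = 0" by (simp add: cross_def)
    with single[OF h(1) order_refl \<theta>s] TH_ge[of h] mult_nonneg_nonneg[OF B0 rt0[of h]] mult_nonneg_nonneg[OF D0 rt0[of h]]
    show ?thesis unfolding \<open>cross \<theta>s \<theta>s = 0\<close> smooth1_zero by linarith
  qed
  ultimately have "\<bar>Fhat S n d \<theta>' h' t - f ?y\<bar> \<le> 7 * TH S n d h"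
    using TH0[of h] by linarith
  with h show ?thesis by blast
qed

end

section \<open>Uniform deviations\<close>

locale regression = procedure_setup S + prob_space P
  for S :: procedure and P :: "'w measure" +
  fixes X :: "nat \<Rightarrow> 'w \<Rightarrow> real^2" and \<epsilon> :: "nat \<Rightarrow> 'w \<Rightarrow> real" and p :: "real \<Rightarrow> real"
  assumes X_dens: "\<forall>i. distributed P lborel (X i) (\<lambda>x. ennreal (design S x))"
    and X_indep: "indep_vars (\<lambda>_. borel) X UNIV"
    and eps_dens: "\<forall>i. distributed P lborel (\<epsilon> i) (\<lambda>x. ennreal (p x))"
    and eps_class: "p \<in> noise_class S"
    and eps_sym: "symmetric_law (density lborel (\<lambda>x. ennreal (p x)))"
    and eps_indep: "indep_vars (\<lambda>_. borel) \<epsilon> UNIV"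
    and X_eps_indep: "indep_set
          (sets (vimage_algebra (space P) (\<lambda>w i. X i w) (PiM UNIV (\<lambda>_. borel))))
          (sets (vimage_algebra (space P) (\<lambda>w i. \<epsilon> i w) (PiM UNIV (\<lambda>_. borel))))"
begin

lemma X_measurable [measurable]: "X i \<in> borel_measurable P"
  using X_indep by (auto simp: indep_vars_def)

lemma eps_measurable [measurable]: "\<epsilon> i \<in> borel_measurable P"
  using eps_indep by (auto simp: indep_vars_def)

lemma design_borel [measurable]: "design S \<in> borel_measurable borel"
  using distributed_real_measurable[of lborel "design S" P "X 0"] X_dens design_nonneg by auto

lemma p_borel [measurable]: "p \<in> borel_measurable borel"
  using eps_class by (simp add: noise_class_def)

lemma p_nonneg: "0 \<le> p x"
  using eps_class by (simp add: noise_class_def)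

lemma distr_eps: "distr P lborel (\<epsilon> i) = density lborel (\<lambda>x. ennreal (p x))"
  using eps_dens by (simp add: distributed_distr_eq_density)

lemma prob_space_p: "prob_space (density lborel (\<lambda>x. ennreal (p x)))"
  unfolding distr_eps[of 0, symmetric] by (rule prob_space_distr) simp

lemma indep_pairs: "indep_vars (\<lambda>_. borel \<Otimes>\<^sub>M borel) (\<lambda>i w. (X i w, \<epsilon> i w)) UNIV"
  by (rule indep_vars_Pair[OF X_indep eps_indep X_eps_indep])

text \<open>Functions of single terms generate \<sigma>-algebras contained in those of the whole
  sequences, which are independent.\<close>

lemma indep_X_eps:
  fixes g :: "real^2 \<Rightarrow> real" and k :: "real \<Rightarrow> real"
  assumes g [measurable]: "g \<in> borel_measurable borel" and k [measurable]: "k \<in> borel_measurable borel"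
  shows "indep_var borel (\<lambda>w. g (X i w)) borel (\<lambda>w. k (\<epsilon> i w))"
proof -
  have sub: "sigma_sets (space P) {(\<lambda>w. f (Z i w)) -` A \<inter> space P | A. A \<in> sets borel}
      \<subseteq> sets (vimage_algebra (space P) (\<lambda>w i. Z i w) (PiM UNIV (\<lambda>_. borel)))"
    if f: "f \<in> borel_measurable borel"
    for Z :: "nat \<Rightarrow> 'w \<Rightarrow> 'b::topological_space" and f :: "'b \<Rightarrow> real"
  proof -
    let ?V = "vimage_algebra (space P) (\<lambda>w i. Z i w) (PiM UNIV (\<lambda>_. borel))"
    have "{(\<lambda>w. f (Z i w)) -` A \<inter> space P | A. A \<in> sets borel} \<subseteq> sets ?V"
    proof (intro subsetI, elim CollectE exE conjE)
      fix a A assume a: "a = (\<lambda>w. f (Z i w)) -` A \<inter> space P" and A: "A \<in> sets borel"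
      have "f -` A \<in> sets borel" using measurable_sets_borel[OF f A] .
      then have "{x \<in> space (PiM UNIV (\<lambda>_. borel)). x i \<in> f -` A} \<in> sets (PiM UNIV (\<lambda>_. borel))"
        by (rule measurable_Collect_PiM)
      then have "(\<lambda>w i. Z i w) -` {x \<in> space (PiM UNIV (\<lambda>_. borel)). x i \<in> f -` A} \<inter> space P \<in> sets ?V"
        by (rule in_vimage_algebra)
      moreover have "(\<lambda>w i. Z i w) -` {x \<in> space (PiM UNIV (\<lambda>_. borel)). x i \<in> f -` A} \<inter> space P = a"
        unfolding a by (auto simp: space_PiM)
      ultimately show "a \<in> sets ?V" by simp
    qed
    from sets.sigma_sets_subset[OF this] show ?thesis by simp
  qed
  have "indep_set (sigma_sets (space P) {(\<lambda>w. g (X i w)) -` A \<inter> space P | A. A \<in> sets borel})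
      (sigma_sets (space P) {(\<lambda>w. k (\<epsilon> i w)) -` A \<inter> space P | A. A \<in> sets borel})"
    using X_eps_indep unfolding indep_set_def
    by (rule indep_sets_mono_sets) (use sub[OF g, of X] sub[OF k, of \<epsilon>] in \<open>simp split: bool.split\<close>)
  then show ?thesis unfolding indep_var_eq by simp
qed

lemma expectation_X:
  fixes g :: "real^2 \<Rightarrow> real"
  assumes "g \<in> borel_measurable borel"
  shows "expectation (\<lambda>w. g (X i w)) = (LBINT x. design S x * g x)"
  using distributed_integral[OF X_dens[rule_format], of g i] assms design_nonneg by simp

lemma expectation_eps:
  fixes g :: "real \<Rightarrow> real"
  assumes "g \<in> borel_measurable borel"
  shows "expectation (\<lambda>w. g (\<epsilon> i w)) = (LBINT x. p x * g x)"
  using distributed_integral[OF eps_dens[rule_format], of g i] assms p_nonneg by simp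

text \<open>An odd function, so that the truncated noise stays centred by symmetry while Bernstein's
  inequality gets a bounded variable.\<close>

definition trunc :: "real \<Rightarrow> real \<Rightarrow> real" where
  "trunc \<tau> u = (if \<bar>u\<bar> \<le> \<tau> then u else 0)"

lemma trunc_borel [measurable]: "trunc \<tau> \<in> borel_measurable borel"
  unfolding trunc_def[abs_def] by measurable

lemma abs_trunc_le: "0 \<le> \<tau> \<Longrightarrow> \<bar>trunc \<tau> u\<bar> \<le> \<tau>"
  by (simp add: trunc_def)

lemma expectation_trunc: "expectation (\<lambda>w. trunc \<tau> (\<epsilon> i w)) = 0"
proof -
  let ?\<mu> = "density lborel (\<lambda>x. ennreal (p x))"
  have "expectation (\<lambda>w. trunc \<tau> (\<epsilon> i w)) = (\<integral>u. trunc \<tau> u \<partial>?\<mu>)"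
    unfolding distr_eps[of i, symmetric] by (simp add: integral_distr)
  moreover have "(\<integral>u. trunc \<tau> u \<partial>?\<mu>) = (\<integral>u. trunc \<tau> u \<partial>(distr ?\<mu> borel uminus))"
    using eps_sym by (simp add: symmetric_law_def)
  moreover have "\<dots> = (\<integral>u. trunc \<tau> (- u) \<partial>?\<mu>)"
    by (subst integral_distr) auto
  moreover have "\<dots> = - (\<integral>u. trunc \<tau> u \<partial>?\<mu>)"
  proof -
    have "trunc \<tau> (- u) = - trunc \<tau> u" for u by (simp add: trunc_def)
    then show ?thesis by simp
  qed
  ultimately show ?thesis by linarith
qed

lemma expectation_trunc_square: "expectation (\<lambda>w. (trunc \<tau> (\<epsilon> i w))\<^sup>2) \<le> (sigma S)\<^sup>2"
proof -
  note sq = integrable_noise_square[OF eps_class eps_sym noise_params(1,2,4)]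
  have "expectation (\<lambda>w. (trunc \<tau> (\<epsilon> i w))\<^sup>2) = (LBINT x. p x * (trunc \<tau> x)\<^sup>2)"
    by (rule expectation_eps) measurable
  also have "\<dots> \<le> (LBINT x. x\<^sup>2 * p x)"
  proof (rule integral_mono_AE)
    show "integrable lborel (\<lambda>x. p x * (trunc \<tau> x)\<^sup>2)"
      by (rule Bochner_Integration.integrable_bound[OF sq])
        (auto simp: trunc_def p_nonneg abs_mult)
  qed (use sq p_nonneg in \<open>auto simp: trunc_def\<close>)
  also have "\<dots> \<le> (sigma S)\<^sup>2"
    by (rule noise_variance_le_sigma[OF eps_class eps_sym prob_space_p noise_params(1,2,4)])
  finally show ?thesis .
qed

definition cube :: "(real^2) set" where
  "cube = cbox (vec (-3)) (vec 3)"

text \<open>Division by the design density is harmless because the weight vanishes outside the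
  square on which the density is bounded below.\<close>

lemma weight_bound:
  assumes supp: "\<And>x. \<psi> x \<noteq> 0 \<Longrightarrow> x \<in> cube" and le: "\<bar>\<psi> x\<bar> \<le> c"
  shows "\<bar>\<psi> x / design S x\<bar> \<le> c / glow S"
proof (cases "x \<in> cube")
  case True
  then show ?thesis
    using design_ge_glow[of x] glow le by (auto simp: cube_def abs_divide intro!: frac_le)
next
  case False
  then have "\<psi> x = 0" using supp by blast
  then show ?thesis using le glow by simp
qed

text \<open>The density of \<open>X\<close> cancels one of the two factors
  \<open>1 / design\<close>, so only one factor \<open>1 / glow\<close> remains.\<close>

lemma weight_second_moment:
  assumes supp: "\<And>x. \<psi> x \<noteq> 0 \<Longrightarrow> x \<in> cube" and [measurable]: "\<psi> \<in> borel_measurable borel"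
    and int: "integrable lborel (\<lambda>x. (\<psi> x)\<^sup>2)"
  shows "expectation (\<lambda>w. (\<psi> (X i w) / design S (X i w))\<^sup>2) \<le> (LBINT x. (\<psi> x)\<^sup>2) / glow S"
proof -
  have pt: "design S x * (\<psi> x / design S x)\<^sup>2 \<le> (\<psi> x)\<^sup>2 / glow S" for x
  proof (cases "\<psi> x = 0")
    case False
    then have g: "glow S \<le> design S x" using supp design_ge_glow by (simp add: cube_def)
    then have "design S x * (\<psi> x / design S x)\<^sup>2 = (\<psi> x)\<^sup>2 / design S x"
      using glow by (simp add: power2_eq_square)
    also have "\<dots> \<le> (\<psi> x)\<^sup>2 / glow S" using g glow by (intro divide_left_mono) auto
    finally show ?thesis .
  qed simp
  have "expectation (\<lambda>w. (\<psi> (X i w) / design S (X i w))\<^sup>2) = (LBINT x. design S x * (\<psi> x / design S x)\<^sup>2)"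
    by (rule expectation_X[where g = "\<lambda>x. (\<psi> x / design S x)\<^sup>2"]) measurable
  also have "\<dots> \<le> (LBINT x. (\<psi> x)\<^sup>2 / glow S)"
  proof (rule integral_mono)
    have int': "integrable lborel (\<lambda>x. (\<psi> x)\<^sup>2 / glow S)" using int by simp
    show "integrable lborel (\<lambda>x. design S x * (\<psi> x / design S x)\<^sup>2)"
    proof (rule Bochner_Integration.integrable_bound[OF int'])
      show "AE x in lborel. norm (design S x * (\<psi> x / design S x)\<^sup>2) \<le> norm ((\<psi> x)\<^sup>2 / glow S)"
        using pt design_nonneg glow by simp
    qed measurable
    show "integrable lborel (\<lambda>x. (\<psi> x)\<^sup>2 / glow S)" by (rule int')
  qed (rule pt)
  also have "\<dots> = (LBINT x. (\<psi> x)\<^sup>2) / glow S" by simp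
  finally show ?thesis .
qed

text \<open>Design and noise are independent, so both moments factor, and the noise factor of the
  mean is zero.\<close>

lemma weight_noise_moments:
  assumes supp: "\<And>x. \<psi> x \<noteq> 0 \<Longrightarrow> x \<in> cube" and [measurable]: "\<psi> \<in> borel_measurable borel"
    and le: "\<And>x. \<bar>\<psi> x\<bar> \<le> c" and int: "integrable lborel (\<lambda>x. (\<psi> x)\<^sup>2)" and \<tau>: "0 \<le> \<tau>"
  shows "expectation (\<lambda>w. \<psi> (X i w) / design S (X i w) * trunc \<tau> (\<epsilon> i w)) = 0"
    and "expectation (\<lambda>w. (\<psi> (X i w) / design S (X i w) * trunc \<tau> (\<epsilon> i w))\<^sup>2)
      \<le> (LBINT x. (\<psi> x)\<^sup>2) / glow S * (sigma S)\<^sup>2"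
proof -
  define g where "g x = \<psi> x / design S x" for x
  have [measurable]: "g \<in> borel_measurable borel" unfolding g_def[abs_def] by measurable
  have gb: "\<bar>g x\<bar> \<le> c / glow S" for x unfolding g_def by (rule weight_bound[OF supp le])
  have ig: "integrable P (\<lambda>w. g (X i w))"
    by (rule integrable_const_bound[where B = "c / glow S"]) (auto simp: gb)
  have it: "integrable P (\<lambda>w. trunc \<tau> (\<epsilon> i w))"
    by (rule integrable_const_bound[where B = \<tau>]) (auto simp: abs_trunc_le \<tau>)
  have ig2: "integrable P (\<lambda>w. (g (X i w))\<^sup>2)"
    by (rule integrable_const_bound[where B = "(c / glow S)\<^sup>2"]) (auto simp: gb power2_le_if_abs_le)
  have it2: "integrable P (\<lambda>w. (trunc \<tau> (\<epsilon> i w))\<^sup>2)"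
    by (rule integrable_const_bound[where B = "\<tau>\<^sup>2"]) (auto simp: abs_trunc_le \<tau> power2_le_if_abs_le)
  have ind: "indep_var borel (\<lambda>w. g (X i w)) borel (\<lambda>w. trunc \<tau> (\<epsilon> i w))"
    by (rule indep_X_eps) measurable
  have ind2: "indep_var borel (\<lambda>w. (g (X i w))\<^sup>2) borel (\<lambda>w. (trunc \<tau> (\<epsilon> i w))\<^sup>2)"
    by (rule indep_X_eps[of "\<lambda>x. (g x)\<^sup>2" "\<lambda>u. (trunc \<tau> u)\<^sup>2"]) measurable
  have "expectation (\<lambda>w. g (X i w) * trunc \<tau> (\<epsilon> i w))
      = expectation (\<lambda>w. g (X i w)) * expectation (\<lambda>w. trunc \<tau> (\<epsilon> i w))"
    by (rule indep_var_lebesgue_integral[OF ind ig it])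
  then show "expectation (\<lambda>w. \<psi> (X i w) / design S (X i w) * trunc \<tau> (\<epsilon> i w)) = 0"
    by (simp add: expectation_trunc g_def)
  have "expectation (\<lambda>w. (g (X i w) * trunc \<tau> (\<epsilon> i w))\<^sup>2)
      = expectation (\<lambda>w. (g (X i w))\<^sup>2) * expectation (\<lambda>w. (trunc \<tau> (\<epsilon> i w))\<^sup>2)"
    using indep_var_lebesgue_integral[OF ind2 ig2 it2] by (simp add: power_mult_distrib)
  also have "\<dots> \<le> (LBINT x. (\<psi> x)\<^sup>2) / glow S * (sigma S)\<^sup>2"
    using weight_second_moment[OF supp _ int, of i] glow
    by (intro mult_mono expectation_trunc_square) (auto simp: g_def intro!: Bochner_Integration.integral_nonneg divide_nonneg_pos)
  finally show "expectation (\<lambda>w. (\<psi> (X i w) / design S (X i w) * trunc \<tau> (\<epsilon> i w))\<^sup>2)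
      \<le> (LBINT x. (\<psi> x)\<^sup>2) / glow S * (sigma S)\<^sup>2"
    by (simp add: g_def)
qed

text \<open>The importance weight \<open>1 / design\<close> turns the mean into a Lebesgue integral;
  where the density vanishes, so does \<psi>.\<close>

lemma weight_design_moments:
  assumes supp: "\<And>x. \<psi> x \<noteq> 0 \<Longrightarrow> x \<in> cube" and [measurable]: "\<psi> \<in> borel_measurable borel"
    and le: "\<And>x. \<bar>\<psi> x\<bar> \<le> c" and int: "integrable lborel (\<lambda>x. (\<psi> x)\<^sup>2)"
    and [measurable]: "G \<in> borel_measurable borel" and G: "\<And>x. \<psi> x \<noteq> 0 \<Longrightarrow> \<bar>G x\<bar> \<le> 1"
  shows "expectation (\<lambda>w. \<psi> (X i w) / design S (X i w) * G (X i w)) = (LBINT x. \<psi> x * G x)"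
    and "expectation (\<lambda>w. (\<psi> (X i w) / design S (X i w) * G (X i w))\<^sup>2) \<le> (LBINT x. (\<psi> x)\<^sup>2) / glow S"
proof -
  have "expectation (\<lambda>w. \<psi> (X i w) / design S (X i w) * G (X i w)) = (LBINT x. design S x * (\<psi> x / design S x * G x))"
    by (rule expectation_X[where g = "\<lambda>x. \<psi> x / design S x * G x"]) measurable
  moreover have "design S x * (\<psi> x / design S x * G x) = \<psi> x * G x" for x
  proof (cases "\<psi> x = 0")
    case False
    then have "0 < design S x" using supp[of x] design_ge_glow[of x] glow by (simp add: cube_def)
    then show ?thesis by simp
  qed simp
  ultimately show "expectation (\<lambda>w. \<psi> (X i w) / design S (X i w) * G (X i w)) = (LBINT x. \<psi> x * G x)"
    by (simp only:)
  have gb: "\<bar>\<psi> x / design S x\<bar> \<le> c / glow S" for x by (rule weight_bound[OF supp le])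
  have pt: "\<bar>\<psi> x / design S x * G x\<bar> \<le> \<bar>\<psi> x / design S x\<bar>" for x
  proof (cases "\<psi> x = 0")
    case False
    from mult_left_mono[OF G[OF this], of "\<bar>\<psi> x / design S x\<bar>"] show ?thesis
      unfolding abs_mult by simp
  qed simp
  have i2: "integrable P (\<lambda>w. (\<psi> (X i w) / design S (X i w))\<^sup>2)"
  proof (rule integrable_const_bound[where B = "(c / glow S)\<^sup>2"])
    show "AE w in P. norm ((\<psi> (X i w) / design S (X i w))\<^sup>2) \<le> (c / glow S)\<^sup>2"
      using power2_le_if_abs_le[OF gb] by (intro AE_I2) (simp only: real_norm_def abs_power2)
  qed measurable
  have "expectation (\<lambda>w. (\<psi> (X i w) / design S (X i w) * G (X i w))\<^sup>2) \<le> expectation (\<lambda>w. (\<psi> (X i w) / design S (X i w))\<^sup>2)"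
  proof (rule integral_mono)
    have sq: "(\<psi> x / design S x * G x)\<^sup>2 \<le> (\<psi> x / design S x)\<^sup>2" for x
      using power2_le_if_abs_le[OF pt[of x]] by (simp only: power2_abs)
    show "integrable P (\<lambda>w. (\<psi> (X i w) / design S (X i w) * G (X i w))\<^sup>2)"
      by (rule Bochner_Integration.integrable_bound[OF i2]) (measurable, rule AE_I2, use sq in simp)
    show "(\<psi> (X i w) / design S (X i w) * G (X i w))\<^sup>2 \<le> (\<psi> (X i w) / design S (X i w))\<^sup>2" for w
      by (rule sq)
  qed (rule i2)
  also have "\<dots> \<le> (LBINT x. (\<psi> x)\<^sup>2) / glow S" by (rule weight_second_moment[OF supp _ int]) measurable
  finally show "expectation (\<lambda>w. (\<psi> (X i w) / design S (X i w) * G (X i w))\<^sup>2) \<le> (LBINT x. (\<psi> x)\<^sup>2) / glow S" .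
qed

text \<open>Bernstein's inequality and a union bound over the net, then transfer to
  \<open>A\<close>. A net point has the same \<open>D\<close> as the point it replaces, so the
  threshold does not change; the empirical mean and the expectation each move by at most
  \<open>b * \<delta> / glow S\<close>, which gives the factor 2 in the last term.\<close>

lemma uniform_deviation:
  fixes \<psi> :: "'e \<Rightarrow> real^2 \<Rightarrow> real" and W :: "real^2 \<Rightarrow> real \<Rightarrow> real" and D m :: "'e \<Rightarrow> real" and n :: nat
  defines "Z \<equiv> \<lambda>e i w. \<psi> e (X i w) / design S (X i w) * W (X i w) (\<epsilon> i w)"
  assumes N: "finite N" "N \<subseteq> A"
    and \<psi> [measurable]: "\<And>e. \<psi> e \<in> borel_measurable borel"
    and W [measurable]: "case_prod W \<in> borel_measurable (borel \<Otimes>\<^sub>M borel)"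
    and supp: "\<And>e x. e \<in> A \<Longrightarrow> \<psi> e x \<noteq> 0 \<Longrightarrow> x \<in> cube"
    and Wb: "\<And>e x u. e \<in> A \<Longrightarrow> \<psi> e x \<noteq> 0 \<Longrightarrow> \<bar>W x u\<bar> \<le> b"
    and bound: "\<And>e x. e \<in> A \<Longrightarrow> \<bar>\<psi> e x\<bar> \<le> D e * (kernel_sup S)\<^sup>2"
    and second: "\<And>e i. e \<in> A \<Longrightarrow> expectation (\<lambda>w. (Z e i w)\<^sup>2) \<le> s\<^sup>2 * D e * (kernel_sup S) ^ 4 / glow S"
    and mean: "\<And>e i. e \<in> A \<Longrightarrow> expectation (Z e i) = m e"
    and net: "\<And>e. e \<in> A \<Longrightarrow> \<exists>e'\<in>N. D e' = D e \<and> (\<forall>x. \<bar>\<psi> e x - \<psi> e' x\<bar> \<le> \<delta>)"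
    and pos: "\<And>e. e \<in> A \<Longrightarrow> 0 < D e" "0 < s" "0 < b" "0 < x" "0 < n" "0 \<le> \<delta>"
  shows "\<exists>B\<in>events. prob B \<le> card N * (2 * exp (- x)) \<and>
    (\<forall>w\<in>space P - B. \<forall>e\<in>A. \<bar>(\<Sum>i<n. Z e i w) / n - m e\<bar>
      \<le> 2 * s * (kernel_sup S)\<^sup>2 * sqrt (D e * x / (glow S * n)) + b * (kernel_sup S)\<^sup>2 * D e * x / (glow S * n)
        + 2 * b * \<delta> / glow S)"
proof -
  let ?\<kappa> = "kernel_sup S"
  have \<kappa>: "1 \<le> ?\<kappa>" by (rule kernel_sup_ge_1)
  have Zm [measurable]: "Z e i \<in> borel_measurable P" for e i
  proof -
    have "(\<lambda>w. case_prod W (X i w, \<epsilon> i w)) \<in> borel_measurable P" by measurable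
    then show ?thesis unfolding Z_def by simp
  qed
  define V where "V e = s\<^sup>2 * D e * ?\<kappa> ^ 4 / glow S" for e
  define B0 where "B0 e = b * ?\<kappa>\<^sup>2 * D e / glow S" for e
  define T where "T e = 2 * sqrt (n * V e * x) + B0 e * x" for e
  define Bad where "Bad e = {w \<in> space P. \<bar>\<Sum>i<n. Z e i w - expectation (Z e i)\<bar> \<ge> T e}" for e
  have BadM [measurable]: "Bad e \<in> events" for e unfolding Bad_def by measurable
  have Zb: "\<bar>Z e i w\<bar> \<le> B0 e" if "e \<in> A" for e i w
  proof (cases "\<psi> e (X i w) = 0")
    case True
    then show ?thesis using pos that glow \<kappa> by (simp add: Z_def B0_def less_imp_le)
  next
    case False
    have "\<bar>\<psi> e (X i w) / design S (X i w)\<bar> \<le> D e * ?\<kappa>\<^sup>2 / glow S"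
      by (rule weight_bound) (use supp bound that in auto)
    from mult_mono[OF this Wb[OF that False, of "\<epsilon> i w"]] pos that glow
    show ?thesis by (simp add: Z_def B0_def abs_mult mult_ac less_imp_le)
  qed
  have ZI: "integrable P (Z e i)" if "e \<in> A" for e i
    by (rule integrable_const_bound[where B = "B0 e"]) (use Zb that in auto)
  have ind: "indep_vars (\<lambda>_. borel) (Z e) UNIV" for e
  proof -
    have "(\<lambda>(x, u). \<psi> e x / design S x * W x u) \<in> borel_measurable (borel \<Otimes>\<^sub>M borel)"
    proof -
      have "(\<lambda>z. \<psi> e (fst z) / design S (fst z) * case_prod W z) \<in> borel_measurable (borel \<Otimes>\<^sub>M borel)"
        by measurable
      then show ?thesis by (simp add: case_prod_beta')
    qed
    from indep_vars_compose2[OF indep_pairs, where Y = "\<lambda>_ (x, u). \<psi> e x / design S x * W x u", OF this]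
    show ?thesis by (simp add: Z_def)
  qed
  have pBad: "prob (Bad e) \<le> 2 * exp (- x)" if e: "e \<in> A" for e
  proof -
    have "0 < B0 e" "0 < V e" using pos e glow \<kappa> by (simp_all add: B0_def V_def)
    then show ?thesis unfolding Bad_def T_def
      by (intro bernstein[OF ind]) (use Zb[OF e] second[OF e] pos V_def in auto)
  qed
  define B where "B = (\<Union>e\<in>N. Bad e)"
  have BM: "B \<in> events" unfolding B_def using N by (intro sets.finite_UN) auto
  have "prob B \<le> (\<Sum>e\<in>N. prob (Bad e))"
    unfolding B_def using N by (intro finite_measure_subadditive_finite) auto
  also have "\<dots> \<le> (\<Sum>e\<in>N. 2 * exp (- x))" using N pBad by (intro sum_mono) auto
  finally have pB: "prob B \<le> card N * (2 * exp (- x))" by simp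
  have dev: "\<bar>(\<Sum>i<n. Z e i w) / n - m e\<bar> \<le> T e / n" if "e \<in> N" "w \<in> space P - B" for e w
  proof -
    have e: "e \<in> A" using that N by auto
    have "\<bar>\<Sum>i<n. Z e i w - expectation (Z e i)\<bar> \<le> T e"
      using that by (auto simp: B_def Bad_def)
    then have "\<bar>(\<Sum>i<n. Z e i w) - n * m e\<bar> \<le> T e"
      by (simp add: mean[OF e] sum_subtractf)
    then have "\<bar>(\<Sum>i<n. Z e i w) - n * m e\<bar> / n \<le> T e / n" by (rule divide_right_mono) simp
    moreover have "\<bar>(\<Sum>i<n. Z e i w) - n * m e\<bar> / n = \<bar>(\<Sum>i<n. Z e i w) / n - m e\<bar>"
    proof -
      have "((\<Sum>i<n. Z e i w) - n * m e) / n = (\<Sum>i<n. Z e i w) / n - m e"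
        using pos by (simp add: field_simps)
      then show ?thesis by (metis abs_divide abs_of_nat)
    qed
    ultimately show ?thesis by simp
  qed
  have Teq: "T e / n = 2 * s * ?\<kappa>\<^sup>2 * sqrt (D e * x / (glow S * n)) + b * ?\<kappa>\<^sup>2 * D e * x / (glow S * n)"
    if "e \<in> A" for e
  proof -
    have "n * V e * x = (s * ?\<kappa>\<^sup>2 * n)\<^sup>2 * (D e * x / (glow S * n))"
      using pos glow by (simp add: V_def power2_eq_square power4_eq_xxxx)
    then have "sqrt (n * V e * x) = s * ?\<kappa>\<^sup>2 * n * sqrt (D e * x / (glow S * n))"
      by (simp only: real_sqrt_mult real_sqrt_abs) (use pos \<kappa> in simp)
    then show ?thesis using pos by (simp add: T_def B0_def add_divide_distrib)
  qed
  have close: "\<bar>Z e i w - Z e' i w\<bar> \<le> b * \<delta> / glow S"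
    if ee: "e \<in> A" "e' \<in> A" and d: "\<And>x. \<bar>\<psi> e x - \<psi> e' x\<bar> \<le> \<delta>" for e e' i w
  proof (cases "\<psi> e (X i w) = 0 \<and> \<psi> e' (X i w) = 0")
    case True
    then show ?thesis using pos glow by (simp add: Z_def)
  next
    case False
    then have Wle: "\<bar>W (X i w) (\<epsilon> i w)\<bar> \<le> b" and "X i w \<in> cube" using Wb supp ee by blast+
    then have g: "glow S \<le> design S (X i w)" using design_ge_glow by (simp add: cube_def)
    have "Z e i w - Z e' i w = (\<psi> e (X i w) - \<psi> e' (X i w)) / design S (X i w) * W (X i w) (\<epsilon> i w)"
      by (simp add: Z_def diff_divide_distrib algebra_simps)
    also have "\<bar>\<dots>\<bar> = \<bar>\<psi> e (X i w) - \<psi> e' (X i w)\<bar> / design S (X i w) * \<bar>W (X i w) (\<epsilon> i w)\<bar>"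
      using g glow by (simp add: abs_mult)
    also have "\<dots> \<le> \<delta> / glow S * b"
      using d[of "X i w"] g glow Wle pos by (intro mult_mono frac_le) auto
    finally show ?thesis by (simp add: mult.commute)
  qed
  show ?thesis
  proof (intro bexI[of _ B] conjI ballI)
    fix w e assume w: "w \<in> space P - B" and e: "e \<in> A"
    obtain e' where e': "e' \<in> N" "D e' = D e" and d: "\<And>x. \<bar>\<psi> e x - \<psi> e' x\<bar> \<le> \<delta>"
      using net[OF e] by blast
    have e'A: "e' \<in> A" using e' N by auto
    note cl = close[OF e e'A d]
    have "\<bar>(\<Sum>i<n. Z e i w) - (\<Sum>i<n. Z e' i w)\<bar> \<le> (\<Sum>i<n. b * \<delta> / glow S)"
      unfolding sum_subtractf[symmetric] by (rule order_trans[OF sum_abs]) (intro sum_mono cl)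
    then have "\<bar>(\<Sum>i<n. Z e i w) - (\<Sum>i<n. Z e' i w)\<bar> / n \<le> b * \<delta> / glow S"
      using pos by (simp add: divide_le_eq mult.commute)
    then have 1: "\<bar>(\<Sum>i<n. Z e i w) / n - (\<Sum>i<n. Z e' i w) / n\<bar> \<le> b * \<delta> / glow S"
      by (simp add: abs_divide flip: diff_divide_distrib)
    \<comment> \<open>All terms of the sample have the same mean; the term of index 0 represents
      them.\<close>
    have "m e - m e' = expectation (\<lambda>w. Z e 0 w - Z e' 0 w)"
      using mean[OF e, of 0] mean[OF e'A, of 0] ZI[OF e] ZI[OF e'A] by simp
    also have "\<bar>\<dots>\<bar> \<le> expectation (\<lambda>w. \<bar>Z e 0 w - Z e' 0 w\<bar>)" by (rule integral_abs_bound)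
    also have "\<dots> \<le> expectation (\<lambda>w. b * \<delta> / glow S)"
      using ZI[OF e] ZI[OF e'A] by (intro integral_mono cl integrable_abs) auto
    finally have 2: "\<bar>m e - m e'\<bar> \<le> b * \<delta> / glow S" by (simp add: prob_space)
    have 3: "\<bar>(\<Sum>i<n. Z e' i w) / n - m e'\<bar> \<le> T e / n"
      using dev[OF e'(1) w] Teq[OF e] Teq[OF e'A] e'(2) by simp
    show "\<bar>(\<Sum>i<n. Z e i w) / n - m e\<bar>
      \<le> 2 * s * ?\<kappa>\<^sup>2 * sqrt (D e * x / (glow S * n)) + b * ?\<kappa>\<^sup>2 * D e * x / (glow S * n) + 2 * b * \<delta> / glow S"
      using 1 2 3 Teq[OF e] by linarith
  qed (use BM pB in auto)
qed

end

section \<open>Kernel weights, discretization errors and cardinalities\<close>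

context procedure_setup
begin

text \<open>The product of the net spacing \<open>1 / n^4\<close>, the Lipschitz constant
  \<open>4 * (lipK S)\<^sup>2 / \<eta>\<^sup>2\<close> of the weights, and the bound
  \<open>1 / \<eta>\<^sup>2 \<le> 4 * n\<^sup>2\<close> on the bandwidth grid.\<close>

abbreviation mesh :: "nat \<Rightarrow> real" where
  "mesh n \<equiv> 16 * (lipK S)\<^sup>2 / (real n)\<^sup>2"

text \<open>\<open>N\<close> is the effective sample size, \<open>\<eta> * n\<close> for directions
  and \<open>n * hfrak^2\<close> for points. The two summands are the variance part and the range
  part and have the shape of those in \<open>C1\<close> to \<open>C4\<close>.\<close>

abbreviation budget :: "real \<Rightarrow> real \<Rightarrow> real \<Rightarrow> real \<Rightarrow> real" where
  "budget s b c N \<equiv> (2 * sqrt 2 * s * glow S powr (-1/2) * (kernel_sup S)\<^sup>2 * sqrt c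
    + c / 2 * b * (kernel_sup S)\<^sup>2 / glow S * N powr (-1/2)) * N powr (-1/2)"

definition psi :: "real^2^2 \<Rightarrow> real^2 \<Rightarrow> real^2 \<Rightarrow> real" where
  "psi E v x = det E * kernel2 S (E *v (x - v))"

lemma psi_borel [measurable]: "psi E v \<in> borel_measurable borel"
proof -
  have [measurable]: "(\<lambda>x. E *v (x - v)) \<in> borel \<rightarrow>\<^sub>M borel" by (rule borel_measurable_affine_matrix)
  show ?thesis unfolding psi_def[abs_def] by measurable
qed

lemma Fhat_mat_psi: "Fhat_mat S n d E v = (\<Sum>i<n. psi E v (fst (d i)) / design S (fst (d i)) * snd (d i)) / n"
  by (simp add: Fhat_mat_def psi_def sum_distrib_left sum_divide_distrib mult_ac)

lemma abs_psi_le: "0 < det E \<Longrightarrow> det E \<le> D \<Longrightarrow> \<bar>psi E v x\<bar> \<le> D * (kernel_sup S)\<^sup>2"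
  unfolding psi_def abs_mult by (intro mult_mono abs_kernel2_le) auto

text \<open>One of the two factors \<open>det E\<close> in the square is absorbed by the change of
  variables.\<close>

lemma
  assumes det: "0 < det E" and D: "det E \<le> D"
  shows integrable_psi_square: "integrable lborel (\<lambda>x. (psi E v x)\<^sup>2)"
    and integral_psi_square_le: "(LBINT x. (psi E v x)\<^sup>2) \<le> D * (kernel_sup S) ^ 4"
proof -
  have eq: "(psi E v x)\<^sup>2 = det E * (det E * (kernel2 S (E *v (x - v)))\<^sup>2)" for x
    by (simp add: psi_def power2_eq_square)
  have [measurable]: "(\<lambda>u. (kernel2 S u)\<^sup>2) \<in> borel_measurable borel" by measurable
  have "integrable lborel (\<lambda>u. (kernel2 S u)\<^sup>2)"
    using integrable_kernel2_times[OF kernel2_borel abs_kernel2_le] by (simp add: power2_eq_square)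
  then have "integrable lborel (\<lambda>x. det E * (kernel2 S (E *v (x - v)))\<^sup>2)"
    by (subst lborel_integrable_linear_image[OF det, of "\<lambda>u. (kernel2 S u)\<^sup>2"]) auto
  then show "integrable lborel (\<lambda>x. (psi E v x)\<^sup>2)" unfolding eq by (rule integrable_mult_right)
  have "(LBINT x. (psi E v x)\<^sup>2) = det E * (LBINT x. det E * (kernel2 S (E *v (x - v)))\<^sup>2)"
    unfolding eq by (rule integral_mult_right_zero)
  also have "\<dots> = det E * (LBINT u. (kernel2 S u)\<^sup>2)"
    by (subst lborel_integral_linear_image[OF det, of "\<lambda>u. (kernel2 S u)\<^sup>2"]) auto
  also have "\<dots> \<le> D * (kernel_sup S) ^ 4"
    using det D by (intro mult_mono integral_kernel2_square Bochner_Integration.integral_nonneg) auto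
  finally show "(LBINT x. (psi E v x)\<^sup>2) \<le> D * (kernel_sup S) ^ 4" .
qed

lemma psi_E_single: "psi (E_single w h) v x = (norm w)\<^sup>2 / h * (kern S ((w \<bullet> (x - v)) / h) * kern S (cross w (x - v)))"
  by (simp add: psi_def det_E_single kernel2_E_single)

lemma kern_product_diff:
  assumes "\<bar>a - a'\<bar> \<le> e" "\<bar>b - b'\<bar> \<le> e'"
  shows "\<bar>kern S a * kern S b - kern S a' * kern S b'\<bar> \<le> kernel_sup S * lipK S * (e + e')"
proof -
  have "kern S a * kern S b - kern S a' * kern S b' = kern S b * (kern S a - kern S a') + kern S a' * (kern S b - kern S b')"
    by (simp add: algebra_simps)
  also have "\<bar>\<dots>\<bar> \<le> \<bar>kern S b\<bar> * \<bar>kern S a - kern S a'\<bar> + \<bar>kern S a'\<bar> * \<bar>kern S b - kern S b'\<bar>"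
    by (rule order_trans[OF abs_triangle_ineq]) (simp add: abs_mult)
  also have "\<dots> \<le> kernel_sup S * (lipK S * e) + kernel_sup S * (lipK S * e')"
  proof (intro add_mono mult_mono kern_le_sup)
    show "\<bar>kern S a - kern S a'\<bar> \<le> lipK S * e" "\<bar>kern S b - kern S b'\<bar> \<le> lipK S * e'"
      using kern_lipschitz[of a a'] kern_lipschitz[of b b'] assms kernel_lip(1)
      by (meson less_imp_le mult_left_mono order_trans)+
  qed (auto simp: kernel_sup_nonneg)
  finally show ?thesis by (simp add: algebra_simps)
qed

text \<open>Both kernel arguments are below 1/2, so
  \<open>\<bar>w\<bar>^2 * \<bar>x - v\<bar>^2 \<le> 1/2\<close>, and
  \<open>\<bar>w\<bar> \<ge> 1/2\<close> gives \<open>\<bar>x - v\<bar>^2 \<le> 2\<close>. This is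
  where the lower bound on the norm of pair vectors matters.\<close>

lemma psi_support:
  assumes h: "0 < h" "h \<le> 1" and w: "1/2 \<le> norm w" and nz: "psi (E_single w h) v x \<noteq> 0"
  shows "\<bar>(x - v)$i\<bar> \<le> 3/2"
proof -
  define y where "y = x - v"
  have a: "\<bar>(w \<bullet> y) / h\<bar> < 1/2" and b: "\<bar>cross w y\<bar> < 1/2"
    using nz kern_eq_0 by (force simp: psi_E_single y_def)+
  have "\<bar>w \<bullet> y\<bar> \<le> 1/2" using a h by (simp add: abs_divide field_simps)
  then have "(w \<bullet> y)\<^sup>2 + (cross w y)\<^sup>2 \<le> (1/2)\<^sup>2 + (1/2)\<^sup>2"
    using b by (intro add_mono power2_le_if_abs_le) auto
  then have "(norm w)\<^sup>2 * (norm y)\<^sup>2 \<le> 1/2"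
    using inner_cross_identity[of w y y] by (simp add: power2_eq_square power2_norm_eq_inner[symmetric, unfolded power2_eq_square])
  moreover have "(1/2)\<^sup>2 * (norm y)\<^sup>2 \<le> (norm w)\<^sup>2 * (norm y)\<^sup>2"
    using w by (intro mult_right_mono power_mono) auto
  ultimately have "(norm y)\<^sup>2 \<le> 2" by (simp add: power2_eq_square)
  moreover have "(y$i)\<^sup>2 \<le> (norm y)\<^sup>2"
    using component_le_norm_cart[of y i] power2_le_if_abs_le by blast
  ultimately have "\<bar>y$i\<bar>\<^sup>2 \<le> (3/2)\<^sup>2" by (simp add: power2_eq_square)
  then show ?thesis unfolding y_def by (rule power2_le_imp_le) simp
qed

text \<open>One factor \<open>1 / h\<close> comes from the determinant, the other from the kernel
  argument. The support bound keeps \<open>x - v\<close> bounded, so that a change of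
  \<open>w\<close> moves the arguments by a multiple of \<rho> only. With
  \<open>kernel_sup \<le> lipK / 2\<close>, written \<open>\<kappa> \<le> Q / 2\<close>, the
  constants add up to \<open>4 \<kappa>^2 + 6 \<kappa> Q \<le> 4 Q^2\<close>.\<close>

lemma psi_E_single_lipschitz:
  assumes h: "0 < h" "h \<le> 1" and w: "1/2 \<le> norm w" "norm w \<le> 1" and w': "1/2 \<le> norm w'" "norm w' \<le> 1"
    and d: "\<bar>w$1 - w'$1\<bar> \<le> \<rho>" "\<bar>w$2 - w'$2\<bar> \<le> \<rho>"
  shows "\<bar>psi (E_single w h) v x - psi (E_single w' h) v x\<bar> \<le> \<rho> / h\<^sup>2 * (4 * (lipK S)\<^sup>2)"
proof -
  let ?\<kappa> = "kernel_sup S" and ?Q = "lipK S"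
  have \<rho>: "0 \<le> \<rho>" using d(1) by linarith
  have Q: "2 \<le> ?Q" "?\<kappa> \<le> ?Q / 2" "1 \<le> ?\<kappa>" by (rule lipK_ge_2 kernel_sup_le kernel_sup_ge_1)+
  show ?thesis
  proof (cases "psi (E_single w h) v x = 0 \<and> psi (E_single w' h) v x = 0")
    case True
    then show ?thesis using \<rho> by simp
  next
    case False
    define y where "y = x - v"
    have y: "\<bar>y$1\<bar> \<le> 3/2" "\<bar>y$2\<bar> \<le> 3/2"
      using False psi_support[OF h w(1), of v x] psi_support[OF h w'(1), of v x] by (auto simp: y_def)
    have prod: "\<bar>a * b\<bar> \<le> \<rho> * (3/2)" if "\<bar>a\<bar> \<le> \<rho>" "\<bar>b\<bar> \<le> 3/2" for a b :: real
      unfolding abs_mult using that \<rho> by (intro mult_mono) auto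
    have "w \<bullet> y - w' \<bullet> y = (w$1 - w'$1) * y$1 + (w$2 - w'$2) * y$2"
      by (simp add: inner_real2 algebra_simps)
    then have i: "\<bar>w \<bullet> y - w' \<bullet> y\<bar> \<le> 3 * \<rho>"
      using prod[OF d(1) y(1)] prod[OF d(2) y(2)] by linarith
    have "cross w y - cross w' y = (w$1 - w'$1) * y$2 - (w$2 - w'$2) * y$1"
      by (simp add: cross_def algebra_simps)
    then have c: "\<bar>cross w y - cross w' y\<bar> \<le> 3 * \<rho>"
      using prod[OF d(1) y(2)] prod[OF d(2) y(1)] by linarith
    have "\<bar>(w \<bullet> y) / h - (w' \<bullet> y) / h\<bar> \<le> 3 * \<rho> / h"
      using i h by (simp add: divide_right_mono abs_divide flip: diff_divide_distrib)
    moreover have "\<bar>cross w y - cross w' y\<bar> \<le> 3 * \<rho> / h"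
      using c h \<rho> by (smt (verit) divide_le_eq_1 le_divide_eq mult_left_le)
    ultimately have kd: "\<bar>kern S ((w \<bullet> y) / h) * kern S (cross w y) - kern S ((w' \<bullet> y) / h) * kern S (cross w' y)\<bar>
        \<le> ?\<kappa> * ?Q * (3 * \<rho> / h + 3 * \<rho> / h)"
      by (rule kern_product_diff)
    have comp: "\<bar>u$j\<bar> \<le> 1" if "norm u \<le> 1" for u :: "real^2" and j
      using component_le_norm_cart[of u j] that by linarith
    have sq: "\<bar>a\<^sup>2 - b\<^sup>2\<bar> \<le> \<rho> * 2" if "\<bar>a - b\<bar> \<le> \<rho>" "\<bar>a\<bar> \<le> 1" "\<bar>b\<bar> \<le> 1" for a b :: real
    proof -
      have "a\<^sup>2 - b\<^sup>2 = (a - b) * (a + b)" by (simp add: power2_eq_square algebra_simps)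
      moreover have "\<bar>(a - b) * (a + b)\<bar> \<le> \<rho> * 2" unfolding abs_mult using that \<rho> by (intro mult_mono) auto
      ultimately show ?thesis by simp
    qed
    have nd: "\<bar>(norm w)\<^sup>2 - (norm w')\<^sup>2\<bar> \<le> 4 * \<rho>"
      unfolding norm_real2_square
      using sq[OF d(1) comp[OF w(2)] comp[OF w'(2)]] sq[OF d(2) comp[OF w(2)] comp[OF w'(2)]] by linarith
    define A where "A = kern S ((w \<bullet> y) / h) * kern S (cross w y)"
    define A' where "A' = kern S ((w' \<bullet> y) / h) * kern S (cross w' y)"
    have Ab: "\<bar>A\<bar> \<le> ?\<kappa> * ?\<kappa>" unfolding A_def abs_mult by (intro mult_mono kern_le_sup) (auto simp: kernel_sup_nonneg)
    have w'2: "(norm w')\<^sup>2 \<le> 1" using power_mono[OF w'(2), of 2] by simp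
    have "psi (E_single w h) v x - psi (E_single w' h) v x
        = ((norm w)\<^sup>2 - (norm w')\<^sup>2) / h * A + (norm w')\<^sup>2 / h * (A - A')"
      by (simp add: psi_E_single A_def A'_def y_def diff_divide_distrib algebra_simps)
    also have "\<bar>\<dots>\<bar> \<le> \<bar>(norm w)\<^sup>2 - (norm w')\<^sup>2\<bar> / h * \<bar>A\<bar> + (norm w')\<^sup>2 / h * \<bar>A - A'\<bar>"
      using h by (intro order_trans[OF abs_triangle_ineq]) (simp add: abs_mult)
    also have "\<dots> \<le> (4 * \<rho>) / h * (?\<kappa> * ?\<kappa>) + 1 / h * (?\<kappa> * ?Q * (3 * \<rho> / h + 3 * \<rho> / h))"
      using nd Ab w'2 kd h \<rho> by (intro add_mono mult_mono divide_right_mono) (auto simp: A_def A'_def)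
    also have "\<dots> \<le> \<rho> / h\<^sup>2 * (4 * (?\<kappa> * ?\<kappa>)) + \<rho> / h\<^sup>2 * (6 * (?\<kappa> * ?Q))"
    proof -
      have "1 / h \<le> 1 / h\<^sup>2" using h by (simp add: power2_eq_square field_simps)
      then have "\<rho> / h \<le> \<rho> / h\<^sup>2" using \<rho> mult_left_mono[of "1/h" "1/h\<^sup>2" \<rho>] by simp
      then have 1: "\<rho> / h * (4 * (?\<kappa> * ?\<kappa>)) \<le> \<rho> / h\<^sup>2 * (4 * (?\<kappa> * ?\<kappa>))"
        using Q by (intro mult_right_mono) auto
      have 2: "(4 * \<rho>) / h * (?\<kappa> * ?\<kappa>) = \<rho> / h * (4 * (?\<kappa> * ?\<kappa>))" by simp
      have 3: "1 / h * (?\<kappa> * ?Q * (3 * \<rho> / h + 3 * \<rho> / h)) = \<rho> / h\<^sup>2 * (6 * (?\<kappa> * ?Q))"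
        by (simp add: power2_eq_square)
      show ?thesis unfolding 2 3 using 1 by (rule add_right_mono)
    qed
    also have "\<dots> = \<rho> / h\<^sup>2 * (4 * (?\<kappa> * ?\<kappa>) + 6 * (?\<kappa> * ?Q))" by (simp add: algebra_simps)
    also have "\<dots> \<le> \<rho> / h\<^sup>2 * (4 * ?Q\<^sup>2)"
    proof (intro mult_left_mono)
      have "?\<kappa> * ?\<kappa> \<le> (?Q / 2) * (?Q / 2)" "?\<kappa> * ?Q \<le> (?Q / 2) * ?Q"
        using Q by (intro mult_mono; simp)+
      then show "4 * (?\<kappa> * ?\<kappa>) + 6 * (?\<kappa> * ?Q) \<le> 4 * ?Q\<^sup>2" by (simp add: power2_eq_square)
    qed (use \<rho> in simp)
    finally show ?thesis .
  qed
qed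

definition scal :: "real \<Rightarrow> real^2^2" where
  "scal h = mat (1 / h)"

lemma det_scal: "det (scal h) = 1 / h\<^sup>2"
  by (simp add: scal_def det_2 mat_def power2_eq_square)

lemma scal_mult: "(scal h *v x)$1 = x$1 / h" "(scal h *v x)$2 = x$2 / h"
  by (simp_all add: scal_def matrix_vector_mult_def sum_2 mat_def)

lemma psi_scal: "psi (scal h) v x = 1 / h\<^sup>2 * (kern S ((x$1 - v$1) / h) * kern S ((x$2 - v$2) / h))"
  by (simp add: psi_def det_scal kernel2_def scal_mult)

lemma kernel2_hfrak_eq: "kernel2_hfrak S n (x - v) = psi (scal (hfrak S n)) v x"
  by (simp add: kernel2_hfrak_def psi_scal)

lemma psi_scal_support:
  assumes h: "0 < h" "h \<le> 1" and nz: "psi (scal h) v x \<noteq> 0"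
  shows "\<bar>(x - v)$i\<bar> \<le> h / 2"
proof -
  have "\<bar>(x$1 - v$1) / h\<bar> < 1/2" "\<bar>(x$2 - v$2) / h\<bar> < 1/2"
    using nz kern_eq_0 by (force simp: psi_scal)+
  then have "\<bar>x$1 - v$1\<bar> \<le> h / 2" "\<bar>x$2 - v$2\<bar> \<le> h / 2"
    using h by (simp_all add: abs_divide field_simps)
  then show ?thesis using exhaust_2[of i] by auto
qed

text \<open>The natural order is \<open>1 / h^3\<close>; it is weakened to \<open>1 / h^4\<close>
  because the lower bound on \<open>hfrak\<close> is one on its square.\<close>

lemma psi_scal_lipschitz:
  assumes h: "0 < h" "h \<le> 1" and d: "\<bar>v$1 - v'$1\<bar> \<le> \<rho>" "\<bar>v$2 - v'$2\<bar> \<le> \<rho>"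
  shows "\<bar>psi (scal h) v x - psi (scal h) v' x\<bar> \<le> \<rho> / h ^ 4 * (lipK S)\<^sup>2"
proof -
  have \<rho>: "0 \<le> \<rho>" using d(1) by linarith
  have Q: "2 \<le> lipK S" "kernel_sup S \<le> lipK S / 2" by (rule lipK_ge_2 kernel_sup_le)+
  have "\<bar>(x$1 - v$1) / h - (x$1 - v'$1) / h\<bar> \<le> \<rho> / h" "\<bar>(x$2 - v$2) / h - (x$2 - v'$2) / h\<bar> \<le> \<rho> / h"
    using d h by (simp_all add: divide_right_mono abs_divide abs_minus_commute flip: diff_divide_distrib)
  from kern_product_diff[OF this]
  have *: "\<bar>kern S ((x$1 - v$1) / h) * kern S ((x$2 - v$2) / h) - kern S ((x$1 - v'$1) / h) * kern S ((x$2 - v'$2) / h)\<bar>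
      \<le> kernel_sup S * lipK S * (\<rho> / h + \<rho> / h)" .
  have "\<bar>psi (scal h) v x - psi (scal h) v' x\<bar> \<le> 1 / h\<^sup>2 * (kernel_sup S * lipK S * (\<rho> / h + \<rho> / h))"
    using mult_left_mono[OF *, of "1 / h\<^sup>2"] h by (simp add: psi_scal abs_mult flip: right_diff_distrib diff_divide_distrib)
  also have "\<dots> = (\<rho> / h ^ 3) * (2 * (kernel_sup S * lipK S))"
    using h by (simp add: power2_eq_square power3_eq_cube)
  also have "\<dots> \<le> (\<rho> / h ^ 4) * (2 * (lipK S / 2 * lipK S))"
  proof (rule mult_mono)
    have "h ^ 4 \<le> h ^ 3" using h by (intro power_decreasing) auto
    then show "\<rho> / h ^ 3 \<le> \<rho> / h ^ 4" using h \<rho> by (intro divide_left_mono) auto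
  qed (use Q \<rho> h kernel_sup_nonneg in auto)
  finally show ?thesis by (simp add: power2_eq_square)
qed

text \<open>A crude count: \<open>2^(2 n)\<close> exceeds \<open>2 n\<close>, so powers with
  exponent at least \<open>2 n\<close> lie below \<open>hmin / 2\<close>.\<close>

lemma card_bandwidths:
  assumes n: "3 \<le> n" and hm: "1 / n \<le> hmin S n"
  shows "card (bandwidths S n) \<le> 2 * n"
proof -
  have "bandwidths S n \<subseteq> (\<lambda>k. (1/2)^k) ` {..<2 * n}"
  proof
    fix h assume "h \<in> bandwidths S n"
    then obtain k where k: "h = (1/2)^k" "hmin S n / 2 \<le> h" by (auto simp: bandwidths_def)
    have "k < 2 * n"
    proof (rule ccontr)
      assume "\<not> k < 2 * n"
      then have "(1/2 :: real)^k \<le> (1/2)^(2 * n)" by (intro power_decreasing) auto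
      also have "\<dots> = 1 / 2 ^ (2 * n)" by (simp add: power_one_over)
      also have "\<dots> < 1 / (2 * n)"
      proof (rule divide_strict_left_mono)
        show "real (2 * n) < 2 ^ (2 * n)" by (rule of_nat_less_two_power)
      qed (use n in auto)
      also have "\<dots> \<le> hmin S n / 2" using hm by simp
      finally show False using k by simp
    qed
    then show "h \<in> (\<lambda>k. (1/2)^k) ` {..<2 * n}" using k by auto
  qed
  from card_mono[OF _ this] have "card (bandwidths S n) \<le> card ((\<lambda>k. (1/2 :: real)^k) ` {..<2 * n})" by simp
  also have "\<dots> \<le> 2 * n" using card_image_le[of "{..<2 * n}" "\<lambda>k. (1/2 :: real)^k"] by simp
  finally show ?thesis .
qed

text \<open>
  With deviation level \<open>x = c / 2\<close> the Bernstein bound uses half of the leading term of the constants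
  \<open>C\<^sub>1, \<dots>, C\<^sub>4\<close>; the discretization error is paid by the other half.
\<close>

lemma deviation_budget:
  fixes s b D c \<delta> :: real and n :: nat
  assumes D: "1 \<le> D" and c: "1 \<le> c" and s: "1 \<le> s" and b: "0 \<le> b" and n: "1 \<le> n"
    and net: "2 * b * \<delta> / glow S \<le> real n powr (-1/2)"
  shows "2 * s * (kernel_sup S)\<^sup>2 * sqrt (D * (c / 2) / (glow S * n)) + b * (kernel_sup S)\<^sup>2 * D * (c / 2) / (glow S * n)
      + 2 * b * \<delta> / glow S
    \<le> budget s b c (n / D)"
proof -
  let ?\<kappa> = "kernel_sup S" and ?R = "(n / D) powr (-1/2)" and ?g = "glow S powr (-1/2)"
  have \<kappa>: "1 \<le> ?\<kappa>\<^sup>2" using kernel_sup_ge_1 by simp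
  have R: "?R = sqrt (D / n)" using D n by (subst powr_neg_half) (auto simp: real_sqrt_divide)
  have g: "?g = 1 / sqrt (glow S)" using glow by (intro powr_neg_half) auto
  have g1: "1 \<le> ?g" unfolding g using glow by simp
  have RR: "?R * ?R = D / n" unfolding R using D by simp
  have "sqrt (D * (c / 2) / (glow S * n)) = sqrt (c / 2) * ?g * ?R"
    unfolding R g using c D by (simp add: real_sqrt_divide real_sqrt_mult mult_ac)
  also have "sqrt (c / 2) = sqrt 2 * sqrt c / 2"
    by (simp add: real_sqrt_divide field_simps)
  finally have sq: "sqrt (D * (c / 2) / (glow S * n)) = sqrt 2 * sqrt c / 2 * ?g * ?R" .
  have 1: "2 * s * ?\<kappa>\<^sup>2 * sqrt (D * (c / 2) / (glow S * n)) = sqrt 2 * s * ?g * ?\<kappa>\<^sup>2 * sqrt c * ?R"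
    unfolding sq by simp
  have 2: "b * ?\<kappa>\<^sup>2 * D * (c / 2) / (glow S * n) = c / 2 * b * ?\<kappa>\<^sup>2 / glow S * ?R * ?R"
    unfolding mult.assoc RR by (simp add: mult_ac)
  have "real n powr (-1/2) \<le> ?R"
    using D n by (intro powr_mono2') (auto simp: divide_le_eq mult_left_le_one_le)
  also have "1 * ?R \<le> (sqrt 2 * s * ?g * ?\<kappa>\<^sup>2 * sqrt c) * ?R"
  proof (rule mult_right_mono)
    have "1 * 1 * 1 * 1 * 1 \<le> sqrt 2 * s * ?g * ?\<kappa>\<^sup>2 * sqrt c"
      using s c g1 \<kappa> by (intro mult_mono) auto
    then show "1 \<le> sqrt 2 * s * ?g * ?\<kappa>\<^sup>2 * sqrt c" by simp
  qed simp
  finally have 3: "2 * b * \<delta> / glow S \<le> sqrt 2 * s * ?g * ?\<kappa>\<^sup>2 * sqrt c * ?R"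
    using net by simp
  have "(2 * sqrt 2 * s * ?g * ?\<kappa>\<^sup>2 * sqrt c + c / 2 * b * ?\<kappa>\<^sup>2 / glow S * ?R) * ?R
      = 2 * (sqrt 2 * s * ?g * ?\<kappa>\<^sup>2 * sqrt c * ?R) + c / 2 * b * ?\<kappa>\<^sup>2 / glow S * ?R * ?R"
    by (simp add: algebra_simps)
  then show ?thesis using 1 2 3 by linarith
qed

abbreviation net_error_small :: "real \<Rightarrow> nat \<Rightarrow> bool" where
  "net_error_small b n \<equiv> 2 * b * mesh n / glow S \<le> real n powr (-1/2)"

text \<open>Collects what is used of a large sample size, including the conditions behind
  \<open>n0\<close> and \<open>n1\<close>. The lower bounds on \<open>c1\<close> to
  \<open>c4\<close> pay for the union bounds; the last condition makes the nets fine enough.\<close>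

definition large :: "real \<Rightarrow> real \<Rightarrow> nat \<Rightarrow> bool" where
  "large M \<beta> n \<longleftrightarrow> 3 \<le> n \<and> hmin S n \<le> 1 \<and> hfrak S n \<le> 1 \<and> max M 1 * hfrak S n powr \<beta> \<le> 1 \<and>
     max M 1 * (ln (real n) powr (1 / omg S) * hmin S n powr \<beta>) \<le> 1 \<and>
     (real n * (hfrak S n)\<^sup>2) powr (-1/2) * C3 S n \<le> 1/2 \<and>
     (\<forall>c\<in>{c1 S n, c2 S n, c3 S n, c4 S n}. (200 + 8 * rexp S) * ln (real n) \<le> c) \<and>
     net_error_small (max 1 (tau S n)) n"

lemma ln_ge_1: "3 \<le> n \<Longrightarrow> 1 \<le> ln (real n)"
  using exp_le by (subst ln_ge_iff) auto

lemma hmin_lower: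
  assumes "3 \<le> n"
  shows "1 / n \<le> hmin S n"
  unfolding hmin_def using ln_ge_1[OF assms] noise_params
  by (intro divide_right_mono) (auto intro!: ge_one_powr_ge_zero)

lemma hfrak_square: "1 \<le> n \<Longrightarrow> (hfrak S n)\<^sup>2 = ln (real n) powr (1 + 1 / omg S) / n"
  by (simp add: hfrak_def)

lemma hfrak_pos: "3 \<le> n \<Longrightarrow> 0 < hfrak S n"
  using ln_ge_1[of n] by (auto simp: hfrak_def)

lemma hfrak_lower:
  assumes "3 \<le> n"
  shows "1 / n \<le> (hfrak S n)\<^sup>2"
  using ln_ge_1[OF assms] noise_params assms
  by (subst hfrak_square) (auto intro!: divide_right_mono ge_one_powr_ge_zero)

lemma tau_pos: "3 \<le> n \<Longrightarrow> 0 < tau S n"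
  using ln_ge_1[of n] noise_params r by (auto simp: tau_def)

text \<open>The net costs the exponent 20, the deviation level \<open>c / 2\<close> gains
  \<open>100 + 4 r\<close>.\<close>

lemma exp_union_bound:
  assumes n: "3 \<le> n" and c: "(200 + 8 * rexp S) * ln (real n) \<le> c" and k: "real k \<le> real n ^ 20"
  shows "real k * (2 * exp (- (c / 2))) \<le> 2 * real n powr (- 4 * rexp S)"
proof -
  have "exp (- (c / 2)) \<le> exp (- ((100 + 4 * rexp S) * ln n))" using c by (simp add: algebra_simps)
  also have "\<dots> = real n powr (- (100 + 4 * rexp S))" using n by (simp add: powr_def algebra_simps)
  finally have "real k * exp (- (c / 2)) \<le> real n ^ 20 * real n powr (- (100 + 4 * rexp S))"
    using k by (intro mult_mono) auto
  also have "\<dots> = real n powr 20 * real n powr (- (100 + 4 * rexp S))"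
    using n powr_realpow[of n 20] by simp
  also have "\<dots> = real n powr (- 80 - 4 * rexp S)"
    by (simp only: powr_add[symmetric]) simp
  also have "\<dots> \<le> real n powr (- 4 * rexp S)" using n by (intro powr_mono) auto
  finally show ?thesis by simp
qed

text \<open>From \<open>n \<ge> 3\<close> follow \<open>7 n^4 \<le> n^6\<close>, squared
  \<open>n^12\<close>, and \<open>2 n \<le> n^2\<close>; the exponent 20 is generous.\<close>

lemma net_card_bound:
  assumes n: "3 \<le> n" and R: "R \<le> 3" and m: "m \<le> 2 * n"
  shows "real ((2 * R * n ^ 4 + 1)\<^sup>2 * m) \<le> real n ^ 20"
proof -
  have 1: "1 \<le> n ^ 4" using n by simp
  have "2 * R * n ^ 4 + 1 \<le> 6 * n ^ 4 + n ^ 4" using R 1 by (intro add_mono mult_right_mono) auto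
  also have "\<dots> \<le> n ^ 2 * n ^ 4"
  proof -
    have "3 ^ 2 \<le> n ^ 2" using n by (rule power_mono) simp
    then have "7 * n ^ 4 \<le> n ^ 2 * n ^ 4" by (intro mult_right_mono) auto
    then show ?thesis by simp
  qed
  finally have "(2 * R * n ^ 4 + 1)\<^sup>2 \<le> (n ^ 2 * n ^ 4)\<^sup>2" by (rule power_mono) simp
  also have "\<dots> = n ^ 12" by (simp flip: power_add power_mult)
  finally have "(2 * R * n ^ 4 + 1)\<^sup>2 * m \<le> n ^ 12 * (n * n)"
  proof (rule mult_mono)
    have "2 * n \<le> n * n" using n by (intro mult_right_mono) auto
    with m show "m \<le> n * n" by (rule order_trans)
  qed auto
  also have "\<dots> = n ^ 14" by (simp add: power_eq_if)
  also have "\<dots> \<le> n ^ 20" using n by (intro power_increasing) auto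
  finally have "real ((2 * R * n ^ 4 + 1)\<^sup>2 * m) \<le> real (n ^ 20)" by (rule of_nat_mono)
  then show ?thesis by simp
qed

end

section \<open>Nets for directions and for evaluation points\<close>

context procedure_setup
begin

definition dir_index :: "nat \<Rightarrow> ((real^2) \<times> real) set" where
  "dir_index n = {(w, \<eta>). 1/2 \<le> norm w \<and> norm w \<le> 1 \<and> \<eta> \<in> bandwidths S n}"

lemma bandwidth_bounds:
  assumes n: "3 \<le> n" and \<eta>: "\<eta> \<in> bandwidths S n"
  shows "0 < \<eta>" "\<eta> \<le> 1" "1 / (2 * real n) \<le> \<eta>"
  using hmin_lower[OF n] \<eta> bandwidths_pos[OF \<eta>] by (auto simp: bandwidths_def)

text \<open>The bandwidths are finite in number and enter the net exactly, so that a point and its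
  net point share the scale \<open>1 / \<eta>\<close>; only the directions are discretized.\<close>

lemma net_dir_index:
  assumes n: "3 \<le> n"
  obtains N where "finite N" "N \<subseteq> dir_index n" "real (card N) \<le> real n ^ 20"
    "\<And>e. e \<in> dir_index n \<Longrightarrow> \<exists>e'\<in>N. 1 / snd e' = 1 / snd e \<and>
      (\<forall>x. \<bar>psi (E_single (fst e) (snd e)) t x - psi (E_single (fst e') (snd e')) t x\<bar> \<le> mesh n)"
proof -
  define W where "W = {w :: real^2. 1/2 \<le> norm w \<and> norm w \<le> 1}"
  have W: "\<bar>w$1\<bar> \<le> real 1 \<and> \<bar>w$2\<bar> \<le> real 1" if "w \<in> W" for w
    using that component_le_norm_cart[of w 1] component_le_norm_cart[of w 2] by (auto simp: W_def)
  have m: "0 < n ^ 4" using n by simp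
  obtain N0 where N0: "N0 \<subseteq> W" "finite N0" "card N0 \<le> (2 * 1 * n ^ 4 + 1)\<^sup>2"
    and net0: "\<And>w. w \<in> W \<Longrightarrow> \<exists>y\<in>N0. \<bar>w$1 - y$1\<bar> \<le> 1 / real (n ^ 4) \<and> \<bar>w$2 - y$2\<bar> \<le> 1 / real (n ^ 4)"
    using finite_net_real2[OF W m] by blast
  have fin: "finite (bandwidths S n)" using finite_bandwidths n by simp
  define N where "N = N0 \<times> bandwidths S n"
  show ?thesis
  proof
    show "finite N" using N0 fin by (simp add: N_def)
    show "N \<subseteq> dir_index n" using N0 by (auto simp: N_def dir_index_def W_def)
    have "card N \<le> (2 * 1 * n ^ 4 + 1)\<^sup>2 * card (bandwidths S n)"
      using N0 by (simp add: N_def card_cartesian_product)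
    then have "real (card N) \<le> real ((2 * 1 * n ^ 4 + 1)\<^sup>2 * card (bandwidths S n))" by (rule of_nat_mono)
    also have "\<dots> \<le> real n ^ 20"
      by (rule net_card_bound[OF n _ card_bandwidths[OF n hmin_lower[OF n]]]) simp
    finally show "real (card N) \<le> real n ^ 20" .
  next
    fix e assume e: "e \<in> dir_index n"
    obtain w \<eta> where we: "e = (w, \<eta>)" "1/2 \<le> norm w" "norm w \<le> 1" "\<eta> \<in> bandwidths S n"
      using e by (auto simp: dir_index_def)
    obtain y where y: "y \<in> N0" "\<bar>w$1 - y$1\<bar> \<le> 1 / real (n ^ 4)" "\<bar>w$2 - y$2\<bar> \<le> 1 / real (n ^ 4)"
      using net0[of w] we by (auto simp: W_def)
    have yn: "1/2 \<le> norm y" "norm y \<le> 1" using y(1) N0(1) by (auto simp: W_def)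
    note \<eta> = bandwidth_bounds[OF n we(4)]
    have "1 \<le> 2 * n * \<eta>" using \<eta>(3) n by (simp add: field_simps)
    then have "1\<^sup>2 \<le> (2 * n * \<eta>)\<^sup>2" by (rule power_mono) simp
    then have "1 / \<eta>\<^sup>2 \<le> 4 * (real n)\<^sup>2" using \<eta> by (simp add: field_simps power_mult_distrib)
    then have "(1 / real n ^ 4) * (1 / \<eta>\<^sup>2) \<le> (1 / real n ^ 4) * (4 * (real n)\<^sup>2)" by (intro mult_left_mono) auto
    also have "\<dots> = 4 / (real n)\<^sup>2" using n by (simp add: power2_eq_square power4_eq_xxxx)
    finally have le: "1 / real n ^ 4 / \<eta>\<^sup>2 \<le> 4 / (real n)\<^sup>2" by simp
    have "\<bar>psi (E_single w \<eta>) t x - psi (E_single y \<eta>) t x\<bar> \<le> mesh n" for x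
    proof -
      have "\<bar>psi (E_single w \<eta>) t x - psi (E_single y \<eta>) t x\<bar> \<le> 1 / real (n ^ 4) / \<eta>\<^sup>2 * (4 * (lipK S)\<^sup>2)"
        by (rule psi_E_single_lipschitz[OF \<eta>(1,2) we(2,3) yn y(2,3)])
      also have "\<dots> \<le> 4 / (real n)\<^sup>2 * (4 * (lipK S)\<^sup>2)"
        using le by (intro mult_right_mono) auto
      finally show ?thesis by simp
    qed
    then show "\<exists>e'\<in>N. 1 / snd e' = 1 / snd e \<and>
      (\<forall>x. \<bar>psi (E_single (fst e) (snd e)) t x - psi (E_single (fst e') (snd e')) t x\<bar> \<le> mesh n)"
      using y(1) we by (intro bexI[of _ "(y, \<eta>)"]) (auto simp: N_def)
  qed
qed

definition point_index :: "(real^2) set" where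
  "point_index = cbox (vec (-5/2)) (vec (5/2))"

lemma net_point_index:
  assumes n: "3 \<le> n" and h: "hfrak S n \<le> 1"
  obtains N where "finite N" "N \<subseteq> point_index" "real (card N) \<le> real n ^ 20"
    "\<And>v. v \<in> point_index \<Longrightarrow> \<exists>v'\<in>N.
      (\<forall>x. \<bar>psi (scal (hfrak S n)) v x - psi (scal (hfrak S n)) v' x\<bar> \<le> mesh n)"
proof -
  have W: "\<bar>w$1\<bar> \<le> real 3 \<and> \<bar>w$2\<bar> \<le> real 3" if "w \<in> point_index" for w
    using that by (auto simp: point_index_def mem_box_cart forall_2)
  have m: "0 < n ^ 4" using n by simp
  obtain N where N: "N \<subseteq> point_index" "finite N" "card N \<le> (2 * 3 * n ^ 4 + 1)\<^sup>2"
    and net: "\<And>w. w \<in> point_index \<Longrightarrow> \<exists>y\<in>N. \<bar>w$1 - y$1\<bar> \<le> 1 / real (n ^ 4) \<and> \<bar>w$2 - y$2\<bar> \<le> 1 / real (n ^ 4)"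
    using finite_net_real2[OF W m] by blast
  let ?h = "hfrak S n"
  have hp: "0 < ?h" by (rule hfrak_pos[OF n])
  have "(1 / real n)\<^sup>2 \<le> (?h\<^sup>2)\<^sup>2" using hfrak_lower[OF n] by (rule power_mono) simp
  then have "(1 / real n)\<^sup>2 \<le> ?h ^ 4" by simp
  then have "1 / ?h ^ 4 \<le> (real n)\<^sup>2" using n hp by (simp add: field_simps)
  then have "(1 / real n ^ 4) * (1 / ?h ^ 4) \<le> (1 / real n ^ 4) * (real n)\<^sup>2" by (intro mult_left_mono) auto
  also have "\<dots> = 1 / (real n)\<^sup>2" using n by (simp add: power2_eq_square power4_eq_xxxx)
  finally have le: "1 / real n ^ 4 / ?h ^ 4 \<le> 1 / (real n)\<^sup>2" by simp
  show ?thesis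
  proof
    show "finite N" "N \<subseteq> point_index" by (rule N)+
    have "card N \<le> (2 * 3 * n ^ 4 + 1)\<^sup>2 * 1" using N by simp
    then have "real (card N) \<le> real ((2 * 3 * n ^ 4 + 1)\<^sup>2 * 1)" by (rule of_nat_mono)
    also have "\<dots> \<le> real n ^ 20" by (rule net_card_bound[OF n]) (use n in auto)
    finally show "real (card N) \<le> real n ^ 20" .
  next
    fix v assume "v \<in> point_index"
    then obtain y where y: "y \<in> N" "\<bar>v$1 - y$1\<bar> \<le> 1 / real (n ^ 4)" "\<bar>v$2 - y$2\<bar> \<le> 1 / real (n ^ 4)"
      using net by blast
    have "\<bar>psi (scal ?h) v x - psi (scal ?h) y x\<bar> \<le> mesh n" for x
    proof -
      have "\<bar>psi (scal ?h) v x - psi (scal ?h) y x\<bar> \<le> 1 / real (n ^ 4) / ?h ^ 4 * (lipK S)\<^sup>2"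
        by (rule psi_scal_lipschitz[OF hp h y(2,3)])
      also have "\<dots> \<le> 1 / (real n)\<^sup>2 * (16 * (lipK S)\<^sup>2)"
        using le by (intro mult_mono) auto
      finally show ?thesis by simp
    qed
    then show "\<exists>v'\<in>N. (\<forall>x. \<bar>psi (scal ?h) v x - psi (scal ?h) v' x\<bar> \<le> mesh n)"
      using y(1) by blast
  qed
qed

end

section \<open>Deviation bounds for design and noise\<close>

context regression
begin

abbreviation wmean :: "nat \<Rightarrow> 'w \<Rightarrow> real^2^2 \<Rightarrow> real^2 \<Rightarrow> (nat \<Rightarrow> real) \<Rightarrow> real" where
  "wmean n w E v Y \<equiv> (\<Sum>i<n. psi E v (X i w) / design S (X i w) * Y i) / real n"

text \<open>\<open>W\<close> stands for the normalised link or for the truncated noise, and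
  \<open>c\<close> for one of \<open>c1\<close> to \<open>c4\<close>. The level \<open>c / 2\<close>
  is high enough for a net of \<open>n^20\<close> points and low enough for the deviation to fit
  into \<open>budget\<close>.\<close>

lemma family_deviation:
  fixes E :: "'e \<Rightarrow> real^2^2" and v :: "'e \<Rightarrow> real^2" and W :: "real^2 \<Rightarrow> real \<Rightarrow> real" and D m :: "'e \<Rightarrow> real"
  assumes n: "3 \<le> n" and c: "(200 + 8 * rexp S) * ln (real n) \<le> c"
    and N: "finite N" "N \<subseteq> A" "real (card N) \<le> real n ^ 20"
    and W: "case_prod W \<in> borel_measurable (borel \<Otimes>\<^sub>M borel)"
    and det: "\<And>e. e \<in> A \<Longrightarrow> 0 < det (E e)" "\<And>e. e \<in> A \<Longrightarrow> det (E e) \<le> D e" "\<And>e. e \<in> A \<Longrightarrow> 1 \<le> D e"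
    and supp: "\<And>e x. e \<in> A \<Longrightarrow> psi (E e) (v e) x \<noteq> 0 \<Longrightarrow> x \<in> cube"
    and Wb: "\<And>e x u. e \<in> A \<Longrightarrow> psi (E e) (v e) x \<noteq> 0 \<Longrightarrow> \<bar>W x u\<bar> \<le> b"
    and second: "\<And>e i. e \<in> A \<Longrightarrow> expectation (\<lambda>w. (psi (E e) (v e) (X i w) / design S (X i w) * W (X i w) (\<epsilon> i w))\<^sup>2)
        \<le> s\<^sup>2 * D e * (kernel_sup S) ^ 4 / glow S"
    and mean: "\<And>e i. e \<in> A \<Longrightarrow> expectation (\<lambda>w. psi (E e) (v e) (X i w) / design S (X i w) * W (X i w) (\<epsilon> i w)) = m e"
    and net: "\<And>e. e \<in> A \<Longrightarrow> \<exists>e'\<in>N. D e' = D e \<and>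
        (\<forall>x. \<bar>psi (E e) (v e) x - psi (E e') (v e') x\<bar> \<le> mesh n)"
    and s: "1 \<le> s" and b: "0 < b" and err: "net_error_small b n"
  shows "\<exists>B\<in>events. prob B \<le> 2 * real n powr (- 4 * rexp S) \<and>
    (\<forall>w\<in>space P - B. \<forall>e\<in>A.
      \<bar>wmean n w (E e) (v e) (\<lambda>i. W (X i w) (\<epsilon> i w)) - m e\<bar>
      \<le> budget s b c (n / D e))"
proof -
  have c1: "1 \<le> c"
  proof -
    have "200 * 1 \<le> (200 + 8 * rexp S) * ln (real n)"
      using r ln_ge_1[OF n] by (intro mult_mono) auto
    then show ?thesis using c by simp
  qed
  have "\<exists>B\<in>events. prob B \<le> card N * (2 * exp (- (c / 2))) \<and>
    (\<forall>w\<in>space P - B. \<forall>e\<in>A.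
      \<bar>wmean n w (E e) (v e) (\<lambda>i. W (X i w) (\<epsilon> i w)) - m e\<bar>
      \<le> 2 * s * (kernel_sup S)\<^sup>2 * sqrt (D e * (c / 2) / (glow S * n)) + b * (kernel_sup S)\<^sup>2 * D e * (c / 2) / (glow S * n)
        + 2 * b * mesh n / glow S)"
  proof (rule uniform_deviation[where \<psi> = "\<lambda>e. psi (E e) (v e)"])
    show "0 < D e" if "e \<in> A" for e using det(3)[OF that] by simp
    show "\<bar>psi (E e) (v e) x\<bar> \<le> D e * (kernel_sup S)\<^sup>2" if "e \<in> A" for e x
      by (rule abs_psi_le[OF det(1,2)[OF that]])
  qed (use N W supp Wb second mean net s b c1 n in \<open>simp_all add: psi_borel\<close>)
  then obtain B where B: "B \<in> events" "prob B \<le> card N * (2 * exp (- (c / 2)))"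
    and dev: "\<And>w e. w \<in> space P - B \<Longrightarrow> e \<in> A \<Longrightarrow>
      \<bar>wmean n w (E e) (v e) (\<lambda>i. W (X i w) (\<epsilon> i w)) - m e\<bar>
      \<le> 2 * s * (kernel_sup S)\<^sup>2 * sqrt (D e * (c / 2) / (glow S * n)) + b * (kernel_sup S)\<^sup>2 * D e * (c / 2) / (glow S * n)
        + 2 * b * mesh n / glow S"
    by blast
  show ?thesis
  proof (intro bexI[of _ B] conjI ballI)
    show "prob B \<le> 2 * real n powr (- 4 * rexp S)"
      using B(2) exp_union_bound[OF n c N(3)] by simp
    fix w e assume "w \<in> space P - B" and e: "e \<in> A"
    from order_trans[OF dev[OF this] deviation_budget[OF det(3)[OF e] c1 s _ _ err]] b n
    show "\<bar>wmean n w (E e) (v e) (\<lambda>i. W (X i w) (\<epsilon> i w)) - m e\<bar>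
      \<le> budget s b c (n / D e)"
      by simp
  qed (rule B(1))
qed

lemma design_family_deviation:
  fixes E :: "'e \<Rightarrow> real^2^2" and v :: "'e \<Rightarrow> real^2" and G :: "real^2 \<Rightarrow> real" and D :: "'e \<Rightarrow> real"
  assumes n: "3 \<le> n" and c: "(200 + 8 * rexp S) * ln (real n) \<le> c"
    and N: "finite N" "N \<subseteq> A" "real (card N) \<le> real n ^ 20"
    and G [measurable]: "G \<in> borel_measurable borel"
    and det: "\<And>e. e \<in> A \<Longrightarrow> 0 < det (E e)" "\<And>e. e \<in> A \<Longrightarrow> det (E e) \<le> D e" "\<And>e. e \<in> A \<Longrightarrow> 1 \<le> D e"
    and supp: "\<And>e x. e \<in> A \<Longrightarrow> psi (E e) (v e) x \<noteq> 0 \<Longrightarrow> x \<in> cube"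
    and Gb: "\<And>e x. e \<in> A \<Longrightarrow> psi (E e) (v e) x \<noteq> 0 \<Longrightarrow> \<bar>G x\<bar> \<le> 1"
    and net: "\<And>e. e \<in> A \<Longrightarrow> \<exists>e'\<in>N. D e' = D e \<and>
        (\<forall>x. \<bar>psi (E e) (v e) x - psi (E e') (v e') x\<bar> \<le> mesh n)"
    and err: "net_error_small (max 1 (tau S n)) n"
  shows "\<exists>B\<in>events. prob B \<le> 2 * real n powr (- 4 * rexp S) \<and>
    (\<forall>w\<in>space P - B. \<forall>e\<in>A.
      \<bar>wmean n w (E e) (v e) (\<lambda>i. G (X i w)) - (LBINT x. psi (E e) (v e) x * G x)\<bar>
      \<le> budget 1 1 c (n / D e))"
proof (rule family_deviation[where W = "\<lambda>x u. G x" and s = 1 and b = 1, OF n c N _ det supp])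
  show "case_prod (\<lambda>x u. G x) \<in> borel_measurable (borel \<Otimes>\<^sub>M borel)"
    by measurable
  fix e assume e: "e \<in> A"
  note m = weight_design_moments[of "psi (E e) (v e)", OF supp[OF e] psi_borel abs_psi_le[OF det(1,2)[OF e]]
      integrable_psi_square[OF det(1,2)[OF e]] G Gb[OF e]]
  show "expectation (\<lambda>w. psi (E e) (v e) (X i w) / design S (X i w) * G (X i w)) = (LBINT x. psi (E e) (v e) x * G x)" for i
    by (rule m(1))
  show "expectation (\<lambda>w. (psi (E e) (v e) (X i w) / design S (X i w) * G (X i w))\<^sup>2) \<le> 1\<^sup>2 * D e * (kernel_sup S) ^ 4 / glow S" for i
    using order_trans[OF m(2) divide_right_mono[OF integral_psi_square_le[OF det(1,2)[OF e]]]] glow by simp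
  show "\<exists>e'\<in>N. D e' = D e \<and> (\<forall>x. \<bar>psi (E e) (v e) x - psi (E e') (v e') x\<bar> \<le> mesh n)"
    by (rule net[OF e])
  show "\<bar>G x\<bar> \<le> 1" if "psi (E e) (v e) x \<noteq> 0" for x by (rule Gb[OF e that])
next
  have "2 * 1 * mesh n / glow S \<le> 2 * max 1 (tau S n) * mesh n / glow S"
    using glow by (intro divide_right_mono mult_right_mono mult_left_mono) auto
  then show "net_error_small 1 n"
    using err by (rule order_trans)
qed simp_all

lemma noise_family_deviation:
  fixes E :: "'e \<Rightarrow> real^2^2" and v :: "'e \<Rightarrow> real^2" and D :: "'e \<Rightarrow> real"
  assumes n: "3 \<le> n" and c: "(200 + 8 * rexp S) * ln (real n) \<le> c"
    and N: "finite N" "N \<subseteq> A" "real (card N) \<le> real n ^ 20"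
    and det: "\<And>e. e \<in> A \<Longrightarrow> 0 < det (E e)" "\<And>e. e \<in> A \<Longrightarrow> det (E e) \<le> D e" "\<And>e. e \<in> A \<Longrightarrow> 1 \<le> D e"
    and supp: "\<And>e x. e \<in> A \<Longrightarrow> psi (E e) (v e) x \<noteq> 0 \<Longrightarrow> x \<in> cube"
    and net: "\<And>e. e \<in> A \<Longrightarrow> \<exists>e'\<in>N. D e' = D e \<and>
        (\<forall>x. \<bar>psi (E e) (v e) x - psi (E e') (v e') x\<bar> \<le> mesh n)"
    and err: "net_error_small (max 1 (tau S n)) n"
  shows "\<exists>B\<in>events. prob B \<le> 2 * real n powr (- 4 * rexp S) \<and>
    (\<forall>w\<in>space P - B. \<forall>e\<in>A.
      \<bar>wmean n w (E e) (v e) (\<lambda>i. trunc (tau S n) (\<epsilon> i w)) - 0\<bar>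
      \<le> budget (max (sigma S) 1) (tau S n) c (n / D e))"
proof (rule family_deviation[where W = "\<lambda>x u. trunc (tau S n) u" and m = "\<lambda>_. 0", OF n c N _ det supp])
  have \<tau>: "0 < tau S n" by (rule tau_pos[OF n])
  show "0 < tau S n" by fact
  show "case_prod (\<lambda>x u. trunc (tau S n) u) \<in> borel_measurable (borel \<Otimes>\<^sub>M borel)"
    by measurable
  show "\<bar>trunc (tau S n) u\<bar> \<le> tau S n" for u using abs_trunc_le \<tau> by simp
  fix e assume e: "e \<in> A"
  note m = weight_noise_moments[of "psi (E e) (v e)", OF supp[OF e] psi_borel abs_psi_le[OF det(1,2)[OF e]]
      integrable_psi_square[OF det(1,2)[OF e]] less_imp_le[OF \<tau>]]
  show "expectation (\<lambda>w. psi (E e) (v e) (X i w) / design S (X i w) * trunc (tau S n) (\<epsilon> i w)) = 0" for i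
    by (rule m(1))
  have "(LBINT x. (psi (E e) (v e) x)\<^sup>2) / glow S * (sigma S)\<^sup>2 \<le> (D e * (kernel_sup S) ^ 4) / glow S * (max (sigma S) 1)\<^sup>2"
  proof (intro mult_mono divide_right_mono integral_psi_square_le[OF det(1,2)[OF e]])
    have "0 \<le> sigma S" by (rule sigma_nonneg[OF eps_class eps_sym prob_space_p noise_params(1,2,4)])
    then show "(sigma S)\<^sup>2 \<le> (max (sigma S) 1)\<^sup>2" by (intro power_mono) auto
  qed (use glow det(3)[OF e] in auto)
  then show "expectation (\<lambda>w. (psi (E e) (v e) (X i w) / design S (X i w) * trunc (tau S n) (\<epsilon> i w))\<^sup>2)
      \<le> (max (sigma S) 1)\<^sup>2 * D e * (kernel_sup S) ^ 4 / glow S" for i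
    using m(2)[of i] by (simp add: mult_ac)
  show "\<exists>e'\<in>N. D e' = D e \<and> (\<forall>x. \<bar>psi (E e) (v e) x - psi (E e') (v e') x\<bar> \<le> mesh n)"
    by (rule net[OF e])
next
  have "2 * tau S n * mesh n / glow S \<le> 2 * max 1 (tau S n) * mesh n / glow S"
    using glow by (intro divide_right_mono mult_right_mono mult_left_mono) auto
  then show "net_error_small (tau S n) n"
    using err by (rule order_trans)
qed simp_all

text \<open>Supports reach at most 3/2 beyond \<open>t\<close> in each coordinate, hence stay within
  2 of the origin, inside both the square of \<open>Fhat_inf\<close> and the one on which the design
  density is bounded below.\<close>

lemma psi_E_single_in_cube:
  assumes e: "e \<in> dir_index n" and n: "3 \<le> n" and t: "t \<in> cbox (vec (-1/2)) (vec (1/2))"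
    and nz: "psi (E_single (fst e) (snd e)) t x \<noteq> 0"
  shows "x \<in> cbox (vec (-5/2)) (vec (5/2))" "x \<in> cube"
proof -
  obtain w \<eta> where we: "e = (w, \<eta>)" "1/2 \<le> norm w" "norm w \<le> 1" "\<eta> \<in> bandwidths S n"
    using e by (auto simp: dir_index_def)
  note \<eta> = bandwidth_bounds[OF n we(4)]
  have y: "\<bar>(x - t)$i\<bar> \<le> 3/2" for i
    using psi_support[OF \<eta>(1,2) we(2), of t x i] nz by (simp add: we(1))
  have tb: "- (1/2) \<le> t$i" "t$i \<le> 1/2" for i using t by (simp_all add: mem_box_cart)
  have "- 2 \<le> x$i \<and> x$i \<le> 2" for i
    using y[of i] tb[of i] unfolding abs_le_iff vector_minus_component by linarith
  then have "- (5/2) \<le> x$i \<and> x$i \<le> 5/2" "- 3 \<le> x$i \<and> x$i \<le> 3" for i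
    by (smt (verit) field_sum_of_halves)+
  then show "x \<in> cbox (vec (-5/2)) (vec (5/2))" "x \<in> cube"
    by (simp_all add: cube_def mem_box_cart)
qed

lemma det_dir_index:
  assumes e: "e \<in> dir_index n" and n: "3 \<le> n"
  shows "0 < det (E_single (fst e) (snd e))" "det (E_single (fst e) (snd e)) \<le> 1 / snd e" "1 \<le> 1 / snd e"
proof -
  obtain w \<eta> where we: "e = (w, \<eta>)" "1/2 \<le> norm w" "norm w \<le> 1" "\<eta> \<in> bandwidths S n"
    using e by (auto simp: dir_index_def)
  note \<eta> = bandwidth_bounds[OF n we(4)]
  have "(norm w)\<^sup>2 \<le> 1" using power_mono[OF we(3), of 2] by simp
  moreover have "0 < norm w" using we(2) by linarith
  ultimately show "0 < det (E_single (fst e) (snd e))" "det (E_single (fst e) (snd e)) \<le> 1 / snd e" "1 \<le> 1 / snd e"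
    using \<eta> by (simp_all add: we(1) det_E_single divide_right_mono)
qed

text \<open>Bandwidths are at least \<open>hmin / 2\<close>, and the power of \<open>ln n\<close> in
  \<open>hmin\<close> produces the one in \<open>C1\<close>; the half costs
  \<open>sqrt 2 \<le> 2\<close>.\<close>

lemma bandwidth_rate:
  assumes n: "3 \<le> n" and \<eta>: "\<eta> \<in> bandwidths S n"
  shows "(\<eta> * n) powr (-1/2) \<le> 2 * ln (real n) powr (- (2 + omg S) / (2 * omg S))"
proof -
  let ?l = "ln (real n)"
  have o: "0 < omg S" by (rule noise_params)
  have l: "1 \<le> ?l" by (rule ln_ge_1[OF n])
  have "hmin S n / 2 \<le> \<eta>" using \<eta> by (simp add: bandwidths_def)
  then have "hmin S n / 2 * n \<le> \<eta> * n" by (rule mult_right_mono) simp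
  then have "?l powr (1 + 2 / omg S) / 2 \<le> \<eta> * n" using n by (simp add: hmin_def)
  then have "(\<eta> * n) powr (-1/2) \<le> (?l powr (1 + 2 / omg S) / 2) powr (-1/2)"
    using l by (intro powr_mono2') auto
  also have "\<dots> = ?l powr ((1 + 2 / omg S) * (-1/2)) * (1 / 2) powr (-1/2)"
    using l by (subst powr_powr[symmetric]) (simp add: powr_mult[symmetric])
  also have "(1 / 2 :: real) powr (-1/2) \<le> 2"
  proof -
    have "(1 / 2 :: real) powr (-1/2) = 1 / sqrt (1/2)" by (rule powr_neg_half) simp
    also have "\<dots> = sqrt 2" by (simp add: real_sqrt_divide)
    also have "\<dots> \<le> 2" by (rule real_le_lsqrt) auto
    finally show ?thesis .
  qed
  finally have "(\<eta> * n) powr (-1/2) \<le> ?l powr ((1 + 2 / omg S) * (-1/2)) * 2"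
    by (simp add: mult_left_mono)
  also have "(1 + 2 / omg S) * (-1/2) = - (2 + omg S) / (2 * omg S)" using o by (simp add: field_simps)
  finally show ?thesis by simp
qed

lemma large_D:
  assumes "large M \<beta> n"
  shows "3 \<le> n" "hmin S n \<le> 1" "hfrak S n \<le> 1" "max M 1 * hfrak S n powr \<beta> \<le> 1"
    "max M 1 * (ln (real n) powr (1 / omg S) * hmin S n powr \<beta>) \<le> 1"
    "(real n * (hfrak S n)\<^sup>2) powr (-1/2) * C3 S n \<le> 1/2"
    "(200 + 8 * rexp S) * ln (real n) \<le> c1 S n" "(200 + 8 * rexp S) * ln (real n) \<le> c2 S n"
    "(200 + 8 * rexp S) * ln (real n) \<le> c3 S n" "(200 + 8 * rexp S) * ln (real n) \<le> c4 S n"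
    "net_error_small (max 1 (tau S n)) n"
  using assms by (auto simp: large_def)

lemma large_c_nonneg:
  assumes "large M \<beta> n"
  shows "0 \<le> c1 S n" "0 \<le> c2 S n" "0 \<le> c3 S n" "0 \<le> c4 S n"
proof -
  have "0 \<le> (200 + 8 * rexp S) * ln (real n)"
    using ln_ge_1[OF large_D(1)[OF assms]] r by (intro mult_nonneg_nonneg) auto
  then show "0 \<le> c1 S n" "0 \<le> c2 S n" "0 \<le> c3 S n" "0 \<le> c4 S n"
    using large_D(7-10)[OF assms] by linarith+
qed

lemma budget_rearrange:
  fixes c k g l t :: real
  shows "(c * k / g) * (8/3 * l) = 8/3 * c * l * inverse g * k"
    "(c * k / g) * (8/3 * (t * l)) = 8/3 * c * l * inverse g * k * t"
    "8/3 * (c * k / g * l) = 8/3 * inverse g * k * c * l"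
    "8/3 * (c * t * k / g * l) = 8/3 * t * c * l * inverse g * k"
  by (simp_all add: inverse_eq_divide mult_ac)

text \<open>\<open>G\<close> will be the link divided by its supremum on the square. The leading
  Bernstein term is that of \<open>C1\<close>, and the range term fits into the second summand since
  \<open>1/2 * 2 \<le> 8/3\<close>.\<close>

lemma direction_design_deviation:
  assumes L: "large M \<beta> n" and t: "t \<in> cbox (vec (-1/2)) (vec (1/2))"
    and G: "G \<in> borel_measurable borel" "\<And>x. x \<in> cbox (vec (-5/2)) (vec (5/2)) \<Longrightarrow> \<bar>G x\<bar> \<le> 1"
  shows "\<exists>B\<in>events. prob B \<le> 2 * real n powr (- 4 * rexp S) \<and>
    (\<forall>w\<in>space P - B. \<forall>v \<eta>. 1/2 \<le> norm v \<longrightarrow> norm v \<le> 1 \<longrightarrow> \<eta> \<in> bandwidths S n \<longrightarrow>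
      \<bar>wmean n w (E_single v \<eta>) t (\<lambda>i. G (X i w))
        - (LBINT x. psi (E_single v \<eta>) t x * G x)\<bar> \<le> C1 S n * (\<eta> * n) powr (-1/2))"
proof -
  note n = large_D(1)[OF L]
  obtain N where N: "finite N" "N \<subseteq> dir_index n" "real (card N) \<le> real n ^ 20"
    and net: "\<And>e. e \<in> dir_index n \<Longrightarrow> \<exists>e'\<in>N. 1 / snd e' = 1 / snd e \<and>
      (\<forall>x. \<bar>psi (E_single (fst e) (snd e)) t x - psi (E_single (fst e') (snd e')) t x\<bar> \<le> mesh n)"
    by (rule net_dir_index[OF n, of t]) (rule that)
  let ?Q = "\<lambda>w e. \<bar>wmean n w (E_single (fst e) (snd e)) t (\<lambda>i. G (X i w))
        - (LBINT x. psi (E_single (fst e) (snd e)) t x * G x)\<bar>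
      \<le> budget 1 1 (c1 S n) (n / (1 / snd e))"
  have "\<exists>B\<in>events. prob B \<le> 2 * real n powr (- 4 * rexp S) \<and> (\<forall>w\<in>space P - B. \<forall>e\<in>dir_index n. ?Q w e)"
  proof (rule design_family_deviation[where E = "\<lambda>e. E_single (fst e) (snd e)" and v = "\<lambda>_. t" and D = "\<lambda>e. 1 / snd e",
      OF n large_D(7)[OF L] N G(1)])
    fix e assume e: "e \<in> dir_index n"
    show "0 < det (E_single (fst e) (snd e))" "det (E_single (fst e) (snd e)) \<le> 1 / snd e" "1 \<le> 1 / snd e"
      by (rule det_dir_index[OF e n])+
    show "\<exists>e'\<in>N. 1 / snd e' = 1 / snd e \<and> (\<forall>x. \<bar>psi (E_single (fst e) (snd e)) t x - psi (E_single (fst e') (snd e')) t x\<bar>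
        \<le> mesh n)" by (rule net[OF e])
    fix x assume nz: "psi (E_single (fst e) (snd e)) t x \<noteq> 0"
    show "x \<in> cube" by (rule psi_E_single_in_cube(2)[OF e n t nz])
    show "\<bar>G x\<bar> \<le> 1" by (rule G(2)[OF psi_E_single_in_cube(1)[OF e n t nz]])
  qed (rule large_D(11)[OF L])
  then obtain B where B: "B \<in> events"
    and B2: "prob B \<le> 2 * real n powr (- 4 * rexp S) \<and> (\<forall>w\<in>space P - B. \<forall>e\<in>dir_index n. ?Q w e)"
    by (rule bexE)
  note dev = bspec[OF bspec[OF conjunct2[OF B2]]]
  show ?thesis
  proof (intro bexI[of _ B] conjI ballI allI impI)
    fix w and v :: "real^2" and \<eta> assume w: "w \<in> space P - B" and v: "1/2 \<le> norm v" "norm v \<le> 1" and \<eta>: "\<eta> \<in> bandwidths S n"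
    have "(v, \<eta>) \<in> dir_index n" using v \<eta> by (simp add: dir_index_def)
    have eq: "n / (1 / \<eta>) = \<eta> * n" by simp
    note d = dev[OF w \<open>(v, \<eta>) \<in> dir_index n\<close>, unfolded fst_conv snd_conv eq]
    have "c1 S n / 2 * 1 * (kernel_sup S)\<^sup>2 / glow S * (\<eta> * n) powr (-1/2)
      \<le> 8/3 * c1 S n * ln (real n) powr (- (2 + omg S) / (2 * omg S)) * inverse (glow S) * (kernel_sup S)\<^sup>2"
    proof -
      have q: "0 \<le> c1 S n * (kernel_sup S)\<^sup>2 / glow S" using large_c_nonneg[OF L] glow by simp
      have "c1 S n / 2 * 1 * (kernel_sup S)\<^sup>2 / glow S * (\<eta> * n) powr (-1/2)
          = (c1 S n * (kernel_sup S)\<^sup>2 / glow S) * (1/2 * (\<eta> * n) powr (-1/2))" by simp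
      also have "\<dots> \<le> (c1 S n * (kernel_sup S)\<^sup>2 / glow S) * (8/3 * ln (real n) powr (- (2 + omg S) / (2 * omg S)))"
        using bandwidth_rate[OF n \<eta>] powr_ge_zero[of "ln (real n)" "- (2 + omg S) / (2 * omg S)"]
        by (intro mult_left_mono[OF _ q]) linarith
      finally show ?thesis by (simp only: budget_rearrange(1))
    qed
    then have "2 * sqrt 2 * 1 * glow S powr (-1/2) * (kernel_sup S)\<^sup>2 * sqrt (c1 S n)
        + c1 S n / 2 * 1 * (kernel_sup S)\<^sup>2 / glow S * (\<eta> * n) powr (-1/2) \<le> C1 S n"
      unfolding C1_def mult_1_right by (rule add_left_mono)
    from order_trans[OF d mult_right_mono[OF this powr_ge_zero]]
    show "\<bar>wmean n w (E_single v \<eta>) t (\<lambda>i. G (X i w))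
        - (LBINT x. psi (E_single v \<eta>) t x * G x)\<bar> \<le> C1 S n * (\<eta> * n) powr (-1/2)" .
  qed (rule conjunct1[OF B2], rule B)
qed

text \<open>The factor \<open>ln n powr (1 / omg S)\<close> in \<open>tau\<close> raises the
  exponent of the range term to exactly -1/2, the one in \<open>C2\<close>. This is what the
  exponent \<open>1 + 2 / omg S\<close> in \<open>hmin\<close> is for.\<close>

lemma direction_noise_deviation:
  assumes L: "large M \<beta> n" and t: "t \<in> cbox (vec (-1/2)) (vec (1/2))"
  shows "\<exists>B\<in>events. prob B \<le> 2 * real n powr (- 4 * rexp S) \<and>
    (\<forall>w\<in>space P - B. \<forall>v \<eta>. 1/2 \<le> norm v \<longrightarrow> norm v \<le> 1 \<longrightarrow> \<eta> \<in> bandwidths S n \<longrightarrow>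
      \<bar>wmean n w (E_single v \<eta>) t (\<lambda>i. trunc (tau S n) (\<epsilon> i w))\<bar>
      \<le> C2 S n * (\<eta> * n) powr (-1/2))"
proof -
  note n = large_D(1)[OF L]
  obtain N where N: "finite N" "N \<subseteq> dir_index n" "real (card N) \<le> real n ^ 20"
    and net: "\<And>e. e \<in> dir_index n \<Longrightarrow> \<exists>e'\<in>N. 1 / snd e' = 1 / snd e \<and>
      (\<forall>x. \<bar>psi (E_single (fst e) (snd e)) t x - psi (E_single (fst e') (snd e')) t x\<bar> \<le> mesh n)"
    by (rule net_dir_index[OF n, of t]) (rule that)
  let ?Q = "\<lambda>w e. \<bar>wmean n w (E_single (fst e) (snd e)) t (\<lambda>i. trunc (tau S n) (\<epsilon> i w)) - 0\<bar>
      \<le> budget (max (sigma S) 1) (tau S n) (c2 S n) (n / (1 / snd e))"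
  have "\<exists>B\<in>events. prob B \<le> 2 * real n powr (- 4 * rexp S) \<and> (\<forall>w\<in>space P - B. \<forall>e\<in>dir_index n. ?Q w e)"
  proof (rule noise_family_deviation[where E = "\<lambda>e. E_single (fst e) (snd e)" and v = "\<lambda>_. t" and D = "\<lambda>e. 1 / snd e",
      OF n large_D(8)[OF L] N])
    fix e assume e: "e \<in> dir_index n"
    show "0 < det (E_single (fst e) (snd e))" "det (E_single (fst e) (snd e)) \<le> 1 / snd e" "1 \<le> 1 / snd e"
      by (rule det_dir_index[OF e n])+
    show "\<exists>e'\<in>N. 1 / snd e' = 1 / snd e \<and> (\<forall>x. \<bar>psi (E_single (fst e) (snd e)) t x - psi (E_single (fst e') (snd e')) t x\<bar>
        \<le> mesh n)" by (rule net[OF e])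
    fix x assume nz: "psi (E_single (fst e) (snd e)) t x \<noteq> 0"
    show "x \<in> cube" by (rule psi_E_single_in_cube(2)[OF e n t nz])
  qed (rule large_D(11)[OF L])
  then obtain B where B: "B \<in> events"
    and B2: "prob B \<le> 2 * real n powr (- 4 * rexp S) \<and> (\<forall>w\<in>space P - B. \<forall>e\<in>dir_index n. ?Q w e)"
    by (rule bexE)
  note dev = bspec[OF bspec[OF conjunct2[OF B2]]]
  show ?thesis
  proof (intro bexI[of _ B] conjI ballI allI impI)
    fix w and v :: "real^2" and \<eta> assume w: "w \<in> space P - B" and v: "1/2 \<le> norm v" "norm v \<le> 1" and \<eta>: "\<eta> \<in> bandwidths S n"
    have "(v, \<eta>) \<in> dir_index n" using v \<eta> by (simp add: dir_index_def)
    have eq: "n / (1 / \<eta>) = \<eta> * n" by simp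
    note d = dev[OF w \<open>(v, \<eta>) \<in> dir_index n\<close>, unfolded fst_conv snd_conv diff_0_right eq]
    let ?l = "ln (real n)" and ?K = "((4 * rexp S + 1) / Omg S) powr (1 / omg S)"
    have l: "1 \<le> ?l" by (rule ln_ge_1[OF n])
    have tau: "tau S n = ?K * ?l powr (1 / omg S)"
      using l r noise_params by (simp add: tau_def powr_mult[symmetric])
    have "tau S n * (\<eta> * n) powr (-1/2) \<le> (?K * ?l powr (1 / omg S)) * (2 * ?l powr (- (2 + omg S) / (2 * omg S)))"
      unfolding tau by (intro mult_left_mono bandwidth_rate[OF n \<eta>]) auto
    also have "\<dots> = 2 * ?K * (?l powr (1 / omg S) * ?l powr (- (2 + omg S) / (2 * omg S)))" by simp
    also have "?l powr (1 / omg S) * ?l powr (- (2 + omg S) / (2 * omg S)) = ?l powr (1 / omg S + (- (2 + omg S) / (2 * omg S)))"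
      by (rule powr_add[symmetric])
    also have "1 / omg S + (- (2 + omg S) / (2 * omg S)) = -1/2" using noise_params by (simp add: field_simps)
    finally have tr: "tau S n * (\<eta> * n) powr (-1/2) \<le> 2 * ?K * ?l powr (-1/2)" .
    have "c2 S n / 2 * tau S n * (kernel_sup S)\<^sup>2 / glow S * (\<eta> * n) powr (-1/2)
      \<le> 8/3 * c2 S n * ?l powr (-1/2) * inverse (glow S) * (kernel_sup S)\<^sup>2 * ?K"
    proof -
      have q: "0 \<le> c2 S n * (kernel_sup S)\<^sup>2 / glow S" using large_c_nonneg[OF L] glow by simp
      have "c2 S n / 2 * tau S n * (kernel_sup S)\<^sup>2 / glow S * (\<eta> * n) powr (-1/2)
          = (c2 S n * (kernel_sup S)\<^sup>2 / glow S) * (1/2 * (tau S n * (\<eta> * n) powr (-1/2)))" by (simp add: mult_ac)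
      also have "\<dots> \<le> (c2 S n * (kernel_sup S)\<^sup>2 / glow S) * (8/3 * (?K * ?l powr (-1/2)))"
        using tr mult_nonneg_nonneg[OF powr_ge_zero powr_ge_zero, of "(4 * rexp S + 1) / Omg S" "1 / omg S" ?l "-1/2"]
        by (intro mult_left_mono[OF _ q]) linarith
      finally show ?thesis by (simp only: budget_rearrange(2))
    qed
    then have "2 * sqrt 2 * max (sigma S) 1 * glow S powr (-1/2) * (kernel_sup S)\<^sup>2 * sqrt (c2 S n)
        + c2 S n / 2 * tau S n * (kernel_sup S)\<^sup>2 / glow S * (\<eta> * n) powr (-1/2) \<le> C2 S n"
      unfolding C2_def mult_1_right by (rule add_left_mono)
    from order_trans[OF d mult_right_mono[OF this powr_ge_zero]]
    show "\<bar>wmean n w (E_single v \<eta>) t (\<lambda>i. trunc (tau S n) (\<epsilon> i w))\<bar>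
        \<le> C2 S n * (\<eta> * n) powr (-1/2)" .
  qed (rule conjunct1[OF B2], rule B)
qed

lemma psi_scal_in_cube:
  assumes h: "0 < h" "h \<le> 1" and v: "v \<in> point_index" and nz: "psi (scal h) v x \<noteq> 0"
  shows "x \<in> cube"
proof -
  have "\<bar>(x - v)$i\<bar> \<le> 1/2" for i using psi_scal_support[OF h nz, of i] h by simp
  moreover have "- (5/2) \<le> v$i \<and> v$i \<le> 5/2" for i using v by (simp add: point_index_def mem_box_cart)
  ultimately have "\<bar>x$i - v$i\<bar> \<le> 1/2 \<and> - (5/2) \<le> v$i \<and> v$i \<le> 5/2" for i by simp
  then have "- 3 \<le> x$i \<and> x$i \<le> 3" for i by (smt (verit) field_sum_of_halves)
  then show ?thesis by (simp add: cube_def mem_box_cart)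
qed

text \<open>Some weights reach beyond the square of evaluation points, so the bound on
  \<open>G\<close> is asked wherever the weight of an evaluation point is nonzero.\<close>

lemma point_design_deviation:
  assumes L: "large M \<beta> n" and G: "G \<in> borel_measurable borel"
      "\<And>v x. v \<in> point_index \<Longrightarrow> psi (scal (hfrak S n)) v x \<noteq> 0 \<Longrightarrow> \<bar>G x\<bar> \<le> 1"
  shows "\<exists>B\<in>events. prob B \<le> 2 * real n powr (- 4 * rexp S) \<and>
    (\<forall>w\<in>space P - B. \<forall>v\<in>point_index.
      \<bar>wmean n w (scal (hfrak S n)) v (\<lambda>i. G (X i w))
        - (LBINT x. psi (scal (hfrak S n)) v x * G x)\<bar> \<le> (real n * (hfrak S n)\<^sup>2) powr (-1/2) * C3 S n)"
proof -
  let ?h = "hfrak S n"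
  note n = large_D(1)[OF L]
  note h = hfrak_pos[OF n] large_D(3)[OF L]
  obtain N where N: "finite N" "N \<subseteq> point_index" "real (card N) \<le> real n ^ 20"
    and net: "\<And>v. v \<in> point_index \<Longrightarrow> \<exists>v'\<in>N. 
      (\<forall>x. \<bar>psi (scal ?h) v x - psi (scal ?h) v' x\<bar> \<le> mesh n)"
    by (rule net_point_index[OF n h(2)]) (rule that)
  have det: "0 < det (scal ?h)" "det (scal ?h) \<le> 1 / ?h\<^sup>2" "1 \<le> 1 / ?h\<^sup>2"
    using h power_mono[OF h(2), of 2] by (simp_all add: det_scal)
  let ?Q = "\<lambda>w v. \<bar>wmean n w (scal ?h) v (\<lambda>i. G (X i w)) - (LBINT x. psi (scal ?h) v x * G x)\<bar>
      \<le> budget 1 1 (c3 S n) (n / (1 / ?h\<^sup>2))"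
  have "\<exists>B\<in>events. prob B \<le> 2 * real n powr (- 4 * rexp S) \<and> (\<forall>w\<in>space P - B. \<forall>v\<in>point_index. ?Q w v)"
  proof (rule design_family_deviation[where E = "\<lambda>_. scal ?h" and v = "\<lambda>v. v" and D = "\<lambda>_. 1 / ?h\<^sup>2",
      OF n large_D(9)[OF L] N G(1) det])
    fix v assume v: "v \<in> point_index"
    show "\<exists>v'\<in>N. 1 / ?h\<^sup>2 = 1 / ?h\<^sup>2 \<and> (\<forall>x. \<bar>psi (scal ?h) v x - psi (scal ?h) v' x\<bar> \<le> mesh n)"
      using net[OF v] by simp
    fix x assume nz: "psi (scal ?h) v x \<noteq> 0"
    show "x \<in> cube" by (rule psi_scal_in_cube[OF h v nz])
    show "\<bar>G x\<bar> \<le> 1" by (rule G(2)[OF v nz])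
  qed (rule large_D(11)[OF L])
  then obtain B where B: "B \<in> events"
    and B2: "prob B \<le> 2 * real n powr (- 4 * rexp S) \<and> (\<forall>w\<in>space P - B. \<forall>v\<in>point_index. ?Q w v)"
    by (rule bexE)
  note dev = bspec[OF bspec[OF conjunct2[OF B2]]]
  show ?thesis
  proof (intro bexI[of _ B] conjI ballI)
    fix w v assume w: "w \<in> space P - B" and v: "v \<in> point_index"
    let ?R = "(real n * ?h\<^sup>2) powr (-1/2)"
    have "c3 S n / 2 * 1 * (kernel_sup S)\<^sup>2 / glow S * ?R \<le> 8/3 * inverse (glow S) * (kernel_sup S)\<^sup>2 * c3 S n * ?R"
    proof -
      have q: "0 \<le> c3 S n * (kernel_sup S)\<^sup>2 / glow S * ?R" using large_c_nonneg[OF L] glow by simp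
      have "c3 S n / 2 * 1 * (kernel_sup S)\<^sup>2 / glow S * ?R = 1/2 * (c3 S n * (kernel_sup S)\<^sup>2 / glow S * ?R)" by simp
      also have "\<dots> \<le> 8/3 * (c3 S n * (kernel_sup S)\<^sup>2 / glow S * ?R)" using q by (intro mult_right_mono) auto
      finally show ?thesis by (simp only: budget_rearrange(3))
    qed
    then have le: "2 * sqrt 2 * 1 * glow S powr (-1/2) * (kernel_sup S)\<^sup>2 * sqrt (c3 S n)
        + c3 S n / 2 * 1 * (kernel_sup S)\<^sup>2 / glow S * ?R \<le> C3 S n"
      unfolding C3_def mult_1_right by (rule add_left_mono)
    have eq: "n / (1 / ?h\<^sup>2) = real n * ?h\<^sup>2" by simp
    from order_trans[OF dev[OF w v, unfolded eq diff_0_right] mult_right_mono[OF le powr_ge_zero]]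
    show "\<bar>wmean n w (scal ?h) v (\<lambda>i. G (X i w)) - (LBINT x. psi (scal ?h) v x * G x)\<bar>
      \<le> ?R * C3 S n" unfolding mult.commute[of ?R "C3 S n"] .
  qed (rule conjunct1[OF B2], rule B)
qed

lemma point_noise_deviation:
  assumes L: "large M \<beta> n"
  shows "\<exists>B\<in>events. prob B \<le> 2 * real n powr (- 4 * rexp S) \<and>
    (\<forall>w\<in>space P - B. \<forall>v\<in>point_index.
      \<bar>wmean n w (scal (hfrak S n)) v (\<lambda>i. trunc (tau S n) (\<epsilon> i w))\<bar>
      \<le> (real n * (hfrak S n)\<^sup>2) powr (-1/2) * C4 S n)"
proof -
  let ?h = "hfrak S n"
  note n = large_D(1)[OF L]
  note h = hfrak_pos[OF n] large_D(3)[OF L]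
  obtain N where N: "finite N" "N \<subseteq> point_index" "real (card N) \<le> real n ^ 20"
    and net: "\<And>v. v \<in> point_index \<Longrightarrow> \<exists>v'\<in>N. 
      (\<forall>x. \<bar>psi (scal ?h) v x - psi (scal ?h) v' x\<bar> \<le> mesh n)"
    by (rule net_point_index[OF n h(2)]) (rule that)
  have det: "0 < det (scal ?h)" "det (scal ?h) \<le> 1 / ?h\<^sup>2" "1 \<le> 1 / ?h\<^sup>2"
    using h power_mono[OF h(2), of 2] by (simp_all add: det_scal)
  let ?Q = "\<lambda>w v. \<bar>wmean n w (scal ?h) v (\<lambda>i. trunc (tau S n) (\<epsilon> i w)) - 0\<bar>
      \<le> budget (max (sigma S) 1) (tau S n) (c4 S n) (n / (1 / ?h\<^sup>2))"
  have "\<exists>B\<in>events. prob B \<le> 2 * real n powr (- 4 * rexp S) \<and> (\<forall>w\<in>space P - B. \<forall>v\<in>point_index. ?Q w v)"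
  proof (rule noise_family_deviation[where E = "\<lambda>_. scal ?h" and v = "\<lambda>v. v" and D = "\<lambda>_. 1 / ?h\<^sup>2",
      OF n large_D(10)[OF L] N det])
    fix v assume v: "v \<in> point_index"
    show "\<exists>v'\<in>N. 1 / ?h\<^sup>2 = 1 / ?h\<^sup>2 \<and> (\<forall>x. \<bar>psi (scal ?h) v x - psi (scal ?h) v' x\<bar> \<le> mesh n)"
      using net[OF v] by simp
    fix x assume nz: "psi (scal ?h) v x \<noteq> 0"
    show "x \<in> cube" by (rule psi_scal_in_cube[OF h v nz])
  qed (rule large_D(11)[OF L])
  then obtain B where B: "B \<in> events"
    and B2: "prob B \<le> 2 * real n powr (- 4 * rexp S) \<and> (\<forall>w\<in>space P - B. \<forall>v\<in>point_index. ?Q w v)"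
    by (rule bexE)
  note dev = bspec[OF bspec[OF conjunct2[OF B2]]]
  show ?thesis
  proof (intro bexI[of _ B] conjI ballI)
    fix w v assume w: "w \<in> space P - B" and v: "v \<in> point_index"
    let ?R = "(real n * ?h\<^sup>2) powr (-1/2)"
    have "c4 S n / 2 * tau S n * (kernel_sup S)\<^sup>2 / glow S * ?R
      \<le> 8/3 * tau S n * c4 S n * ?R * inverse (glow S) * (kernel_sup S)\<^sup>2"
    proof -
      have q: "0 \<le> c4 S n * tau S n * (kernel_sup S)\<^sup>2 / glow S * ?R"
        using large_c_nonneg[OF L] glow tau_pos[OF n] by simp
      have "c4 S n / 2 * tau S n * (kernel_sup S)\<^sup>2 / glow S * ?R
          = 1/2 * (c4 S n * tau S n * (kernel_sup S)\<^sup>2 / glow S * ?R)" by simp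
      also have "\<dots> \<le> 8/3 * (c4 S n * tau S n * (kernel_sup S)\<^sup>2 / glow S * ?R)" using q by (intro mult_right_mono) auto
      finally show ?thesis by (simp only: budget_rearrange(4))
    qed
    then have le: "2 * sqrt 2 * max (sigma S) 1 * glow S powr (-1/2) * (kernel_sup S)\<^sup>2 * sqrt (c4 S n)
        + c4 S n / 2 * tau S n * (kernel_sup S)\<^sup>2 / glow S * ?R \<le> C4 S n"
      unfolding C4_def mult_1_right by (rule add_left_mono)
    have eq: "n / (1 / ?h\<^sup>2) = real n * ?h\<^sup>2" by simp
    from order_trans[OF dev[OF w v, unfolded eq diff_0_right] mult_right_mono[OF le powr_ge_zero]]
    show "\<bar>wmean n w (scal ?h) v (\<lambda>i. trunc (tau S n) (\<epsilon> i w))\<bar> \<le> ?R * C4 S n"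
      unfolding mult.commute[of ?R "C4 S n"] .
  qed (rule conjunct1[OF B2], rule B)
qed

text \<open>\<open>tau\<close> solves \<open>Omg S * tau powr omg S = (4 r + 1) * ln n\<close>. Each
  tail is then of order \<open>n powr (- 4 r - 1)\<close>, and the sum over the sample loses one
  power.\<close>

lemma noise_truncation:
  assumes n: "3 \<le> n"
  shows "\<exists>B\<in>events. prob B \<le> 2 * Ups S * real n powr (- 4 * rexp S) \<and>
    (\<forall>w\<in>space P - B. \<forall>i<n. trunc (tau S n) (\<epsilon> i w) = \<epsilon> i w)"
proof -
  let ?\<tau> = "tau S n"
  have \<tau>: "0 \<le> ?\<tau>" using tau_pos[OF n] by simp
  have l: "0 < ln (real n)" using ln_ge_1[OF n] by linarith
  define Bad where "Bad i = {w \<in> space P. ?\<tau> \<le> \<bar>\<epsilon> i w\<bar>}" for i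
  have [measurable]: "Bad i \<in> events" for i unfolding Bad_def by measurable
  have e: "exp (- Omg S * ?\<tau> powr omg S) = real n powr (- 4 * rexp S - 1)"
  proof -
    have "?\<tau> powr omg S = (4 * rexp S + 1) * ln (real n) / Omg S"
      using noise_params r l by (simp add: tau_def powr_powr)
    then have "- Omg S * ?\<tau> powr omg S = - ((4 * rexp S + 1) * ln (real n))" using noise_params by simp
    then show ?thesis using n by (simp only:) (simp add: powr_def algebra_simps)
  qed
  have "prob (Bad i) \<le> 2 * Ups S * real n powr (- 4 * rexp S - 1)" for i
  proof -
    have "emeasure P (Bad i) = emeasure (distr P lborel (\<epsilon> i)) {y. ?\<tau> \<le> \<bar>y\<bar>}"
      by (subst emeasure_distr) (auto simp: Bad_def intro!: arg_cong[where f = "emeasure P"])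
    also have "\<dots> \<le> ennreal (2 * Ups S * exp (- Omg S * ?\<tau> powr omg S))"
      unfolding distr_eps by (rule noise_tail[OF eps_class eps_sym noise_params(1) \<tau>])
    finally show ?thesis unfolding e using noise_params by (simp add: emeasure_eq_measure)
  qed
  then have "(\<Sum>i<n. prob (Bad i)) \<le> (\<Sum>i<n. 2 * Ups S * real n powr (- 4 * rexp S - 1))" by (intro sum_mono)
  also have "\<dots> = 2 * Ups S * (real n powr 1 * real n powr (- 4 * rexp S - 1))" by simp
  also have "\<dots> = 2 * Ups S * real n powr (- 4 * rexp S)" by (simp only: powr_add[symmetric]) simp
  finally have s: "(\<Sum>i<n. prob (Bad i)) \<le> 2 * Ups S * real n powr (- 4 * rexp S)" .
  show ?thesis
  proof (intro bexI[of _ "\<Union>i<n. Bad i"] conjI ballI allI impI)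
    have "prob (\<Union>i<n. Bad i) \<le> (\<Sum>i<n. prob (Bad i))"
      by (rule finite_measure_subadditive_finite) auto
    then show "prob (\<Union>i<n. Bad i) \<le> 2 * Ups S * real n powr (- 4 * rexp S)" using s by simp
    show "trunc ?\<tau> (\<epsilon> i w) = \<epsilon> i w" if "w \<in> space P - (\<Union>i<n. Bad i)" "i < n" for w i
    proof -
      have "w \<in> space P" "w \<notin> Bad i" using that by auto
      then have "\<bar>\<epsilon> i w\<bar> < ?\<tau>" by (simp add: Bad_def)
      then show ?thesis by (simp add: trunc_def)
    qed
  qed auto
qed

end

section \<open>Sample size and constants\<close>

context procedure_setup
begin

lemma ln_square_mult:
  fixes n k :: real
  assumes "0 < n" "0 < k"
  shows "ln (n\<^sup>2 * k) = 2 * ln n + ln k"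
  using assms by (simp add: ln_mult ln_realpow)

lemma glow_powr: "1 \<le> glow S powr (-1/2)"
proof -
  have "glow S powr (-1/2) = 1 / sqrt (glow S)" using glow by (intro powr_neg_half) simp
  then show ?thesis using glow by simp
qed

lemma const_factor_ge_1: "1 \<le> a \<Longrightarrow> 1 \<le> b \<Longrightarrow> 1 \<le> c \<Longrightarrow> 1 \<le> a * b * (c :: real)"
  using mult_mono[of 1 a 1 b] mult_mono[of 1 "a * b" 1 c] by simp

lemma tau_ge_1:
  assumes "3 \<le> n"
  shows "1 \<le> tau S n"
proof -
  have "1 * 1 \<le> (4 * rexp S + 1) * ln (real n)" using ln_ge_1[OF assms] r by (intro mult_mono) auto
  moreover have "1 * ln (real n) \<le> (4 * rexp S + 1) * ln (real n)"
    using ln_ge_1[OF assms] r by (intro mult_right_mono) auto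
  ultimately have "1 \<le> (4 * rexp S + 1) * ln (real n) / Omg S"
    using noise_params by (simp add: le_divide_eq)
  then show ?thesis using noise_params by (auto simp: tau_def intro!: ge_one_powr_ge_zero)
qed

lemma tau_eq:
  assumes "3 \<le> n"
  shows "tau S n = ((4 * rexp S + 1) / Omg S) powr (1 / omg S) * ln (real n) powr (1 / omg S)"
  using ln_ge_1[OF assms] r noise_params by (simp add: tau_def powr_mult[symmetric])

text \<open>\<open>tau\<close> is a power of \<open>ln n\<close>, so its logarithm is of order
  \<open>ln (ln n)\<close>; the cruder \<open>ln x \<le> x\<close> keeps everything a multiple of
  \<open>ln n\<close>.\<close>

lemma ln_tau_le:
  assumes "3 \<le> n"
  shows "ln (tau S n) \<le> (4 * rexp S + 1) / (Omg S * omg S) * ln (real n)"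
proof -
  let ?x = "(4 * rexp S + 1) * ln (real n) / Omg S"
  have x: "0 < ?x" using ln_ge_1[OF assms] r noise_params by simp
  have "ln (tau S n) = 1 / omg S * ln ?x" using x by (simp add: tau_def ln_powr)
  also have "\<dots> \<le> 1 / omg S * ?x" using noise_params by (intro mult_left_mono ln_bound[OF x]) auto
  finally show ?thesis using noise_params by (simp add: field_simps)
qed

text \<open>Once the logarithms are split, the term \<open>1460 ln n\<close> or
  \<open>730 ln n\<close> exceeds the required \<open>200 ln n\<close> and the remaining terms are
  nonnegative. In the upper bounds \<open>ln n \<ge> 1\<close> absorbs the fixed constants.\<close>

lemma
  assumes n: "3 \<le> n"
  shows c_lower: "(200 + 8 * rexp S) * ln (real n) \<le> c1 S n" "(200 + 8 * rexp S) * ln (real n) \<le> c2 S n"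
    "(200 + 8 * rexp S) * ln (real n) \<le> c3 S n" "(200 + 8 * rexp S) * ln (real n) \<le> c4 S n"
    and c_upper: "\<exists>C\<ge>0. \<forall>n\<ge>3. c1 S n \<le> C * ln (real n) \<and> c2 S n \<le> C * ln (real n) \<and> c3 S n \<le> C * ln (real n) \<and> c4 S n \<le> C * ln (real n)"
proof -
  define k1 where "k1 = 16 * glow S powr (-1/2) * (12 * lipK S + sqrt 2)"
  define k3 where "k3 = 5 * lipK S * glow S powr (-1/2)"
  have k1: "1 \<le> k1" unfolding k1_def
  proof (intro const_factor_ge_1 glow_powr)
    have "0 \<le> sqrt (2 :: real)" by simp
    then show "1 \<le> 12 * lipK S + sqrt 2" using lipK_ge_2 by linarith
  qed simp
  have k3: "1 \<le> k3" unfolding k3_def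
    using glow_powr lipK_ge_2 by (intro const_factor_ge_1) auto
  have e: "c1 S n = 1460 * ln (real n) + 730 * ln k1 + 8 * rexp S * ln (real n) + 394"
      "c2 S n = 1460 * ln (real n) + 730 * ln (tau S n) + 730 * ln k1 + 8 * rexp S * ln (real n) + 394"
      "c3 S n = 730 * ln (real n) + 365 * ln k3 + 8 * rexp S * ln (real n) + 197"
      "c4 S n = 730 * ln (real n) + 365 * ln (tau S n) + 365 * ln k3 + 8 * rexp S * ln (real n) + 197"
    if n: "3 \<le> n" for n
  proof -
    have t: "0 < tau S n" using tau_ge_1[OF n] by linarith
    have p: "0 < k1" "0 < k3" "0 < tau S n * k1" "0 < tau S n * k3" "0 < real n" using k1 k3 t n by auto
    have lt: "ln (tau S n * k1) = ln (tau S n) + ln k1" "ln (tau S n * k3) = ln (tau S n) + ln k3"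
      using t p by (simp_all add: ln_mult)
    have q: "16 * (real n)\<^sup>2 * glow S powr (-1/2) * (12 * lipK S + sqrt 2) = (real n)\<^sup>2 * k1" by (simp add: k1_def)
    show "c1 S n = 1460 * ln (real n) + 730 * ln k1 + 8 * rexp S * ln (real n) + 394"
      unfolding c1_def q ln_square_mult[OF p(5,1)] by simp
    have q: "16 * (real n)\<^sup>2 * tau S n * glow S powr (-1/2) * (12 * lipK S + sqrt 2) = (real n)\<^sup>2 * (tau S n * k1)"
      by (simp add: k1_def)
    show "c2 S n = 1460 * ln (real n) + 730 * ln (tau S n) + 730 * ln k1 + 8 * rexp S * ln (real n) + 394"
      unfolding c2_def q ln_square_mult[OF p(5,3)] lt by simp
    have q: "5 * (real n)\<^sup>2 * lipK S * glow S powr (-1/2) = (real n)\<^sup>2 * k3" by (simp add: k3_def)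
    show "c3 S n = 730 * ln (real n) + 365 * ln k3 + 8 * rexp S * ln (real n) + 197"
      unfolding c3_def q ln_square_mult[OF p(5,2)] by simp
    have q: "5 * (real n)\<^sup>2 * tau S n * lipK S * glow S powr (-1/2) = (real n)\<^sup>2 * (tau S n * k3)"
      by (simp add: k3_def)
    show "c4 S n = 730 * ln (real n) + 365 * ln (tau S n) + 365 * ln k3 + 8 * rexp S * ln (real n) + 197"
      unfolding c4_def q ln_square_mult[OF p(5,4)] lt by simp
  qed
  have l: "0 \<le> ln k1" "0 \<le> ln k3" "0 \<le> ln (tau S n)" "1 \<le> ln (real n)"
    using k1 k3 tau_ge_1[OF n] ln_ge_1[OF n] by auto
  define v where "v = 8 * rexp S * ln (real n)"
  have key: "(200 + 8 * rexp S) * ln (real n) = 200 * ln (real n) + v" by (simp add: v_def algebra_simps)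
  note e' = e[OF n, folded v_def]
  show "(200 + 8 * rexp S) * ln (real n) \<le> c1 S n" unfolding key e'(1) using l by linarith
  show "(200 + 8 * rexp S) * ln (real n) \<le> c2 S n" unfolding key e'(2) using l by linarith
  show "(200 + 8 * rexp S) * ln (real n) \<le> c3 S n" unfolding key e'(3) using l by linarith
  show "(200 + 8 * rexp S) * ln (real n) \<le> c4 S n" unfolding key e'(4) using l by linarith
  define T where "T = (4 * rexp S + 1) / (Omg S * omg S)"
  have T: "0 \<le> T" using r noise_params by (simp add: T_def)
  define C where "C = 1460 + 730 * (T + ln k1 + ln k3) + 8 * rexp S + 394"
  show "\<exists>C\<ge>0. \<forall>n\<ge>3. c1 S n \<le> C * ln (real n) \<and> c2 S n \<le> C * ln (real n) \<and> c3 S n \<le> C * ln (real n) \<and> c4 S n \<le> C * ln (real n)"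
  proof (intro exI[of _ C] conjI allI impI)
    show "0 \<le> C" using T l r by (simp add: C_def)
    fix n :: nat assume n: "3 \<le> n"
    let ?l = "ln (real n)"
    have l1: "1 \<le> ?l" by (rule ln_ge_1[OF n])
    have t: "0 \<le> ln (tau S n)" "ln (tau S n) \<le> T * ?l" using ln_tau_le[OF n] tau_ge_1[OF n] by (simp_all add: T_def)
    have Cl: "C * ?l = 1460 * ?l + 730 * (T * ?l) + 730 * (ln k1 * ?l) + 730 * (ln k3 * ?l) + 8 * rexp S * ?l + 394 * ?l"
      by (simp add: C_def algebra_simps)
    have k: "ln k1 * 1 \<le> ln k1 * ?l" "ln k3 * 1 \<le> ln k3 * ?l" using l l1 by (intro mult_left_mono; simp)+
    show "c1 S n \<le> C * ?l" unfolding e(1)[OF n] Cl using k l l1 t by linarith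
    show "c2 S n \<le> C * ?l" unfolding e(2)[OF n] Cl using k l l1 t by linarith
    show "c3 S n \<le> C * ?l" unfolding e(3)[OF n] Cl using k l l1 t by linarith
    show "c4 S n \<le> C * ?l" unfolding e(4)[OF n] Cl using k l l1 t by linarith
  qed
qed

lemma n_hfrak_powr:
  assumes n: "3 \<le> n"
  shows "(real n * (hfrak S n)\<^sup>2) powr (-1/2) = ln (real n) powr (- (1/2) - 1 / (2 * omg S))"
proof -
  have "real n * (hfrak S n)\<^sup>2 = ln (real n) powr (1 + 1 / omg S)" using n by (simp add: hfrak_square)
  then have "(real n * (hfrak S n)\<^sup>2) powr (-1/2) = ln (real n) powr ((1 + 1 / omg S) * (-1/2))"
    by (simp add: powr_powr)
  also have "(1 + 1 / omg S) * (-1/2) = - (1/2) - 1 / (2 * omg S)" by (simp add: field_simps)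
  finally show ?thesis .
qed

text \<open>Each of \<open>c1\<close> to \<open>c4\<close> is at most linear in \<open>ln n\<close>,
  so its root has the right order; in \<open>C1\<close>, \<open>C2\<close> and \<open>C3\<close> the
  range terms carry negative powers of \<open>ln n\<close> that bring them down to it. In
  \<open>C4\<close> the truncation level adds \<open>1 / omg S\<close> to the exponent of the range
  term, and the prefactor in \<open>C5\<close> cancels the resulting growth exactly. For
  \<open>C3\<close> the same prefactor leaves a negative power, by which the condition of
  \<open>n1\<close> eventually holds.\<close>

lemma constants_bounded:
  "\<exists>K\<ge>0. \<forall>n\<ge>3. 0 \<le> C1 S n \<and> C1 S n \<le> K * sqrt (ln (real n)) \<and> 0 \<le> C2 S n \<and> C2 S n \<le> K * sqrt (ln (real n))
    \<and> C5 S n \<le> K \<and> (real n * (hfrak S n)\<^sup>2) powr (-1/2) * C3 S n \<le> K * ln (real n) powr (- 1 / (2 * omg S))"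
proof -
  obtain C where C: "0 \<le> C" and cC: "\<And>n. 3 \<le> n \<Longrightarrow> c1 S n \<le> C * ln (real n) \<and> c2 S n \<le> C * ln (real n)
      \<and> c3 S n \<le> C * ln (real n) \<and> c4 S n \<le> C * ln (real n)"
    using c_upper[of 3] by auto
  define A where "A = 2 * sqrt 2 * glow S powr (-1/2) * (kernel_sup S)\<^sup>2"
  define A' where "A' = 2 * sqrt 2 * max (sigma S) 1 * glow S powr (-1/2) * (kernel_sup S)\<^sup>2"
  define B where "B = 8/3 * inverse (glow S) * (kernel_sup S)\<^sup>2"
  define T where "T = ((4 * rexp S + 1) / Omg S) powr (1 / omg S)"
  have nn: "0 \<le> A" "0 \<le> A'" "0 \<le> B" "0 \<le> T" using glow by (auto simp: A_def A'_def B_def T_def)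
  define K where "K = (kernel_L1 S)\<^sup>2 + 1/2 + (A + A') * sqrt C + B * C + B * T * C"
  have Kn: "0 \<le> (kernel_L1 S)\<^sup>2" "0 \<le> A * sqrt C" "0 \<le> A' * sqrt C" "0 \<le> B * C" "0 \<le> B * T * C"
    using nn C by auto
  have KA: "A * sqrt C + B * C \<le> K" "A' * sqrt C + B * T * C \<le> K"
    "(kernel_L1 S)\<^sup>2 + (A' * sqrt C + B * T * C) + 1/2 \<le> K" "0 \<le> K"
    unfolding K_def distrib_right using Kn by linarith+
  have o: "0 < omg S" by (rule noise_params)
  show ?thesis
  proof (intro exI[of _ K] conjI allI impI KA(4))
    fix n :: nat assume n: "3 \<le> n"
    let ?l = "ln (real n)" and ?R = "(real n * (hfrak S n)\<^sup>2) powr (-1/2)"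
    have l: "1 \<le> ?l" by (rule ln_ge_1[OF n])
    have sl: "sqrt ?l = ?l powr (1/2)" using l by (simp add: powr_half_sqrt)
    have c0: "0 \<le> c1 S n" "0 \<le> c2 S n" "0 \<le> c3 S n" "0 \<le> c4 S n"
    proof -
      have "0 \<le> (200 + 8 * rexp S) * ?l" using l r by (intro mult_nonneg_nonneg) auto
      then show "0 \<le> c1 S n" "0 \<le> c2 S n" "0 \<le> c3 S n" "0 \<le> c4 S n" using c_lower[OF n] by linarith+
    qed
    have sq: "sqrt c \<le> sqrt C * ?l powr (1/2)" if "c \<le> C * ?l" for c
      using real_sqrt_le_mono[OF that] by (simp add: real_sqrt_mult sl)
    have R: "?R = ?l powr (- (1/2) - 1 / (2 * omg S))" by (rule n_hfrak_powr[OF n])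
    have lp: "?l = ?l powr 1" using l by simp
    have p: "?l powr a * ?l powr b = ?l powr (a + b)" for a b by (rule powr_add[symmetric])
    have m: "?l powr a \<le> ?l powr b" if "a \<le> b" for a b using that l by (rule powr_mono)
    note cn = cC[OF n]
    have E1: "C1 S n = A * sqrt (c1 S n) + B * (c1 S n * ?l powr (- (2 + omg S) / (2 * omg S)))"
      by (simp add: C1_def A_def B_def)
    have E2: "C2 S n = A' * sqrt (c2 S n) + B * (T * (c2 S n * ?l powr (-1/2)))"
      by (simp add: C2_def A'_def B_def T_def)
    have E3: "C3 S n = A * sqrt (c3 S n) + B * (c3 S n * ?R)"
      by (simp add: C3_def A_def B_def)
    have E4: "C4 S n = A' * sqrt (c4 S n) + B * (T * (?l powr (1 / omg S) * (c4 S n * ?R)))"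
      by (simp add: C4_def A'_def B_def T_def tau_eq[OF n])
    show "0 \<le> C1 S n" "0 \<le> C2 S n" using nn c0 by (auto simp: E1 E2)
    have "c1 S n * ?l powr (- (2 + omg S) / (2 * omg S)) \<le> (C * ?l powr 1) * ?l powr (- (2 + omg S) / (2 * omg S))"
      using cn lp by (intro mult_right_mono) auto
    also have "\<dots> = C * ?l powr (1 + - (2 + omg S) / (2 * omg S))" by (simp only: mult.assoc p)
    also have "\<dots> \<le> C * ?l powr (1/2)" using o C by (intro mult_left_mono m) (auto simp: field_simps)
    finally have a1: "c1 S n * ?l powr (- (2 + omg S) / (2 * omg S)) \<le> C * ?l powr (1/2)" .
    have "C1 S n \<le> A * (sqrt C * ?l powr (1/2)) + B * (C * ?l powr (1/2))"
      unfolding E1 using cn by (intro add_mono mult_left_mono a1 sq nn) auto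
    also have "\<dots> = (A * sqrt C + B * C) * ?l powr (1/2)" by (simp add: algebra_simps)
    also have "\<dots> \<le> K * ?l powr (1/2)" by (rule mult_right_mono[OF KA(1)]) simp
    finally show "C1 S n \<le> K * sqrt ?l" by (simp add: sl)
    have "c2 S n * ?l powr (-1/2) \<le> (C * ?l powr 1) * ?l powr (-1/2)"
      using cn lp by (intro mult_right_mono) auto
    also have "\<dots> = C * ?l powr (1 + -1/2)" by (simp only: mult.assoc p)
    finally have a2: "c2 S n * ?l powr (-1/2) \<le> C * ?l powr (1/2)" by simp
    have "C2 S n \<le> A' * (sqrt C * ?l powr (1/2)) + B * (T * (C * ?l powr (1/2)))"
      unfolding E2 using cn by (intro add_mono mult_left_mono a2 sq nn) auto
    also have "\<dots> = (A' * sqrt C + B * T * C) * ?l powr (1/2)" by (simp add: algebra_simps)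
    also have "\<dots> \<le> K * ?l powr (1/2)" by (rule mult_right_mono[OF KA(2)]) simp
    finally show "C2 S n \<le> K * sqrt ?l" by (simp add: sl)
    have "c3 S n * ?R \<le> (C * ?l powr 1) * ?l powr (- (1/2) - 1 / (2 * omg S))"
      unfolding R using cn lp by (intro mult_right_mono) auto
    also have "\<dots> = C * ?l powr (1 + (- (1/2) - 1 / (2 * omg S)))" by (simp only: mult.assoc p)
    also have "\<dots> \<le> C * ?l powr (1/2)" using o C by (intro mult_left_mono m) (auto simp: field_simps)
    finally have a3: "c3 S n * ?R \<le> C * ?l powr (1/2)" .
    have "C3 S n \<le> A * (sqrt C * ?l powr (1/2)) + B * (C * ?l powr (1/2))"
      unfolding E3 using cn by (intro add_mono mult_left_mono a3 sq nn) auto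
    also have "\<dots> = (A * sqrt C + B * C) * ?l powr (1/2)" by (simp add: algebra_simps)
    also have "\<dots> \<le> K * ?l powr (1/2)" by (rule mult_right_mono[OF KA(1)]) simp
    finally have "?R * C3 S n \<le> ?R * (K * ?l powr (1/2))" by (rule mult_left_mono) simp
    also have "\<dots> = K * (?l powr (- (1/2) - 1 / (2 * omg S)) * ?l powr (1/2))" unfolding R by simp
    also have "\<dots> = K * ?l powr (- 1 / (2 * omg S))" unfolding p by simp
    finally show "?R * C3 S n \<le> K * ?l powr (- 1 / (2 * omg S))" .
    have "?l powr (1 / omg S) * (c4 S n * ?R) \<le> ?l powr (1 / omg S) * ((C * ?l powr 1) * ?l powr (- (1/2) - 1 / (2 * omg S)))"
      unfolding R using cn lp by (intro mult_left_mono mult_right_mono) auto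
    also have "\<dots> = C * (?l powr (1 / omg S) * (?l powr 1 * ?l powr (- (1/2) - 1 / (2 * omg S))))" by simp
    also have "\<dots> = C * ?l powr (1/2 + 1 / (2 * omg S))"
      unfolding p using o by (simp add: field_simps)
    finally have a4: "?l powr (1 / omg S) * (c4 S n * ?R) \<le> C * ?l powr (1/2 + 1 / (2 * omg S))" .
    have "sqrt (c4 S n) \<le> sqrt C * ?l powr (1/2)" using cn by (intro sq) auto
    also have "\<dots> \<le> sqrt C * ?l powr (1/2 + 1 / (2 * omg S))" using o C by (intro mult_left_mono m) auto
    finally have s4: "sqrt (c4 S n) \<le> sqrt C * ?l powr (1/2 + 1 / (2 * omg S))" .
    have "C4 S n \<le> A' * (sqrt C * ?l powr (1/2 + 1 / (2 * omg S))) + B * (T * (C * ?l powr (1/2 + 1 / (2 * omg S))))"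
      unfolding E4 by (intro add_mono mult_left_mono a4 s4 nn)
    also have "\<dots> = (A' * sqrt C + B * T * C) * ?l powr (1/2 + 1 / (2 * omg S))" by (simp add: algebra_simps)
    finally have "?R * C4 S n \<le> ?R * ((A' * sqrt C + B * T * C) * ?l powr (1/2 + 1 / (2 * omg S)))"
      by (rule mult_left_mono) simp
    also have "\<dots> = (A' * sqrt C + B * T * C) * (?l powr (- (1/2) - 1 / (2 * omg S)) * ?l powr (1/2 + 1 / (2 * omg S)))"
      unfolding R by simp
    also have "\<dots> = A' * sqrt C + B * T * C" unfolding p using l by simp
    finally show "C5 S n \<le> K" using KA(3) by (simp add: C5_def)
  qed
qed

lemma eventually_mult_le:
  fixes g :: "nat \<Rightarrow> real"
  assumes "(g \<longlongrightarrow> 0) sequentially" "0 < e"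
  shows "eventually (\<lambda>n. C * g n \<le> e) sequentially"
proof -
  have "((\<lambda>n. C * g n) \<longlongrightarrow> 0) sequentially" by (rule tendsto_mult_right_zero[OF assms(1)])
  from order_tendstoD(2)[OF this assms(2)] show ?thesis by (rule eventually_mono) simp
qed

lemma eventually_n0:
  assumes \<beta>: "0 < \<beta>"
  shows "eventually (\<lambda>n. max M 1 * hfrak S n powr \<beta> \<le> 1) sequentially"
    "eventually (\<lambda>n. max M 1 * (ln (real n) powr (1 / omg S) * hmin S n powr \<beta>) \<le> 1) sequentially"
proof -
  define q where "q = 1 / omg S"
  have q: "0 < q" using noise_params by (simp add: q_def)
  have "((\<lambda>n. sqrt (ln (real n) powr (1 + q) / real n) powr \<beta>) \<longlongrightarrow> 0) sequentially"
    using \<beta> q by real_asymp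
  then have "((\<lambda>n. hfrak S n powr \<beta>) \<longlongrightarrow> 0) sequentially" by (simp add: hfrak_def q_def)
  then show "eventually (\<lambda>n. max M 1 * hfrak S n powr \<beta> \<le> 1) sequentially"
    by (rule eventually_mult_le) simp
  have "((\<lambda>n. ln (real n) powr q * (ln (real n) powr (1 + 2 * q) / real n) powr \<beta>) \<longlongrightarrow> 0) sequentially"
    using \<beta> q by real_asymp
  then have "((\<lambda>n. ln (real n) powr (1 / omg S) * hmin S n powr \<beta>) \<longlongrightarrow> 0) sequentially"
    by (simp add: hmin_def q_def)
  then show "eventually (\<lambda>n. max M 1 * (ln (real n) powr (1 / omg S) * hmin S n powr \<beta>) \<le> 1) sequentially"
    by (rule eventually_mult_le) simp
qed

lemma eventually_n1: "eventually (\<lambda>n. (real n * (hfrak S n)\<^sup>2) powr (-1/2) * C3 S n \<le> 1/2) sequentially"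
proof -
  define q where "q = 1 / (2 * omg S)"
  have q: "0 < q" using noise_params by (simp add: q_def)
  obtain K where K: "\<And>n. 3 \<le> n \<Longrightarrow> (real n * (hfrak S n)\<^sup>2) powr (-1/2) * C3 S n \<le> K * ln (real n) powr (- 1 / (2 * omg S))"
    using constants_bounded by blast
  have "((\<lambda>n. ln (real n) powr (- q)) \<longlongrightarrow> 0) sequentially" using q by real_asymp
  from eventually_mult_le[OF this, of "1/2" K]
  have "eventually (\<lambda>n. K * ln (real n) powr (- q) \<le> 1/2) sequentially" by simp
  then show ?thesis using eventually_ge_at_top[of 3]
  proof eventually_elim
    case (elim n)
    then show ?case using K[of n] by (simp add: q_def)
  qed
qed

lemma eventually_large:
  assumes \<beta>: "0 < \<beta>"
  shows "eventually (large M \<beta>) sequentially"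
proof -
  define q where "q = 1 / omg S"
  have q: "0 < q" using noise_params by (simp add: q_def)
  have "((\<lambda>n. ln (real n) powr (1 + 2 * q) / real n) \<longlongrightarrow> 0) sequentially" using q by real_asymp
  then have "((\<lambda>n. hmin S n) \<longlongrightarrow> 0) sequentially" by (simp add: hmin_def q_def)
  from eventually_mult_le[OF this, of 1 1]
  have 1: "eventually (\<lambda>n. hmin S n \<le> 1) sequentially" by simp
  have "((\<lambda>n. sqrt (ln (real n) powr (1 + q) / real n)) \<longlongrightarrow> 0) sequentially" using q by real_asymp
  then have "((\<lambda>n. hfrak S n) \<longlongrightarrow> 0) sequentially" by (simp add: hfrak_def q_def)
  from eventually_mult_le[OF this, of 1 1]
  have 2: "eventually (\<lambda>n. hfrak S n \<le> 1) sequentially" by simp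
  define T where "T = ((4 * rexp S + 1) / Omg S) powr (1 / omg S)"
  \<comment> \<open>The net error is a power of \<open>ln n\<close> over \<open>n\<^sup>2\<close>,
    to be compared with \<open>1 / sqrt n\<close>.\<close>
  have "((\<lambda>n. ln (real n) powr q * (1 / (real n)\<^sup>2) * sqrt (real n)) \<longlongrightarrow> 0) sequentially" using q by real_asymp
  from eventually_mult_le[OF this, of 1 "2 * T * (16 * (lipK S)\<^sup>2) / glow S"]
  have 3: "eventually (\<lambda>n. 2 * T * (16 * (lipK S)\<^sup>2) / glow S * (ln (real n) powr q * (1 / (real n)\<^sup>2) * sqrt (real n)) \<le> 1) sequentially"
    by simp
  from 1 2 3 eventually_n0[OF \<beta>, of M] eventually_n1 eventually_ge_at_top[of 3]
  show ?thesis
  proof eventually_elim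
    case (elim n)
    note n = elim(7)
    have "2 * max 1 (tau S n) * mesh n / glow S
        = 2 * T * (16 * (lipK S)\<^sup>2) / glow S * (ln (real n) powr q * (1 / (real n)\<^sup>2))"
      using tau_ge_1[OF n] by (simp add: tau_eq[OF n] T_def q_def mult_ac)
    then have "2 * max 1 (tau S n) * mesh n / glow S * sqrt (real n) \<le> 1"
      using elim(3) by (simp only: mult.assoc)
    moreover have "real n powr (-1/2) = 1 / sqrt n" by (rule powr_neg_half) simp
    ultimately have "2 * max 1 (tau S n) * mesh n / glow S \<le> real n powr (-1/2)"
      using n by (simp add: le_divide_eq)
    then show ?case using elim c_lower[OF n] unfolding large_def by simp
  qed
qed

text \<open>Any admissible start at or below 2 would need the condition at \<open>n = 2\<close>. It
  fails there: \<open>ln 2 < 1\<close> makes the prefactor at least 1, and \<open>C3\<close> is at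
  least 1. From 3 on \<open>ln n\<close> is at least 1, as the bounds above require.\<close>

lemma n1_ge_3:
  shows "3 \<le> n1 S" 
proof -
  let ?P = "\<lambda>n. (real n * (hfrak S n)\<^sup>2) powr (-1/2) * C3 S n \<le> 1/2"
  obtain m where m: "\<And>n. m \<le> n \<Longrightarrow> ?P n" using eventually_n1 by (auto simp: eventually_sequentially)
  \<comment> \<open>Nonemptiness makes the infimum an element of the set.\<close>
  have "{m. 1 \<le> m \<and> (\<forall>n\<ge>m. ?P n)} \<noteq> {}" using m by (auto intro!: exI[of _ "max 1 m"])
  from Inf_nat_def1[OF this] have n1: "1 \<le> n1 S" "\<And>n. n1 S \<le> n \<Longrightarrow> ?P n" by (auto simp: n1_def)
  have l2: "0 < ln (2 :: real)" "ln (2 :: real) < 1"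
    using ln_less_self[of 2] ln_2_less_1 by auto
  have "\<not> ?P 2"
  proof -
    have "1 \<le> (real 2 * (hfrak S 2)\<^sup>2) powr (-1/2)"
    proof -
      have e: "real 2 * (hfrak S 2)\<^sup>2 = ln 2 powr (1 + 1 / omg S)" by (simp add: hfrak_square)
      have "ln 2 powr (1 + 1 / omg S) \<le> 1"
        using l2 noise_params by (intro powr_le1) auto
      then have "1 powr (-1/2) \<le> (ln 2 powr (1 + 1 / omg S)) powr (-1/2)"
        using l2 by (intro powr_mono2') auto
      then show ?thesis unfolding e by simp
    qed
    moreover have "1 \<le> C3 S 2"
    proof -
      have k: "1 \<le> 5 * lipK S * glow S powr (-1/2)"
        using glow_powr lipK_ge_2 by (intro const_factor_ge_1) auto
      then have "1 \<le> 4 * (5 * lipK S * glow S powr (-1/2))" by linarith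
      then have "0 \<le> ln (4 * (5 * lipK S * glow S powr (-1/2)))" by simp
      then have c: "1 \<le> c3 S 2" using r l2 by (simp add: c3_def mult_ac)
      have "1 * 1 * 1 * 1 * 1 \<le> 2 * sqrt 2 * glow S powr (-1/2) * (kernel_sup S)\<^sup>2 * sqrt (c3 S 2)"
        using glow_powr kernel_sup_ge_1 c by (intro mult_mono) auto
      moreover have "0 \<le> 8/3 * inverse (glow S) * (kernel_sup S)\<^sup>2 * c3 S 2 * (real 2 * (hfrak S 2)\<^sup>2) powr (-1/2)"
        using glow c by (intro mult_nonneg_nonneg) auto
      ultimately show ?thesis unfolding C3_def by linarith
    qed
    ultimately have "1 * 1 \<le> (real 2 * (hfrak S 2)\<^sup>2) powr (-1/2) * C3 S 2" by (intro mult_mono) auto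
    then show ?thesis by simp
  qed
  with n1(2)[of 2] have "\<not> n1 S \<le> 2" by blast
  then show ?thesis by simp
qed

end

section \<open>The good event\<close>

context procedure_setup
begin

lemma integral_kernel2: "(LBINT u. kernel2 S u) = 1"
proof -
  have int: "integrable lborel (kernel2 S)"
    using integrable_kernel2_times[of "\<lambda>_. 1" 1] by simp
  have "(LBINT u. kernel2 S u) = (LBINT b. LBINT a. kernel2 S (vector [a, b]))"
    by (rule lborel_integral_real2_swap[OF int])
  then show ?thesis using kernel_int by (simp add: kernel2_def)
qed

lemma integral_abs_kernel2: "(LBINT u. \<bar>kernel2 S u\<bar>) = (kernel_L1 S)\<^sup>2"
proof -
  have int: "integrable lborel (\<lambda>u. \<bar>kernel2 S u\<bar>)"
    using integrable_abs[OF integrable_kernel2_times[of "\<lambda>_. 1" 1]] by simp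
  have "(LBINT u. \<bar>kernel2 S u\<bar>) = (LBINT b. LBINT a. \<bar>kernel2 S (vector [a, b])\<bar>)"
    by (rule lborel_integral_real2_swap[OF int])
  then show ?thesis by (simp add: kernel2_def abs_mult kernel_L1_def power2_eq_square)
qed

end

text \<open>Separates the unknown scale \<open>L\<close> of the link from the empirical process of a
  normalised function.\<close>

lemma sum_linear_split:
  fixes a G Y \<epsilon>' :: "nat \<Rightarrow> real"
  assumes "\<And>i. i < n \<Longrightarrow> a i * Y i = L * (a i * G i) + a i * \<epsilon>' i"
  shows "(\<Sum>i<n. a i * Y i) / real n = L * ((\<Sum>i<n. a i * G i) / n) + (\<Sum>i<n. a i * \<epsilon>' i) / n"
proof -
  have "(\<Sum>i<n. a i * Y i) = (\<Sum>i<n. L * (a i * G i) + a i * \<epsilon>' i)" using assms by (intro sum.cong) auto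
  then show ?thesis by (simp add: sum.distrib sum_distrib_left add_divide_distrib)
qed

section \<open>The regression function on the square of evaluation points\<close>

locale single_index = regression S P X \<epsilon> p + link_setup S f M \<beta>
  for S :: procedure and P :: "'w measure" and X :: "nat \<Rightarrow> 'w \<Rightarrow> real^2" and \<epsilon> :: "nat \<Rightarrow> 'w \<Rightarrow> real"
    and p f :: "real \<Rightarrow> real" and M \<beta> :: real
begin

abbreviation obs :: "real^2 \<Rightarrow> nat \<Rightarrow> 'w \<Rightarrow> dataset" where
  "obs \<theta> n w \<equiv> sample X \<epsilon> (\<lambda>x. f (x \<bullet> \<theta>)) n w"

lemma abs_link_diff_le:
  assumes \<theta>: "norm \<theta> = 1" and d: "norm (x - v) \<le> h"
  shows "\<bar>f (x \<bullet> \<theta>) - f (v \<bullet> \<theta>)\<bar> \<le> M * h powr \<beta>"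
proof -
  have "\<bar>x \<bullet> \<theta> - v \<bullet> \<theta>\<bar> \<le> h"
    using Cauchy_Schwarz_ineq2[of "x - v" \<theta>] \<theta> d by (simp add: inner_diff_left)
  then have "M * \<bar>x \<bullet> \<theta> - v \<bullet> \<theta>\<bar> powr \<beta> \<le> M * h powr \<beta>"
    using M_nonneg \<beta> by (intro mult_left_mono powr_mono2) auto
  with f_holder[of "x \<bullet> \<theta>" "v \<bullet> \<theta>"] show ?thesis by simp
qed

lemma norm_le_half:
  assumes "\<And>i. \<bar>(y :: real^2)$i\<bar> \<le> h / 2"
  shows "norm y \<le> h"
proof -
  have "norm y \<le> (\<Sum>i\<in>UNIV. \<bar>y$i\<bar>)" by (rule norm_le_l1_cart)
  also have "\<dots> \<le> h" using assms[of 1] assms[of 2] by (simp add: sum_2)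
  finally show ?thesis .
qed

text \<open>A crude bias bound is enough here, since the weight at \<open>v\<close> sees only points
  within distance \<open>h\<close>. For \<open>h = hfrak\<close> the first condition of
  \<open>n0\<close> reduces it to the summand \<open>(kernel_L1 S)\<^sup>2\<close> of
  \<open>C5\<close>.\<close>

lemma scal_bias:
  assumes h: "0 < h" and \<theta>: "norm \<theta> = 1"
  shows "\<bar>(LBINT x. psi (scal h) v x * f (x \<bullet> \<theta>)) - f (v \<bullet> \<theta>)\<bar> \<le> (kernel_L1 S)\<^sup>2 * (M * h powr \<beta>)"
proof -
  define g where "g u = f ((v + h *\<^sub>R u) \<bullet> \<theta>)" for u :: "real^2"
  have [measurable]: "g \<in> borel_measurable borel" unfolding g_def by measurable
  have det: "0 < det (scal h)" using h by (simp add: det_scal)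
  have sv: "scal h *v x = (1 / h) *\<^sub>R x" for x by (simp add: vec_eq_iff forall_2 scal_mult)
  have g: "g (scal h *v (x - v)) = f (x \<bullet> \<theta>)" for x using h by (simp add: g_def sv)
  have ig: "integrable lborel (\<lambda>u. kernel2 S u * g u)"
    by (rule integrable_kernel2_times[where C = M]) (simp_all add: g_def f_bound)
  have ik: "integrable lborel (kernel2 S)"
    using integrable_kernel2_times[of "\<lambda>_. 1" 1] by simp
  have "(LBINT x. psi (scal h) v x * f (x \<bullet> \<theta>))
      = (LBINT x. det (scal h) * (kernel2 S (scal h *v (x - v)) * g (scal h *v (x - v))))"
    by (simp add: psi_def g mult.assoc)
  also have "\<dots> = (LBINT u. kernel2 S u * g u)"
    by (rule lborel_integral_linear_image[OF det, of "\<lambda>u. kernel2 S u * g u"]) measurable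
  finally have "(LBINT x. psi (scal h) v x * f (x \<bullet> \<theta>)) - f (v \<bullet> \<theta>)
      = (LBINT u. kernel2 S u * g u) - (LBINT u. kernel2 S u * f (v \<bullet> \<theta>))"
    by (simp add: integral_kernel2)
  also have "\<dots> = (LBINT u. kernel2 S u * g u - kernel2 S u * f (v \<bullet> \<theta>))"
    using ig ik by (intro Bochner_Integration.integral_diff[symmetric]) auto
  also have "\<bar>\<dots>\<bar> \<le> (LBINT u. \<bar>kernel2 S u * g u - kernel2 S u * f (v \<bullet> \<theta>)\<bar>)"
    by (rule integral_abs_bound)
  also have "\<dots> \<le> (LBINT u. \<bar>kernel2 S u\<bar> * (M * h powr \<beta>))"
  proof (rule integral_mono)
    show "integrable lborel (\<lambda>u. \<bar>kernel2 S u * g u - kernel2 S u * f (v \<bullet> \<theta>)\<bar>)" using ig ik by auto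
    show "integrable lborel (\<lambda>u. \<bar>kernel2 S u\<bar> * (M * h powr \<beta>))" using ik by auto
    fix u :: "real^2"
    show "\<bar>kernel2 S u * g u - kernel2 S u * f (v \<bullet> \<theta>)\<bar> \<le> \<bar>kernel2 S u\<bar> * (M * h powr \<beta>)"
    proof (cases "u \<in> cbox (vec (-1/2)) (vec (1/2))")
      case True
      then have "- (1/2) \<le> u$i \<and> u$i \<le> 1/2" for i by (simp add: mem_box_cart)
      then have "\<bar>u$i\<bar> \<le> 1 / 2" for i using abs_le_iff[of "u$i" "1/2"] by (simp add: minus_le_iff)
      then have "norm u \<le> 1" by (rule norm_le_half)
      then have "norm ((v + h *\<^sub>R u) - v) \<le> h" using h by (simp add: mult_left_le)
      from abs_link_diff_le[OF \<theta> this] show ?thesis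
        by (simp add: g_def abs_mult mult_left_mono flip: right_diff_distrib)
    next
      case False
      then show ?thesis using kernel2_eq_0 by simp
    qed
  qed
  also have "\<dots> = (kernel_L1 S)\<^sup>2 * (M * h powr \<beta>)"
    using integral_abs_kernel2 by simp
  finally show ?thesis .
qed

text \<open>The sup norm that \<open>Fhat_inf\<close> has to dominate.\<close>

definition link_sup :: "real^2 \<Rightarrow> real" where
  "link_sup \<theta> = (SUP x\<in>point_index. \<bar>f (x \<bullet> \<theta>)\<bar>)"

lemma le_link_sup: "x \<in> point_index \<Longrightarrow> \<bar>f (x \<bullet> \<theta>)\<bar> \<le> link_sup \<theta>"
  unfolding link_sup_def by (rule cSUP_upper) (auto intro!: bdd_aboveI2[where M = M] f_bound)

lemma point_index_nonempty: "point_index \<noteq> {}"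
proof -
  have "0 \<in> point_index" by (simp add: point_index_def mem_box_cart)
  then show ?thesis by blast
qed

lemma link_sup_bounds: "0 \<le> link_sup \<theta>" "link_sup \<theta> \<le> M"
proof -
  show "link_sup \<theta> \<le> M"
    unfolding link_sup_def by (rule cSUP_least[OF point_index_nonempty]) (rule f_bound)
  obtain x where "x \<in> point_index" using point_index_nonempty by blast
  from le_link_sup[OF this, of \<theta>] show "0 \<le> link_sup \<theta>" by linarith
qed

lemma sample_simps:
  "i < n \<Longrightarrow> fst (sample X \<epsilon> F n w i) = X i w"
  "i < n \<Longrightarrow> snd (sample X \<epsilon> F n w i) = F (X i w) + \<epsilon> i w"
  by (simp_all add: sample_def)

text \<open>The factorisation of the link is asked only where the weight is nonzero, because the
  normalised link is controlled only on the square.\<close>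

lemma Fhat_mat_sample:
  assumes G: "\<And>x. psi E v x \<noteq> 0 \<Longrightarrow> f (x \<bullet> \<theta>) = L * G x"
    and tr: "\<And>i. i < n \<Longrightarrow> \<epsilon>' i = \<epsilon> i w"
  shows "Fhat_mat S n (obs \<theta> n w) E v
    = L * (wmean n w E v (\<lambda>i. G (X i w)))
      + wmean n w E v (\<lambda>i. \<epsilon>' i)"
  unfolding Fhat_mat_psi
proof -
  have "(\<Sum>i<n. psi E v (fst (obs \<theta> n w i)) / design S (fst (obs \<theta> n w i)) *
          snd (obs \<theta> n w i))
      = (\<Sum>i<n. psi E v (X i w) / design S (X i w) * (f (X i w \<bullet> \<theta>) + \<epsilon> i w))"
    by (intro sum.cong) (simp_all add: sample_simps)
  moreover have "(\<Sum>i<n. psi E v (X i w) / design S (X i w) * (f (X i w \<bullet> \<theta>) + \<epsilon> i w)) / real n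
    = L * (wmean n w E v (\<lambda>i. G (X i w)))
      + wmean n w E v (\<lambda>i. \<epsilon>' i)"
  proof (rule sum_linear_split)
    fix i assume "i < n"
    then show "psi E v (X i w) / design S (X i w) * (f (X i w \<bullet> \<theta>) + \<epsilon> i w)
        = L * (psi E v (X i w) / design S (X i w) * G (X i w)) + psi E v (X i w) / design S (X i w) * \<epsilon>' i"
      using G[of "X i w"] tr[of i] by (cases "psi E v (X i w) = 0") (simp_all add: algebra_simps add_divide_distrib)
  qed
  ultimately show "(\<Sum>i<n. psi E v (fst (obs \<theta> n w i)) / design S (fst (obs \<theta> n w i)) *
          snd (obs \<theta> n w i)) / real n
    = L * (wmean n w E v (\<lambda>i. G (X i w)))
      + wmean n w E v (\<lambda>i. \<epsilon>' i)" by (simp only:)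
qed

lemma integral_psi_scaled:
  assumes G: "\<And>x. psi E v x \<noteq> 0 \<Longrightarrow> f (x \<bullet> \<theta>) = L * G x"
  shows "(LBINT x. psi E v x * f (x \<bullet> \<theta>)) = L * (LBINT x. psi E v x * G x)"
proof -
  have "psi E v x * f (x \<bullet> \<theta>) = L * (psi E v x * G x)" for x
    using G[of x] by (cases "psi E v x = 0") simp_all
  then show ?thesis by (simp only: integral_mult_right_zero)
qed

lemma Fhat_inf_eq:
  "Fhat_inf S n d = 2 * (SUP v\<in>point_index. \<bar>Fhat_mat S n d (scal (hfrak S n)) v\<bar>) + 2 * C5 S n"
  unfolding Fhat_inf_def Fhat_mat_psi point_index_def kernel2_hfrak_eq by simp

text \<open>Four deviation bounds cost 2 each and the truncation \<open>2 * Ups S\<close>, in units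
  of \<open>n powr (- 4 r)\<close>. The rest is deterministic. With \<open>L\<close> the sup norm
  and \<open>Q\<close> the empirical supremum, the pointwise error is at most
  \<open>L / 2 + C5\<close>; absorbing \<open>L / 2\<close> gives \<open>L \<le> 2 Q + 2 C5\<close>,
  which explains the two factors 2 in \<open>Fhat_inf\<close>.\<close>

lemma good_event:
  assumes La: "large M \<beta> n" and \<theta>: "norm \<theta> = 1" and t: "t \<in> cbox (vec (-1/2)) (vec (1/2))"
  shows "\<exists>B\<in>events. prob B \<le> (8 + 2 * Ups S) * real n powr (- 4 * rexp S) \<and>
    (\<forall>w\<in>space P - B.
      (\<forall>v \<eta>. \<eta> \<in> bandwidths S n \<longrightarrow> 1/2 \<le> norm v \<longrightarrow> norm v \<le> 1 \<longrightarrow>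
        \<bar>Fhat S n (obs \<theta> n w) v \<eta> t
          - smooth2 (\<eta> * (v \<bullet> \<theta>) / (norm v)\<^sup>2) (cross v \<theta> / (norm v)\<^sup>2) (t \<bullet> \<theta>)\<bar>
        \<le> (link_sup \<theta> * C1 S n + C2 S n) * (\<eta> * real n) powr (-1/2)) \<and>
      link_sup \<theta> \<le> Fhat_inf S n (obs \<theta> n w) \<and>
      Fhat_inf S n (obs \<theta> n w) \<le> 3 * M + 4 * C5 S n)"
proof -
  note n = large_D(1)[OF La]
  let ?L = "link_sup \<theta>" and ?h = "hfrak S n"
  note L0 = link_sup_bounds(1)[of \<theta>] and LM = link_sup_bounds(2)[of \<theta>]
  \<comment> \<open>If the supremum is zero, so is the link on the square, and division by zero
    returns the right value.\<close>
  define G where "G x = f (x \<bullet> \<theta>) / ?L" for x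
  \<comment> \<open>A weight at a point of the square may reach outside it, up to distance
    \<open>hfrak\<close>, where the link exceeds its supremum by at most
    \<open>M * hfrak powr \<beta> \<le> 1\<close>; hence the denominator
    \<open>?L + 1\<close>.\<close>
  define G2 where "G2 x = f (x \<bullet> \<theta>) / (?L + 1)" for x
  have [measurable]: "G \<in> borel_measurable borel" "G2 \<in> borel_measurable borel"
    unfolding G_def[abs_def] G2_def[abs_def] by measurable
  have Gb: "\<bar>G x\<bar> \<le> 1" if "x \<in> cbox (vec (-5/2)) (vec (5/2))" for x
    using le_link_sup[of x \<theta>] that L0 by (cases "?L = 0") (simp_all add: G_def point_index_def)
  have FG: "f (x \<bullet> \<theta>) = ?L * G x" if "x \<in> cbox (vec (-5/2)) (vec (5/2))" for x
    using le_link_sup[of x \<theta>] that by (cases "?L = 0") (simp_all add: G_def point_index_def)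
  note h = hfrak_pos[OF n] large_D(3)[OF La]
  have G2b: "\<bar>G2 x\<bar> \<le> 1" if v: "v \<in> point_index" and nz: "psi (scal ?h) v x \<noteq> 0" for v x
  proof -
    have "norm (x - v) \<le> ?h" by (rule norm_le_half) (rule psi_scal_support[OF h nz])
    from abs_link_diff_le[OF \<theta> this] have "\<bar>f (x \<bullet> \<theta>)\<bar> \<le> \<bar>f (v \<bullet> \<theta>)\<bar> + M * ?h powr \<beta>" by linarith
    moreover have "M * ?h powr \<beta> \<le> max M 1 * ?h powr \<beta>" by (rule mult_right_mono) auto
    ultimately have "\<bar>f (x \<bullet> \<theta>)\<bar> \<le> ?L + 1"
      using le_link_sup[OF v, of \<theta>] large_D(4)[OF La] by linarith
    then show ?thesis using L0 by (simp add: G2_def)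
  qed
  have FG2: "f (x \<bullet> \<theta>) = (?L + 1) * G2 x" for x using L0 by (simp add: G2_def)
  let ?q = "real n powr (- 4 * rexp S)"
  obtain B1 where B1: "B1 \<in> events" "prob B1 \<le> 2 * ?q" and d1: "\<And>w v \<eta>. w \<in> space P - B1 \<Longrightarrow> 1/2 \<le> norm v \<Longrightarrow> norm v \<le> 1 \<Longrightarrow> \<eta> \<in> bandwidths S n \<Longrightarrow>
      \<bar>wmean n w (E_single v \<eta>) t (\<lambda>i. G (X i w))
        - (LBINT x. psi (E_single v \<eta>) t x * G x)\<bar> \<le> C1 S n * (\<eta> * n) powr (-1/2)"
    using direction_design_deviation[OF La t, of G] Gb by auto
  obtain B2 where B2: "B2 \<in> events" "prob B2 \<le> 2 * ?q" and d2: "\<And>w v \<eta>. w \<in> space P - B2 \<Longrightarrow> 1/2 \<le> norm v \<Longrightarrow> norm v \<le> 1 \<Longrightarrow> \<eta> \<in> bandwidths S n \<Longrightarrow>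
      \<bar>wmean n w (E_single v \<eta>) t (\<lambda>i. trunc (tau S n) (\<epsilon> i w))\<bar> \<le> C2 S n * (\<eta> * n) powr (-1/2)"
    using direction_noise_deviation[OF La t] by auto
  obtain B3 where B3: "B3 \<in> events" "prob B3 \<le> 2 * ?q" and d3: "\<And>w v. w \<in> space P - B3 \<Longrightarrow> v \<in> point_index \<Longrightarrow>
      \<bar>wmean n w (scal ?h) v (\<lambda>i. G2 (X i w))
        - (LBINT x. psi (scal ?h) v x * G2 x)\<bar> \<le> (real n * ?h\<^sup>2) powr (-1/2) * C3 S n"
    using point_design_deviation[OF La, of G2] G2b by auto
  obtain B4 where B4: "B4 \<in> events" "prob B4 \<le> 2 * ?q" and d4: "\<And>w v. w \<in> space P - B4 \<Longrightarrow> v \<in> point_index \<Longrightarrow>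
      \<bar>wmean n w (scal ?h) v (\<lambda>i. trunc (tau S n) (\<epsilon> i w))\<bar> \<le> (real n * ?h\<^sup>2) powr (-1/2) * C4 S n"
    using point_noise_deviation[OF La] by auto
  obtain B5 where B5: "B5 \<in> events" "prob B5 \<le> 2 * Ups S * ?q"
    and d5: "\<And>w i. w \<in> space P - B5 \<Longrightarrow> i < n \<Longrightarrow> trunc (tau S n) (\<epsilon> i w) = \<epsilon> i w"
    using noise_truncation[OF n] by auto
  define B where "B = B1 \<union> B2 \<union> B3 \<union> B4 \<union> B5"
  have BM: "B \<in> events" using B1 B2 B3 B4 B5 by (simp add: B_def)
  have "prob B \<le> prob B1 + prob B2 + prob B3 + prob B4 + prob B5"
    unfolding B_def using B1(1) B2(1) B3(1) B4(1) B5(1)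
    by (intro order_trans[OF measure_Un_le] add_right_mono order_refl) auto
  also have "\<dots> \<le> 2 * ?q + 2 * ?q + 2 * ?q + 2 * ?q + 2 * Ups S * ?q"
    by (intro add_mono B1 B2 B3 B4 B5)
  also have "\<dots> = (8 + 2 * Ups S) * ?q" by (simp add: algebra_simps)
  finally have pB: "prob B \<le> (8 + 2 * Ups S) * ?q" .
  show ?thesis
  proof (intro bexI[OF _ BM] conjI pB ballI)
    fix w assume "w \<in> space P - B"
    then have w: "w \<in> space P - B1" "w \<in> space P - B2" "w \<in> space P - B3" "w \<in> space P - B4" "w \<in> space P - B5"
      by (auto simp: B_def)
    let ?d = "obs \<theta> n w"
    show "\<forall>v \<eta>. \<eta> \<in> bandwidths S n \<longrightarrow> 1/2 \<le> norm v \<longrightarrow> norm v \<le> 1 \<longrightarrow>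
        \<bar>Fhat S n ?d v \<eta> t - smooth2 (\<eta> * (v \<bullet> \<theta>) / (norm v)\<^sup>2) (cross v \<theta> / (norm v)\<^sup>2) (t \<bullet> \<theta>)\<bar>
        \<le> (?L * C1 S n + C2 S n) * (\<eta> * real n) powr (-1/2)"
    proof (intro allI impI)
      fix v :: "real^2" and \<eta> :: real
      assume \<eta>: "\<eta> \<in> bandwidths S n" and v: "1/2 \<le> norm v" "norm v \<le> 1"
      let ?E = "E_single v \<eta>" and ?R = "(\<eta> * real n) powr (-1/2)"
      have e: "(v, \<eta>) \<in> dir_index n" using v \<eta> by (simp add: dir_index_def)
      have G: "f (x \<bullet> \<theta>) = ?L * G x" if "psi ?E t x \<noteq> 0" for x
        by (rule FG) (rule psi_E_single_in_cube(1)[OF e n t, unfolded fst_conv snd_conv, OF that])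
      have v0: "v \<noteq> 0" using v by auto
      have s2: "smooth2 (\<eta> * (v \<bullet> \<theta>) / (norm v)\<^sup>2) (cross v \<theta> / (norm v)\<^sup>2) (t \<bullet> \<theta>) = ?L * (LBINT x. psi ?E t x * G x)"
        using integral_kernel2_link[OF bandwidths_pos[OF \<eta>] v0, of t \<theta>] integral_psi_scaled[OF G]
        by (simp add: psi_def)
      have F: "Fhat S n ?d v \<eta> t = ?L * (wmean n w ?E t (\<lambda>i. G (X i w)))
          + wmean n w ?E t (\<lambda>i. trunc (tau S n) (\<epsilon> i w))"
        unfolding Fhat_def by (rule Fhat_mat_sample[OF G d5[OF w(5)]])
      define a where "a = wmean n w ?E t (\<lambda>i. G (X i w))"
      define b where "b = wmean n w ?E t (\<lambda>i. trunc (tau S n) (\<epsilon> i w))"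
      define m where "m = (LBINT x. psi ?E t x * G x)"
      have "?L * \<bar>a - m\<bar> \<le> ?L * (C1 S n * ?R)"
        using d1[OF w(1) v \<eta>] L0 unfolding a_def m_def by (rule mult_left_mono)
      moreover have "\<bar>b\<bar> \<le> C2 S n * ?R" using d2[OF w(2) v \<eta>] unfolding b_def .
      moreover have "\<bar>?L * a + b - ?L * m\<bar> \<le> ?L * \<bar>a - m\<bar> + \<bar>b\<bar>"
      proof -
        have "?L * a + b - ?L * m = ?L * (a - m) + b" by (simp add: algebra_simps)
        also have "\<bar>\<dots>\<bar> \<le> \<bar>?L * (a - m)\<bar> + \<bar>b\<bar>" by (rule abs_triangle_ineq)
        finally show ?thesis using L0 by (simp add: abs_mult)
      qed
      ultimately have "\<bar>?L * a + b - ?L * m\<bar> \<le> ?L * (C1 S n * ?R) + C2 S n * ?R" by linarith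
      then show "\<bar>Fhat S n ?d v \<eta> t - smooth2 (\<eta> * (v \<bullet> \<theta>) / (norm v)\<^sup>2) (cross v \<theta> / (norm v)\<^sup>2) (t \<bullet> \<theta>)\<bar>
        \<le> (?L * C1 S n + C2 S n) * ?R"
        unfolding s2 F a_def b_def m_def by (simp only: distrib_right mult.assoc)
    qed
    \<comment> \<open>The three contributions are the design fluctuation, at most half of
      \<open>?L + 1\<close> by the condition of \<open>n1\<close>, the noise and the bias; apart
      from \<open>?L / 2\<close> they are the summands of \<open>C5\<close>.\<close>
    have A: "\<bar>Fhat_mat S n ?d (scal ?h) v - f (v \<bullet> \<theta>)\<bar> \<le> ?L / 2 + C5 S n" if v: "v \<in> point_index" for v
    proof -
      let ?E = "scal ?h" and ?R = "(real n * ?h\<^sup>2) powr (-1/2)"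
      define a where "a = wmean n w ?E v (\<lambda>i. G2 (X i w))"
      define b where "b = wmean n w ?E v (\<lambda>i. trunc (tau S n) (\<epsilon> i w))"
      define m where "m = (LBINT x. psi ?E v x * G2 x)"
      have F: "Fhat_mat S n ?d ?E v = (?L + 1) * a + b"
        unfolding a_def b_def by (rule Fhat_mat_sample[OF FG2 d5[OF w(5)]])
      have I: "(LBINT x. psi ?E v x * f (x \<bullet> \<theta>)) = (?L + 1) * m"
        unfolding m_def by (rule integral_psi_scaled[OF FG2])
      have "\<bar>a - m\<bar> \<le> 1/2"
        using d3[OF w(3) v] large_D(6)[OF La] unfolding a_def m_def by (rule order_trans)
      then have "(?L + 1) * \<bar>a - m\<bar> \<le> (?L + 1) * (1/2)" using L0 by (intro mult_left_mono) auto
      moreover have "\<bar>b\<bar> \<le> ?R * C4 S n" using d4[OF w(4) v] unfolding b_def .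
      moreover have "\<bar>(?L + 1) * m - f (v \<bullet> \<theta>)\<bar> \<le> (kernel_L1 S)\<^sup>2"
      proof -
        have "M * ?h powr \<beta> \<le> max M 1 * ?h powr \<beta>" by (rule mult_right_mono) auto
        then have "(kernel_L1 S)\<^sup>2 * (M * ?h powr \<beta>) \<le> (kernel_L1 S)\<^sup>2 * 1"
          using large_D(4)[OF La] by (intro mult_left_mono) auto
        with scal_bias[OF h(1) \<theta>, of v] show ?thesis unfolding I by linarith
      qed
      moreover have "\<bar>(?L + 1) * a + b - f (v \<bullet> \<theta>)\<bar> \<le> (?L + 1) * \<bar>a - m\<bar> + \<bar>b\<bar> + \<bar>(?L + 1) * m - f (v \<bullet> \<theta>)\<bar>"
      proof -
        have "(?L + 1) * a + b - f (v \<bullet> \<theta>) = (?L + 1) * (a - m) + b + ((?L + 1) * m - f (v \<bullet> \<theta>))"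
          by (simp add: algebra_simps)
        moreover have "\<bar>(?L + 1) * (a - m)\<bar> = (?L + 1) * \<bar>a - m\<bar>" using L0 by (simp add: abs_mult)
        ultimately show ?thesis by linarith
      qed
      ultimately have "\<bar>(?L + 1) * a + b - f (v \<bullet> \<theta>)\<bar> \<le> (?L + 1) * (1/2) + ?R * C4 S n + (kernel_L1 S)\<^sup>2"
        by linarith
      also have "\<dots> = ?L / 2 + C5 S n" by (simp add: C5_def)
      finally show ?thesis unfolding F .
    qed
    have bd: "bdd_above ((\<lambda>v. \<bar>Fhat_mat S n ?d (scal ?h) v\<bar>) ` point_index)"
    proof (rule bdd_aboveI2)
      fix v assume v: "v \<in> point_index"
      show "\<bar>Fhat_mat S n ?d (scal ?h) v\<bar> \<le> ?L + (?L / 2 + C5 S n)"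
        using A[OF v] le_link_sup[OF v, of \<theta>] by linarith
    qed
    define Q where "Q = (SUP v\<in>point_index. \<bar>Fhat_mat S n ?d (scal ?h) v\<bar>)"
    have "?L \<le> Q + (?L / 2 + C5 S n)"
      unfolding link_sup_def[of \<theta>]
    proof (rule cSUP_least[OF point_index_nonempty], fold link_sup_def)
      fix v assume v: "v \<in> point_index"
      have "\<bar>Fhat_mat S n ?d (scal ?h) v\<bar> \<le> Q" unfolding Q_def by (rule cSUP_upper[OF v bd])
      then show "\<bar>f (v \<bullet> \<theta>)\<bar> \<le> Q + (?L / 2 + C5 S n)" using A[OF v] by linarith
    qed
    then show "?L \<le> Fhat_inf S n ?d" unfolding Fhat_inf_eq Q_def[symmetric] by linarith
    \<comment> \<open>The reverse estimate keeps the random threshold of the right order: twice this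
      bound plus \<open>2 * C5\<close> is \<open>3 * ?L + 4 * C5\<close>.\<close>
    have "Q \<le> ?L + (?L / 2 + C5 S n)"
      unfolding Q_def
    proof (rule cSUP_least[OF point_index_nonempty])
      fix v assume v: "v \<in> point_index"
      show "\<bar>Fhat_mat S n ?d (scal ?h) v\<bar> \<le> ?L + (?L / 2 + C5 S n)"
        using A[OF v] le_link_sup[OF v, of \<theta>] by linarith
    qed
    then show "Fhat_inf S n ?d \<le> 3 * M + 4 * C5 S n"
      unfolding Fhat_inf_eq Q_def[symmetric] using LM by linarith
  qed
qed

end

section \<open>Moments and the risk bound\<close>

text \<open>Both summands of the norm are nonnegative extended reals, so each is at most
  \<open>M\<close>.\<close>

lemma link_class_D:
  assumes f: "f \<in> link_class \<beta> M"
  shows "\<bar>f y\<bar> \<le> M" "\<bar>f y - f z\<bar> \<le> M * \<bar>y - z\<bar> powr \<beta>"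
proof -
  let ?A = "SUP y. ereal \<bar>f y\<bar>"
  let ?H = "\<lambda>(y\<^sub>1, y\<^sub>2). ereal (\<bar>f y\<^sub>1 - f y\<^sub>2\<bar> / \<bar>y\<^sub>1 - y\<^sub>2\<bar> powr \<beta>)"
  let ?B = "SUP x \<in> {(y\<^sub>1 :: real, y\<^sub>2). y\<^sub>1 \<noteq> y\<^sub>2}. ?H x"
  have le: "?A + ?B \<le> ereal M" using f by (simp add: link_class_def)
  have A: "ereal \<bar>f y\<bar> \<le> ?A" for y by (rule SUP_upper) simp
  have B: "?H x \<le> ?B" if "fst x \<noteq> snd x" for x by (rule SUP_upper) (use that in auto)
  have A0: "0 \<le> ?A" using order_trans[OF _ A[of 0], of 0] by simp
  have B0: "0 \<le> ?B" using order_trans[OF _ B[of "(0, 1)"], of 0] by simp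
  have "?A \<le> ?A + ?B" using B0 by (simp add: ereal_le_add_self)
  from order_trans[OF A order_trans[OF this le]] show M: "\<bar>f y\<bar> \<le> M" for y by simp
  have "?B \<le> ?A + ?B" using A0 by (simp add: ereal_le_add_self2)
  note Bm = order_trans[OF this le]
  show "\<bar>f y - f z\<bar> \<le> M * \<bar>y - z\<bar> powr \<beta>"
  proof (cases "y = z")
    case True
    then show ?thesis using M[of 0] by simp
  next
    case False
    have "\<bar>f y - f z\<bar> / \<bar>y - z\<bar> powr \<beta> \<le> M"
      using order_trans[OF B[of "(y, z)"] Bm] False by simp
    moreover have "0 < \<bar>y - z\<bar> powr \<beta>" using False by simp
    ultimately show ?thesis by (simp add: divide_le_eq mult.commute)
  qed
qed

lemma risk_le:
  assumes r: "0 < r" and R: "0 \<le> R"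
    and le: "(\<integral>\<^sup>+w. ennreal (\<bar>T w - a\<bar> powr r) \<partial>P) \<le> ennreal (R powr r)"
  shows "risk P r T a \<le> ennreal R"
proof -
  let ?m = "\<integral>\<^sup>+w. ennreal (\<bar>T w - a\<bar> powr r) \<partial>P"
  have fin: "?m \<noteq> \<infinity>" using le by (auto simp: top_unique)
  have "enn2real ?m \<le> R powr r" using le by (simp add: enn2real_leI)
  then have "enn2real ?m powr (1 / r) \<le> (R powr r) powr (1 / r)"
    using r by (intro powr_mono2) auto
  also have "\<dots> = R" using r R by (simp add: powr_powr)
  finally show ?thesis using fin by (simp add: risk_def Let_def ennreal_leI)
qed

text \<open>\<open>x powr (r - 1)\<close> is increasing. The inequality merges bounds on two parts
  of the r-th moment into the r-th power of a sum, without loss of a constant.\<close>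

lemma powr_add_superadditive:
  fixes a b r :: real
  assumes "0 \<le> a" "0 \<le> b" "1 \<le> r"
  shows "a powr r + b powr r \<le> (a + b) powr r"
proof (cases "a + b = 0")
  case True
  then show ?thesis using assms by (simp add: add_nonneg_eq_0_iff)
next
  case False
  then have s: "0 < a + b" using assms by linarith
  have e: "x powr r = x * x powr (r - 1)" if "0 \<le> x" for x
    using that assms by (cases "x = 0") (simp_all add: powr_diff)
  have "a powr r + b powr r \<le> a * (a + b) powr (r - 1) + b * (a + b) powr (r - 1)"
    unfolding e[OF assms(1)] e[OF assms(2)]
    using assms by (intro add_mono mult_left_mono powr_mono2) auto
  also have "\<dots> = (a + b) powr r" using s e[of "a + b"] by (simp add: distrib_right)
  finally show ?thesis .
qed

lemma powr_add_le:
  fixes a b q :: real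
  assumes "0 \<le> a" "0 \<le> b" "0 \<le> q"
  shows "(a + b) powr q \<le> 2 powr q * (a powr q + b powr q)"
proof -
  have "(a + b) powr q \<le> (2 * max a b) powr q" using assms by (intro powr_mono2) auto
  also have "\<dots> = 2 powr q * max a b powr q" using assms by (simp add: powr_mult)
  also have "max a b powr q \<le> a powr q + b powr q" using assms by (auto simp: max_def)
  finally show ?thesis by (simp add: mult_left_mono)
qed

section \<open>An error bound valid outside the good event\<close>

context regression
begin

text \<open>Bandwidths are at least \<open>1 / (2 n)\<close>, so the weights are at most
  \<open>2 n\<close> times \<open>kernel_sup^2 / glow\<close>. One \<open>M\<close> accounts for the
  link in the data, the other for the estimated value.\<close>

definition crude :: "real \<Rightarrow> nat \<Rightarrow> 'w \<Rightarrow> real" where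
  "crude M n w = 2 * (kernel_sup S)\<^sup>2 / glow S * n * (2 * M + (\<Sum>i<n. \<bar>\<epsilon> i w\<bar>) / n)"

text \<open>The exponent \<open>2 r\<close> is that of the squared r-th power of the error, as the
  quadratic inequality on the failure event requires.\<close>

definition crude_moment :: "real \<Rightarrow> real" where
  "crude_moment M = (2 * (kernel_sup S)\<^sup>2 / glow S) powr (2 * rexp S)
     * (2 powr (2 * rexp S) * ((2 * M) powr (2 * rexp S) + moment_bound S (2 * rexp S)))"

lemma crude_measurable [measurable]: "crude M n \<in> borel_measurable P"
  unfolding crude_def[abs_def] by measurable

lemma crude_nonneg: "0 \<le> M \<Longrightarrow> 0 \<le> crude M n w"
  unfolding crude_def using glow by (intro mult_nonneg_nonneg add_nonneg_nonneg divide_nonneg_nonneg sum_nonneg) auto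

lemma crude_moment_nonneg: "0 \<le> crude_moment M"
  unfolding crude_moment_def using moment_bound_nonneg[OF noise_params(1,2,4)] by simp

text \<open>The mean of the \<open>\<bar>\<epsilon> i\<bar>\<close> is at most their maximum, and a
  power of the maximum at most the sum of the powers; this sum costs one factor \<open>n\<close>
  beyond \<open>n powr (2 r)\<close>.\<close>

lemma nn_integral_crude:
  assumes M: "0 \<le> M" and n: "1 \<le> n"
  shows "(\<integral>\<^sup>+w. ennreal (crude M n w powr (2 * rexp S)) \<partial>P) \<le> ennreal (crude_moment M * real n powr (2 * rexp S + 1))"
proof -
  let ?q = "2 * rexp S" and ?A = "2 * (kernel_sup S)\<^sup>2 / glow S" and ?m = "moment_bound S (2 * rexp S)"
  have q: "0 \<le> ?q" using r by simp
  have A: "0 \<le> ?A" using glow by simp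
  have m: "0 \<le> ?m" by (rule moment_bound_nonneg[OF noise_params(1,2,4)])
  define c where "c = (?A * n) powr ?q * 2 powr ?q"
  have c: "0 \<le> c" by (simp add: c_def)
  have pt: "crude M n w powr ?q \<le> (\<Sum>i<n. c * ((2 * M) powr ?q + \<bar>\<epsilon> i w\<bar> powr ?q))" for w
  proof -
    obtain j where j: "j < n" "(\<Sum>i<n. \<bar>\<epsilon> i w\<bar>) / n \<le> \<bar>\<epsilon> j w\<bar>"
    proof -
      have "0 \<in> {..<n}" using n by simp
      then have ne: "{..<n} \<noteq> {}" by blast
      define mx where "mx = Max ((\<lambda>i. \<bar>\<epsilon> i w\<bar>) ` {..<n})"
      have "mx \<in> (\<lambda>i. \<bar>\<epsilon> i w\<bar>) ` {..<n}" unfolding mx_def using ne by (intro Max_in) auto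
      then obtain j where j: "j < n" "mx = \<bar>\<epsilon> j w\<bar>" by auto
      have "(\<Sum>i<n. \<bar>\<epsilon> i w\<bar>) \<le> (\<Sum>i<n. mx)" by (intro sum_mono) (simp add: mx_def)
      then have "(\<Sum>i<n. \<bar>\<epsilon> i w\<bar>) / n \<le> mx" using n by (simp add: divide_le_eq mult.commute)
      with j that show thesis by simp
    qed
    have "crude M n w \<le> ?A * n * (2 * M + \<bar>\<epsilon> j w\<bar>)"
      unfolding crude_def using j A by (intro mult_left_mono add_left_mono mult_nonneg_nonneg) auto
    then have "crude M n w powr ?q \<le> (?A * n * (2 * M + \<bar>\<epsilon> j w\<bar>)) powr ?q"
      using crude_nonneg[OF M] q by (intro powr_mono2) auto
    also have "\<dots> = (?A * n) powr ?q * (2 * M + \<bar>\<epsilon> j w\<bar>) powr ?q"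
      by (rule powr_mult)
    also have "\<dots> \<le> (?A * n) powr ?q * (2 powr ?q * ((2 * M) powr ?q + \<bar>\<epsilon> j w\<bar> powr ?q))"
      using M q by (intro mult_left_mono powr_add_le) auto
    also have "\<dots> = c * ((2 * M) powr ?q + \<bar>\<epsilon> j w\<bar> powr ?q)" by (simp add: c_def)
    also have "\<dots> = (\<Sum>i\<in>{j}. c * ((2 * M) powr ?q + \<bar>\<epsilon> i w\<bar> powr ?q))" by simp
    also have "\<dots> \<le> (\<Sum>i<n. c * ((2 * M) powr ?q + \<bar>\<epsilon> i w\<bar> powr ?q))"
      using j c by (intro sum_mono2) auto
    finally show ?thesis .
  qed
  have mom: "(\<integral>\<^sup>+w. ennreal (\<bar>\<epsilon> i w\<bar> powr ?q) \<partial>P) \<le> ennreal ?m" for i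
  proof -
    have "(\<integral>\<^sup>+w. ennreal (\<bar>\<epsilon> i w\<bar> powr ?q) \<partial>P) = (\<integral>\<^sup>+u. ennreal (\<bar>u\<bar> powr ?q) \<partial>distr P lborel (\<epsilon> i))"
      by (subst nn_integral_distr) auto
    also have "\<dots> \<le> ennreal ?m"
      unfolding distr_eps by (rule noise_moment[OF eps_class eps_sym noise_params(1,2,4) q])
    finally show ?thesis .
  qed
  have one: "(\<integral>\<^sup>+w. ennreal (c * ((2 * M) powr ?q + \<bar>\<epsilon> i w\<bar> powr ?q)) \<partial>P) \<le> ennreal (c * ((2 * M) powr ?q + ?m))" for i
  proof -
    have "(\<integral>\<^sup>+w. ennreal (c * ((2 * M) powr ?q + \<bar>\<epsilon> i w\<bar> powr ?q)) \<partial>P)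
        = (\<integral>\<^sup>+w. ennreal c * (ennreal ((2 * M) powr ?q) + ennreal (\<bar>\<epsilon> i w\<bar> powr ?q)) \<partial>P)"
      using c by (intro nn_integral_cong) (simp add: ennreal_mult)
    also have "\<dots> = ennreal c * (ennreal ((2 * M) powr ?q) + (\<integral>\<^sup>+w. ennreal (\<bar>\<epsilon> i w\<bar> powr ?q) \<partial>P))"
      by (simp add: nn_integral_cmult nn_integral_add emeasure_space_1)
    also have "\<dots> \<le> ennreal c * (ennreal ((2 * M) powr ?q) + ennreal ?m)"
      by (intro mult_left_mono add_left_mono mom) simp
    also have "\<dots> = ennreal (c * ((2 * M) powr ?q + ?m))" using c m by (simp add: ennreal_mult)
    finally show ?thesis .
  qed
  have "(\<integral>\<^sup>+w. ennreal (crude M n w powr ?q) \<partial>P) \<le> (\<integral>\<^sup>+w. (\<Sum>i<n. ennreal (c * ((2 * M) powr ?q + \<bar>\<epsilon> i w\<bar> powr ?q))) \<partial>P)"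
  proof (rule nn_integral_mono)
    fix w
    have "ennreal (crude M n w powr ?q) \<le> ennreal (\<Sum>i<n. c * ((2 * M) powr ?q + \<bar>\<epsilon> i w\<bar> powr ?q))"
      by (rule ennreal_leI[OF pt])
    then show "ennreal (crude M n w powr ?q) \<le> (\<Sum>i<n. ennreal (c * ((2 * M) powr ?q + \<bar>\<epsilon> i w\<bar> powr ?q)))"
      using c by (subst sum_ennreal) auto
  qed
  also have "\<dots> = (\<Sum>i<n. \<integral>\<^sup>+w. ennreal (c * ((2 * M) powr ?q + \<bar>\<epsilon> i w\<bar> powr ?q)) \<partial>P)"
    by (rule nn_integral_sum) measurable
  also have "\<dots> \<le> (\<Sum>i<n. ennreal (c * ((2 * M) powr ?q + ?m)))" by (intro sum_mono one)
  also have "\<dots> = ennreal (n * (c * ((2 * M) powr ?q + ?m)))"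
    using c m by (simp add: ennreal_mult ennreal_of_nat_eq_real_of_nat)
  also have "n * (c * ((2 * M) powr ?q + ?m)) = crude_moment M * real n powr (?q + 1)"
  proof -
    have "(?A * n) powr ?q = ?A powr ?q * real n powr ?q" by (rule powr_mult)
    moreover have "real n powr (?q + 1) = real n powr ?q * n" using n by (simp add: powr_add)
    ultimately show ?thesis by (simp add: c_def crude_moment_def)
  qed
  finally show ?thesis .
qed

text \<open>Minimality of the selected pair is available exactly where the density is positive at
  the design points.\<close>

lemma design_positive_AE: "AE w in P. \<forall>i<n. 0 < design S (X i w)"
proof -
  have "AE w in P. 0 < design S (X i w)" for i
  proof -
    have "AE x in density lborel (\<lambda>x. ennreal (design S x)). 0 < design S x"
    proof (subst AE_density)
      show "AE x in lborel. 0 < ennreal (design S x) \<longrightarrow> 0 < design S x"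
      proof (intro AE_I2 impI)
        fix x assume "0 < ennreal (design S x)"
        then have "design S x \<noteq> 0" by auto
        then show "0 < design S x" using design_nonneg by (simp add: less_le)
      qed
    qed measurable
    then have "AE x in distr P lborel (X i). 0 < design S x"
      by (simp only: distributed_distr_eq_density[OF X_dens[rule_format]])
    then show ?thesis by (subst (asm) AE_distr_iff) auto
  qed
  then have "AE w in P. \<forall>i. 0 < design S (X i w)" by (simp add: AE_all_countable)
  then show ?thesis by (rule AE_mp) auto
qed

end

section \<open>Risk bounds at a given sample size\<close>

context single_index
begin

lemma minimizer_D:
  fixes \<theta> :: "real^2"
  assumes sel: "measurable_minimizer S n t sel" and pos: "\<forall>i<n. 0 < design S (X i w)"
  defines "d \<equiv> obs \<theta> n w"
  shows "norm (fst (sel d)) = 1" "snd (sel d) \<in> bandwidths S n"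
    "\<And>\<nu> h. norm \<nu> = 1 \<Longrightarrow> h \<in> bandwidths S n \<Longrightarrow>
      criterion S n d t (fst (sel d)) (snd (sel d)) \<le> criterion S n d t \<nu> h"
proof -
  have "d \<in> space (PiM {..<n} (\<lambda>_. borel))" by (simp add: d_def sample_def space_PiM)
  moreover have "\<forall>i<n. 0 < design S (fst (d i))" using pos by (simp add: d_def sample_def)
  ultimately have "sel d \<in> sphere 0 1 \<times> bandwidths S n \<and>
      (\<forall>(\<theta>, h) \<in> sphere 0 1 \<times> bandwidths S n. criterion S n d t (fst (sel d)) (snd (sel d)) \<le> criterion S n d t \<theta> h)"
    using sel unfolding measurable_minimizer_def by blast
  then show "norm (fst (sel d)) = 1" "snd (sel d) \<in> bandwidths S n"
    "\<And>\<nu> h. norm \<nu> = 1 \<Longrightarrow> h \<in> bandwidths S n \<Longrightarrow>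
      criterion S n d t (fst (sel d)) (snd (sel d)) \<le> criterion S n d t \<nu> h"
    by (auto simp: mem_Times_iff)
qed

lemma Fhat_crude:
  assumes n: "3 \<le> n" and t: "t \<in> cbox (vec (-1/2)) (vec (1/2))"
    and v: "norm v = 1" and \<eta>: "\<eta> \<in> bandwidths S n"
  shows "\<bar>Fhat S n (obs \<theta> n w) v \<eta> t - f y\<bar> \<le> crude M n w"
proof -
  let ?d = "obs \<theta> n w" and ?E = "E_single v \<eta>"
  define A where "A = 2 * (kernel_sup S)\<^sup>2 / glow S * n"
  have e: "(v, \<eta>) \<in> dir_index n" using v \<eta> by (simp add: dir_index_def)
  have A1: "1 \<le> A"
  proof -
    have "1 \<le> (kernel_sup S)\<^sup>2" by (rule one_le_power[OF kernel_sup_ge_1])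
    then have "glow S \<le> 2 * (kernel_sup S)\<^sup>2" using glow by linarith
    then have "1 \<le> 2 * (kernel_sup S)\<^sup>2 / glow S" using glow by (simp add: le_divide_eq)
    then have "1 * 1 \<le> 2 * (kernel_sup S)\<^sup>2 / glow S * n" using n by (intro mult_mono) auto
    then show ?thesis by (simp add: A_def)
  qed
  have psi: "\<bar>psi ?E t x / design S x\<bar> \<le> A" for x
  proof -
    have "\<bar>psi ?E t x / design S x\<bar> \<le> 1 / \<eta> * (kernel_sup S)\<^sup>2 / glow S"
    proof (rule weight_bound)
      show "x \<in> cube" if "psi ?E t x \<noteq> 0" for x
        using psi_E_single_in_cube(2)[OF e n t] that by simp
      show "\<bar>psi ?E t x\<bar> \<le> 1 / \<eta> * (kernel_sup S)\<^sup>2"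
        using det_dir_index[OF e n] by (intro abs_psi_le) auto
    qed
    also have "\<dots> = 1 / \<eta> * ((kernel_sup S)\<^sup>2 / glow S)" by simp
    also have "\<dots> \<le> (2 * n) * ((kernel_sup S)\<^sup>2 / glow S)"
    proof (rule mult_right_mono)
      show "1 / \<eta> \<le> real (2 * n)" using bandwidth_bounds[OF n \<eta>] n by (simp add: field_simps)
    qed (use glow in auto)
    finally show ?thesis by (simp add: A_def mult_ac)
  qed
  have Y: "\<bar>snd (?d i)\<bar> \<le> M + \<bar>\<epsilon> i w\<bar>" if "i < n" for i
    using f_bound[of "X i w \<bullet> \<theta>"] that by (simp add: sample_simps)
  have "\<bar>\<Sum>i<n. psi ?E t (fst (?d i)) / design S (fst (?d i)) * snd (?d i)\<bar> \<le> (\<Sum>i<n. A * (M + \<bar>\<epsilon> i w\<bar>))"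
  proof (rule order_trans[OF sum_abs sum_mono])
    fix i assume "i \<in> {..<n}"
    then show "\<bar>psi ?E t (fst (?d i)) / design S (fst (?d i)) * snd (?d i)\<bar> \<le> A * (M + \<bar>\<epsilon> i w\<bar>)"
      using psi Y[of i] A1 unfolding abs_mult[of _ "snd (?d i)"] by (intro mult_mono) auto
  qed
  also have "\<dots> = A * (n * M + (\<Sum>i<n. \<bar>\<epsilon> i w\<bar>))" by (simp add: sum_distrib_left[symmetric] sum.distrib)
  finally have "\<bar>\<Sum>i<n. psi ?E t (fst (?d i)) / design S (fst (?d i)) * snd (?d i)\<bar> / n
      \<le> A * (n * M + (\<Sum>i<n. \<bar>\<epsilon> i w\<bar>)) / n" by (rule divide_right_mono) simp
  then have "\<bar>Fhat S n ?d v \<eta> t\<bar> \<le> A * (n * M + (\<Sum>i<n. \<bar>\<epsilon> i w\<bar>)) / n"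
    by (simp add: Fhat_def Fhat_mat_psi)
  also have "\<dots> = A * (M + (\<Sum>i<n. \<bar>\<epsilon> i w\<bar>) / n)" using n by (simp add: field_simps)
  finally have "\<bar>Fhat S n ?d v \<eta> t\<bar> \<le> A * (M + (\<Sum>i<n. \<bar>\<epsilon> i w\<bar>) / n)" .
  moreover have "\<bar>f y\<bar> \<le> A * M" using f_bound[of y] mult_right_mono[OF A1 M_nonneg] by simp
  ultimately have "\<bar>Fhat S n ?d v \<eta> t - f y\<bar> \<le> A * (M + (\<Sum>i<n. \<bar>\<epsilon> i w\<bar>) / n) + A * M" by linarith
  also have "\<dots> = crude M n w" unfolding crude_def A_def[symmetric] by (simp add: algebra_simps)
  finally show ?thesis .
qed

text \<open>For finitely many \<open>n\<close> any finite bound serves.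
  \<open>x \<le> 1 + x\<^sup>2\<close> leads to the moment of order \<open>2 r\<close>, and a number
  that is at least 1 is below its r-th power, which gives the form needed by
  \<open>risk_le\<close>.\<close>

lemma risk_small_n:
  assumes n: "3 \<le> n" and t: "t \<in> cbox (vec (-1/2)) (vec (1/2))" and sel: "measurable_minimizer S n t sel"
  shows "risk P (rexp S) (\<lambda>w. selected_estimator S n sel (obs \<theta> n w) t) (f y)
    \<le> ennreal (1 + crude_moment M * real n powr (2 * rexp S + 1))"
proof (rule risk_le)
  let ?T = "\<lambda>w. selected_estimator S n sel (obs \<theta> n w) t"
  let ?Q = "crude_moment M * real n powr (2 * rexp S + 1)"
  have Q: "0 \<le> ?Q" using crude_moment_nonneg by simp
  show "0 < rexp S" using r by simp
  show "0 \<le> 1 + ?Q" using Q by simp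
  have "(\<integral>\<^sup>+w. ennreal (\<bar>?T w - f y\<bar> powr rexp S) \<partial>P) \<le> (\<integral>\<^sup>+w. ennreal 1 + ennreal (crude M n w powr (2 * rexp S)) \<partial>P)"
  proof (rule nn_integral_mono_AE)
    show "AE w in P. ennreal (\<bar>?T w - f y\<bar> powr rexp S) \<le> ennreal 1 + ennreal (crude M n w powr (2 * rexp S))"
      using design_positive_AE[of n]
    proof eventually_elim
      case (elim w)
      note m = minimizer_D[OF sel elim, where \<theta> = \<theta>]
      have c0: "0 \<le> crude M n w" by (rule crude_nonneg[OF M_nonneg])
      have "\<bar>?T w - f y\<bar> \<le> crude M n w"
        unfolding selected_estimator_def by (rule Fhat_crude[OF n t m(1,2)])
      then have "\<bar>?T w - f y\<bar> powr rexp S \<le> crude M n w powr rexp S" using r by (intro powr_mono2) auto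
      also have "\<dots> \<le> 1 + crude M n w powr (2 * rexp S)"
      proof -
        define x where "x = crude M n w powr rexp S"
        have "crude M n w powr (2 * rexp S) = x * x" by (simp add: x_def powr_add[symmetric])
        moreover have "x \<le> 1 + x * x"
        proof -
          have "x * 2 \<le> 1 + x * x" using zero_le_square[of "x - 1"] by (simp add: algebra_simps)
          moreover have "0 \<le> x" by (simp add: x_def)
          ultimately show ?thesis by linarith
        qed
        ultimately show ?thesis by (simp add: x_def)
      qed
      finally have "ennreal (\<bar>?T w - f y\<bar> powr rexp S) \<le> ennreal (1 + crude M n w powr (2 * rexp S))"
        by (rule ennreal_leI)
      also have "\<dots> = ennreal 1 + ennreal (crude M n w powr (2 * rexp S))" by (rule ennreal_plus) auto
      finally show ?case .
    qed
  qed
  also have "\<dots> = 1 + (\<integral>\<^sup>+w. ennreal (crude M n w powr (2 * rexp S)) \<partial>P)"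
    by (subst nn_integral_add) (auto simp: emeasure_space_1)
  also have "\<dots> \<le> 1 + ennreal ?Q"
    using n by (intro add_left_mono nn_integral_crude M_nonneg) auto
  also have "\<dots> = ennreal (1 + ?Q)" using Q by simp
  also have "\<dots> \<le> ennreal ((1 + ?Q) powr rexp S)"
    using Q r powr_mono[of 1 "rexp S" "1 + ?Q"] by (intro ennreal_leI) simp
  finally show "(\<integral>\<^sup>+w. ennreal (\<bar>?T w - f y\<bar> powr rexp S) \<partial>P) \<le> ennreal ((1 + ?Q) powr rexp S)" .
qed

text \<open>\<open>C1\<close> and \<open>C2\<close> are of order \<open>sqrt (ln n)\<close> and
  \<open>Fhat_inf\<close> is bounded; replacing \<open>h\<close> by \<open>H\<close>, where
  \<open>h \<ge> H / 4\<close>, costs a factor 2 under the root.\<close>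

lemma TH_le:
  assumes n: "3 \<le> n" and K: "0 \<le> K"
    and C: "0 \<le> C1 S n" "C1 S n \<le> K * sqrt (ln (real n))" "C2 S n \<le> K * sqrt (ln (real n))" "C5 S n \<le> K"
    and F: "0 \<le> Fhat_inf S n d" "Fhat_inf S n d \<le> 3 * M + 4 * C5 S n"
    and h: "0 < H" "H / 4 \<le> h"
  shows "TH S n d h \<le> 4 * ((kernel_sup S)\<^sup>2 + (3 * M + 4 * K) * K + K) * (ln (real n) / (real n * H)) powr (1/2)"
proof -
  let ?s = "sqrt (ln (real n))" and ?\<kappa> = "(kernel_sup S)\<^sup>2"
  have l: "0 \<le> ln (real n)" using ln_ge_1[OF n] by simp
  have "Fhat_inf S n d * C1 S n \<le> (3 * M + 4 * K) * (K * ?s)"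
    using C F M_nonneg K by (intro mult_mono) auto
  then have a: "?\<kappa> * ?s + Fhat_inf S n d * C1 S n + C2 S n \<le> (?\<kappa> + (3 * M + 4 * K) * K + K) * ?s"
    using C(3) by (simp add: algebra_simps)
  have R: "(h * real n) powr (-1/2) \<le> 2 / sqrt (real n * H)"
  proof -
    have "(h * real n) powr (-1/2) \<le> (H / 4 * real n) powr (-1/2)"
      using h n by (intro powr_mono2' mult_right_mono) auto
    also have "\<dots> = 1 / sqrt (H / 4 * real n)" using h by (intro powr_neg_half) auto
    also have "\<dots> = 2 / sqrt (real n * H)" by (simp add: real_sqrt_mult real_sqrt_divide mult.commute)
    finally show ?thesis .
  qed
  have "TH S n d h \<le> 2 * ((?\<kappa> + (3 * M + 4 * K) * K + K) * ?s) * (2 / sqrt (real n * H))"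
    unfolding TH_def using a R M_nonneg K l
    by (intro mult_mono mult_left_mono) auto
  also have "\<dots> = 4 * (?\<kappa> + (3 * M + 4 * K) * K + K) * (?s / sqrt (real n * H))" by simp
  also have "?s / sqrt (real n * H) = (ln (real n) / (real n * H)) powr (1/2)"
    using l h by (simp add: powr_half_sqrt real_sqrt_divide)
  finally show ?thesis .
qed

text \<open>The constant is \<open>28 = 7 * 4\<close>: the thresholds of the oracle inequality times
  the constant of \<open>TH_le\<close>.\<close>

lemma risk_large_n:
  assumes La: "large M \<beta> n" and \<theta>: "norm \<theta> = 1" and t: "t \<in> cbox (vec (-1/2)) (vec (1/2))"
    and sel: "measurable_minimizer S n t sel"
    and K: "0 \<le> K" and C: "0 \<le> C1 S n" "C1 S n \<le> K * sqrt (ln (real n))" "0 \<le> C2 S n"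
      "C2 S n \<le> K * sqrt (ln (real n))" "C5 S n \<le> K"
  shows "risk P (rexp S) (\<lambda>w. selected_estimator S n sel (obs \<theta> n w) t) (f (t \<bullet> \<theta>))
    \<le> ennreal (28 * ((kernel_sup S)\<^sup>2 + (3 * M + 4 * K) * K + K) * (ln (real n) / (real n * h_star S n f (t \<bullet> \<theta>))) powr (1/2)
      + (crude_moment M + (8 + 2 * Ups S)) powr (1 / rexp S) * real n powr (-1/2))"
proof (rule risk_le)
  let ?T = "\<lambda>w. selected_estimator S n sel (obs \<theta> n w) t"
  let ?y = "f (t \<bullet> \<theta>)" and ?r = "rexp S"
  note n = large_D(1)[OF La]
  define Q where "Q = crude_moment M + (8 + 2 * Ups S)"
  define G where "G = 28 * ((kernel_sup S)\<^sup>2 + (3 * M + 4 * K) * K + K) * (ln (real n) / (real n * h_star S n f (t \<bullet> \<theta>))) powr (1/2)"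
  define H where "H = Q powr (1 / ?r) * real n powr (-1/2)"
  have G0: "0 \<le> G" using M_nonneg K by (auto simp: G_def intro!: mult_nonneg_nonneg)
  have H0: "0 \<le> H" by (simp add: H_def)
  have Q0: "0 \<le> Q" using crude_moment_nonneg[of M] noise_params by (simp add: Q_def)
  show "0 < ?r" using r by simp
  show "0 \<le> 28 * ((kernel_sup S)\<^sup>2 + (3 * M + 4 * K) * K + K) * (ln (real n) / (real n * h_star S n f (t \<bullet> \<theta>))) powr (1/2)
      + (crude_moment M + (8 + 2 * Ups S)) powr (1 / rexp S) * real n powr (-1/2)"
    using G0 H0 by (simp add: G_def H_def Q_def)
  obtain B where B: "B \<in> events" "prob B \<le> (8 + 2 * Ups S) * real n powr (- 4 * ?r)"
    and good: "\<And>w. w \<in> space P - B \<Longrightarrow>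
      (\<forall>v \<eta>. \<eta> \<in> bandwidths S n \<longrightarrow> 1/2 \<le> norm v \<longrightarrow> norm v \<le> 1 \<longrightarrow>
        \<bar>Fhat S n (obs \<theta> n w) v \<eta> t
          - smooth2 (\<eta> * (v \<bullet> \<theta>) / (norm v)\<^sup>2) (cross v \<theta> / (norm v)\<^sup>2) (t \<bullet> \<theta>)\<bar>
        \<le> (link_sup \<theta> * C1 S n + C2 S n) * (\<eta> * real n) powr (-1/2)) \<and>
      link_sup \<theta> \<le> Fhat_inf S n (obs \<theta> n w) \<and>
      Fhat_inf S n (obs \<theta> n w) \<le> 3 * M + 4 * C5 S n"
    using good_event[OF La \<theta> t] by (elim bexE conjE) (rule that, auto)
  \<comment> \<open>The exponent balances both failure terms:
    \<open>\<alpha> * n powr (2 r + 1)\<close> is at most \<open>n powr (- r / 2)\<close> because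
    \<open>r \<ge> 1\<close>, and \<open>n powr (- 4 r) / \<alpha>\<close> equals that power, whose
    r-th root is \<open>n powr (-1/2)\<close>.\<close>
  define \<alpha> where "\<alpha> = real n powr (- (7/2) * ?r)"
  have \<alpha>: "0 < \<alpha>" using n by (simp add: \<alpha>_def)
  have [measurable]: "B \<in> events" by fact
  have "(\<integral>\<^sup>+w. ennreal (\<bar>?T w - ?y\<bar> powr ?r) \<partial>P)
      \<le> (\<integral>\<^sup>+w. ennreal (G powr ?r) + (ennreal \<alpha> * ennreal (crude M n w powr (2 * ?r)) + ennreal (1 / \<alpha>) * indicator B w) \<partial>P)"
  proof (rule nn_integral_mono_AE)
    show "AE w in P. ennreal (\<bar>?T w - ?y\<bar> powr ?r)
      \<le> ennreal (G powr ?r) + (ennreal \<alpha> * ennreal (crude M n w powr (2 * ?r)) + ennreal (1 / \<alpha>) * indicator B w)"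
      using design_positive_AE[of n] AE_space
    proof eventually_elim
      case (elim w)
      note m = minimizer_D[OF sel elim(1), where \<theta> = \<theta>]
      let ?d = "obs \<theta> n w"
      show ?case
      proof (cases "w \<in> B")
        case True
        have "\<bar>?T w - ?y\<bar> \<le> crude M n w"
          unfolding selected_estimator_def by (rule Fhat_crude[OF n t m(1,2)])
        then have "\<bar>?T w - ?y\<bar> powr ?r \<le> crude M n w powr ?r" using r by (intro powr_mono2) auto
        also have "\<dots> \<le> \<alpha> * crude M n w powr (2 * ?r) + 1 / \<alpha>"
        proof -
          define x where "x = crude M n w powr ?r"
          have x: "0 \<le> x" by (simp add: x_def)
          have "crude M n w powr (2 * ?r) = x * x" by (simp add: x_def powr_add[symmetric])
          moreover have "x \<le> \<alpha> * (x * x) + 1 / \<alpha>"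
          proof -
            have "0 \<le> (\<alpha> * x - 1)\<^sup>2" by simp
            then have "2 * (\<alpha> * x) \<le> \<alpha> * \<alpha> * (x * x) + 1" by (simp add: power2_eq_square algebra_simps)
            then have "\<alpha> * x \<le> \<alpha> * \<alpha> * (x * x) + 1" using \<alpha> x mult_nonneg_nonneg[of \<alpha> x] by linarith
            then have "\<alpha> * x / \<alpha> \<le> (\<alpha> * \<alpha> * (x * x) + 1) / \<alpha>" using \<alpha> by (intro divide_right_mono) auto
            then show ?thesis using \<alpha> by (simp add: add_divide_distrib)
          qed
          ultimately show ?thesis by (simp add: x_def)
        qed
        finally have "ennreal (\<bar>?T w - ?y\<bar> powr ?r) \<le> ennreal (\<alpha> * crude M n w powr (2 * ?r) + 1 / \<alpha>)"
          by (rule ennreal_leI)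
        also have "\<dots> = ennreal \<alpha> * ennreal (crude M n w powr (2 * ?r)) + ennreal (1 / \<alpha>) * indicator B w"
          using \<alpha> True by (simp add: ennreal_mult[symmetric])
        also have "\<dots> \<le> ennreal (G powr ?r) + (ennreal \<alpha> * ennreal (crude M n w powr (2 * ?r)) + ennreal (1 / \<alpha>) * indicator B w)"
          by (rule add_increasing) auto
        finally show ?thesis .
      next
        case False
        then have "w \<in> space P - B" using elim(2) by simp
        note g = good[OF this]
        have "\<exists>h\<in>bandwidths S n. h_star S n f (t \<bullet> \<theta>) / 4 \<le> h \<and>
            \<bar>Fhat S n ?d (fst (sel ?d)) (snd (sel ?d)) t - f (t \<bullet> \<theta>)\<bar> \<le> 7 * TH S n ?d h"
          by (rule oracle_inequality[OF n large_D(5)[OF La] large_D(2)[OF La] \<theta> _ link_sup_bounds(1) _ C(1,3) m(1,2)])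
            (use g m(3) in auto)
        then obtain h where h: "h \<in> bandwidths S n" "h_star S n f (t \<bullet> \<theta>) / 4 \<le> h"
          "\<bar>?T w - ?y\<bar> \<le> 7 * TH S n ?d h" unfolding selected_estimator_def by blast
        have hs: "0 < h_star S n f (t \<bullet> \<theta>)"
          using oracle_bandwidth(1)[OF n large_D(5)[OF La] large_D(2)[OF La], of "t \<bullet> \<theta>"] hmin_pos[of n] n by simp
        have Fi: "0 \<le> Fhat_inf S n ?d" using g link_sup_bounds(1)[of \<theta>] by linarith
        define Z where "Z = ((kernel_sup S)\<^sup>2 + (3 * M + 4 * K) * K + K) * (ln (real n) / (real n * h_star S n f (t \<bullet> \<theta>))) powr (1/2)"
        have "TH S n ?d h \<le> 4 * Z"
          using TH_le[OF n K C(1,2,4,5) Fi _ hs h(2)] g by (simp only: Z_def mult.assoc)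
        moreover have "G = 28 * Z" by (simp only: G_def Z_def mult.assoc)
        ultimately have "7 * TH S n ?d h \<le> G" by linarith
        then have "\<bar>?T w - ?y\<bar> powr ?r \<le> G powr ?r" using h(3) r by (intro powr_mono2) auto
        then have "ennreal (\<bar>?T w - ?y\<bar> powr ?r) \<le> ennreal (G powr ?r)" by (rule ennreal_leI)
        also have "\<dots> \<le> ennreal (G powr ?r) + (ennreal \<alpha> * ennreal (crude M n w powr (2 * ?r)) + ennreal (1 / \<alpha>) * indicator B w)"
          by simp
        finally show ?thesis .
      qed
    qed
  qed
  also have "\<dots> = ennreal (G powr ?r) + (ennreal \<alpha> * (\<integral>\<^sup>+w. ennreal (crude M n w powr (2 * ?r)) \<partial>P) + ennreal (1 / \<alpha>) * emeasure P B)"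
    by (subst nn_integral_add, measurable, subst nn_integral_add, measurable)
      (simp add: nn_integral_cmult emeasure_space_1 nn_integral_cmult_indicator)
  also have "\<dots> \<le> ennreal (G powr ?r) + (ennreal \<alpha> * ennreal (crude_moment M * real n powr (2 * ?r + 1))
      + ennreal (1 / \<alpha>) * ennreal ((8 + 2 * Ups S) * real n powr (- 4 * ?r)))"
    using n B(2) by (intro add_left_mono add_mono mult_left_mono nn_integral_crude M_nonneg)
      (auto simp: emeasure_eq_measure intro: ennreal_leI)
  also have "\<dots> = ennreal (G powr ?r + (\<alpha> * (crude_moment M * real n powr (2 * ?r + 1)) + 1 / \<alpha> * ((8 + 2 * Ups S) * real n powr (- 4 * ?r))))"
    using \<alpha> crude_moment_nonneg[of M] noise_params
    by (simp add: ennreal_mult[symmetric] ennreal_plus[symmetric] del: ennreal_plus)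
  \<comment> \<open>\<open>H powr r\<close> is exactly the bound on the two failure terms, so
    superadditivity finishes the estimate.\<close>
  also have "\<dots> \<le> ennreal ((G + H) powr ?r)"
  proof (rule ennreal_leI)
    have "\<alpha> * (crude_moment M * real n powr (2 * ?r + 1)) = crude_moment M * (real n powr (- (7/2) * ?r) * real n powr (2 * ?r + 1))"
      by (simp add: \<alpha>_def)
    also have "\<dots> = crude_moment M * real n powr (- (7/2) * ?r + (2 * ?r + 1))" by (simp only: powr_add)
    also have "\<dots> \<le> crude_moment M * real n powr (- (1/2) * ?r)"
      using n r crude_moment_nonneg[of M] by (intro mult_left_mono powr_mono) auto
    finally have 1: "\<alpha> * (crude_moment M * real n powr (2 * ?r + 1)) \<le> crude_moment M * real n powr (- (1/2) * ?r)" .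
    have "1 / \<alpha> = real n powr ((7/2) * ?r)" by (simp add: \<alpha>_def powr_minus field_simps)
    then have "1 / \<alpha> * ((8 + 2 * Ups S) * real n powr (- 4 * ?r)) = (8 + 2 * Ups S) * (real n powr ((7/2) * ?r) * real n powr (- 4 * ?r))"
      by simp
    also have "\<dots> = (8 + 2 * Ups S) * real n powr ((7/2) * ?r + (- 4 * ?r))" by (simp only: powr_add)
    finally have 2: "1 / \<alpha> * ((8 + 2 * Ups S) * real n powr (- 4 * ?r)) = (8 + 2 * Ups S) * real n powr (- (1/2) * ?r)"
      by simp
    have "H powr ?r = (Q powr (1 / ?r)) powr ?r * (real n powr (-1/2)) powr ?r" unfolding H_def by (rule powr_mult)
    also have "\<dots> = Q * real n powr (- (1/2) * ?r)" using r Q0 by (simp add: powr_powr)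
    finally have 3: "H powr ?r = crude_moment M * real n powr (- (1/2) * ?r) + (8 + 2 * Ups S) * real n powr (- (1/2) * ?r)"
      by (simp add: Q_def distrib_right)
    show "G powr ?r + (\<alpha> * (crude_moment M * real n powr (2 * ?r + 1)) + 1 / \<alpha> * ((8 + 2 * Ups S) * real n powr (- 4 * ?r))) \<le> (G + H) powr ?r"
      using powr_add_superadditive[OF G0 H0 r] 1 2 3 by linarith
  qed
  finally show "(\<integral>\<^sup>+w. ennreal (\<bar>?T w - ?y\<bar> powr ?r) \<partial>P) \<le> ennreal ((28 * ((kernel_sup S)\<^sup>2 + (3 * M + 4 * K) * K + K)
      * (ln (real n) / (real n * h_star S n f (t \<bullet> \<theta>))) powr (1/2)
      + (crude_moment M + (8 + 2 * Ups S)) powr (1 / rexp S) * real n powr (-1/2)) powr ?r)"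
    by (simp only: G_def H_def Q_def)
qed

end

theorem theorem1:
  fixes S :: procedure
    and \<beta>\<^sub>0 M :: real
    and P :: "'w measure"
    and X :: "nat \<Rightarrow> 'w \<Rightarrow> real^2"
    and \<epsilon> :: "nat \<Rightarrow> 'w \<Rightarrow> real"
    and p :: "real \<Rightarrow> real"
  assumes r: "1 \<le> rexp S"
    and beta: "0 < \<beta>\<^sub>0" "\<beta>\<^sub>0 < 1"
    and M: "0 < M"
    and noise_params: "0 < Ups S" "0 < Omg S" "Omg S \<le> 1" "0 < omg S"
    and kernel_sym: "\<forall>u. kern S (- u) = kern S u"
    and kernel_supp: "closure {u. kern S u \<noteq> 0} \<subseteq> {-1/2..1/2}"
    and kernel_int: "(LBINT u. kern S u) = 1"
    and kernel_lip: "0 < lipK S" "\<forall>u v. \<bar>kern S u - kern S v\<bar> \<le> lipK S * \<bar>u - v\<bar>"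
    and glow: "0 < glow S" "glow S < 1"
    and design_nonneg: "\<forall>x. 0 \<le> design S x"
    and design_low: "glow S \<le> (INF x\<in>cbox (vec (-3)) (vec 3). design S x)"
    and prob: "prob_space P"
    and X_dens: "\<forall>i. distributed P lborel (X i) (\<lambda>x. ennreal (design S x))"
    and X_indep: "prob_space.indep_vars P (\<lambda>_. borel) X UNIV"
    and eps_dens: "\<forall>i. distributed P lborel (\<epsilon> i) (\<lambda>x. ennreal (p x))"
    and eps_class: "p \<in> noise_class S"
    and eps_sym: "symmetric_law (density lborel (\<lambda>x. ennreal (p x)))"
    and eps_centered: "\<forall>i. has_bochner_integral P (\<epsilon> i) 0"
    and eps_indep: "prob_space.indep_vars P (\<lambda>_. borel) \<epsilon> UNIV"
    and X_eps_indep: "prob_space.indep_set P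
          (sets (vimage_algebra (space P) (\<lambda>w i. X i w) (PiM UNIV (\<lambda>_. borel))))
          (sets (vimage_algebra (space P) (\<lambda>w i. \<epsilon> i w) (PiM UNIV (\<lambda>_. borel))))"
  shows "\<exists>a>0. \<exists>b>0.
    \<forall>f \<in> link_class \<beta>\<^sub>0 M. \<forall>\<theta>s \<in> sphere (0 :: real^2) 1. \<forall>n \<ge> max (n0 S \<beta>\<^sub>0 M) (n1 S).
    \<forall>t \<in> cbox (vec (-1/2)) (vec (1/2)). \<forall>sel. measurable_minimizer S n t sel \<longrightarrow>
      risk P (rexp S)
        (\<lambda>w. selected_estimator S n sel (sample X \<epsilon> (\<lambda>x. f (x \<bullet> \<theta>s)) n w) t) (f (t \<bullet> \<theta>s))
      \<le> ennreal (a * (ln (real n) / (real n * h_star S n f (t \<bullet> \<theta>s))) powr (1/2)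
                 + b * real n powr (-1/2))"
proof -
  interpret prob_space P by (rule prob)
  interpret regression S P X \<epsilon> p
    by (intro regression.intro regression_axioms.intro procedure_setup.intro prob_space_axioms)
      (fact r noise_params kernel_sym kernel_supp kernel_int kernel_lip glow design_nonneg design_low
        X_dens X_indep eps_dens eps_class eps_sym eps_indep X_eps_indep)+
  \<comment> \<open>\<open>N0\<close>, \<open>K\<close> and the constants below depend on
    \<open>S\<close>, \<open>\<beta>\<^sub>0\<close> and \<open>M\<close> only; they are fixed
    before the link, the direction, \<open>n\<close> and \<open>t\<close>.\<close>
  obtain N0 where N0: "\<And>n. N0 \<le> n \<Longrightarrow> large M \<beta>\<^sub>0 n"
    using eventually_large[OF beta(1), of M] by (auto simp: eventually_sequentially)
  obtain K where K: "0 \<le> K" and KC: "\<And>n. 3 \<le> n \<Longrightarrow> 0 \<le> C1 S n \<and> C1 S n \<le> K * sqrt (ln (real n)) \<and> 0 \<le> C2 S n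
      \<and> C2 S n \<le> K * sqrt (ln (real n)) \<and> C5 S n \<le> K"
    using constants_bounded by blast
  define a where "a = 28 * ((kernel_sup S)\<^sup>2 + (3 * M + 4 * K) * K + K)"
  define b1 where "b1 = (crude_moment M + (8 + 2 * Ups S)) powr (1 / rexp S)"
  \<comment> \<open>Covers \<open>n < N0\<close>: the crude bound increases with \<open>n\<close>,
    and \<open>sqrt N0 * n powr (-1/2)\<close> is at least 1.\<close>
  define b2 where "b2 = (1 + crude_moment M * real N0 powr (2 * rexp S + 1)) * sqrt N0"
  have "1 \<le> (kernel_sup S)\<^sup>2" using one_le_power[OF kernel_sup_ge_1, of 2] .
  moreover have "0 \<le> (3 * M + 4 * K) * K" using M K by simp
  ultimately have a: "0 < a" using K by (simp add: a_def)
  have b12: "0 \<le> b1" "0 \<le> b2" using crude_moment_nonneg[of M] by (simp_all add: b1_def b2_def)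
  show ?thesis
  proof (rule exI[of _ a], rule conjI[OF a], rule exI[of _ "b1 + b2 + 1"], intro conjI ballI allI impI)
    \<comment> \<open>\<open>b1\<close> and \<open>b2\<close> are known to be nonnegative; the
      summand 1 makes the constant strictly positive.\<close>
    show "0 < b1 + b2 + 1" using b12 by linarith
    fix f \<theta>s n t sel
    assume f: "f \<in> link_class \<beta>\<^sub>0 M" and th: "\<theta>s \<in> sphere (0 :: real^2) 1" and nn: "max (n0 S \<beta>\<^sub>0 M) (n1 S) \<le> n"
      and t: "t \<in> cbox (vec (-1/2)) (vec (1/2) :: real^2)" and sel: "measurable_minimizer S n t sel"
    interpret link_setup S f M \<beta>\<^sub>0
      by unfold_locales (use link_class_D[OF f] beta in auto)
    interpret single_index S P X \<epsilon> p f M \<beta>\<^sub>0 ..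
    have \<theta>: "norm \<theta>s = 1" using th by simp
    have n: "3 \<le> n" using n1_ge_3 nn by simp
    let ?lead = "a * (ln (real n) / (real n * h_star S n f (t \<bullet> \<theta>s))) powr (1/2)"
    have lead: "0 \<le> ?lead" using a by simp
    have pn: "0 \<le> real n powr (-1/2)" by simp
    show "risk P (rexp S) (\<lambda>w. selected_estimator S n sel (sample X \<epsilon> (\<lambda>x. f (x \<bullet> \<theta>s)) n w) t) (f (t \<bullet> \<theta>s))
      \<le> ennreal (?lead + (b1 + b2 + 1) * real n powr (-1/2))"
    proof (cases "N0 \<le> n")
      case True
      have "risk P (rexp S) (\<lambda>w. selected_estimator S n sel (sample X \<epsilon> (\<lambda>x. f (x \<bullet> \<theta>s)) n w) t) (f (t \<bullet> \<theta>s))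
          \<le> ennreal (?lead + b1 * real n powr (-1/2))"
        unfolding a_def b1_def using KC[OF n] by (intro risk_large_n[OF N0[OF True] \<theta> t sel K]) auto
      also have "\<dots> \<le> ennreal (?lead + (b1 + b2 + 1) * real n powr (-1/2))"
        using b12 pn by (intro ennreal_leI add_left_mono mult_right_mono) auto
      finally show ?thesis .
    next
      case False
      have "1 + crude_moment M * real n powr (2 * rexp S + 1) \<le> b2 * real n powr (-1/2)"
      proof -
        have s: "real n powr (-1/2) = 1 / sqrt n" by (rule powr_neg_half) simp
        have "1 \<le> sqrt N0 * (1 / sqrt n)" using False n by (simp add: le_divide_eq)
        moreover have "1 + crude_moment M * real n powr (2 * rexp S + 1) \<le> 1 + crude_moment M * real N0 powr (2 * rexp S + 1)"
          using False r crude_moment_nonneg[of M] by (intro add_left_mono mult_left_mono powr_mono2) auto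
        ultimately have "(1 + crude_moment M * real n powr (2 * rexp S + 1)) * 1
            \<le> (1 + crude_moment M * real N0 powr (2 * rexp S + 1)) * (sqrt N0 * (1 / sqrt n))"
          using crude_moment_nonneg[of M] by (intro mult_mono) auto
        then show ?thesis unfolding b2_def s by simp
      qed
      also have "\<dots> \<le> ?lead + (b1 + b2 + 1) * real n powr (-1/2)"
        using lead mult_nonneg_nonneg[OF b12(1) pn] pn by (simp add: distrib_right)
      finally have "ennreal (1 + crude_moment M * real n powr (2 * rexp S + 1)) \<le> ennreal (?lead + (b1 + b2 + 1) * real n powr (-1/2))"
        by (rule ennreal_leI)
      with risk_small_n[OF n t sel] show ?thesis by (rule order_trans)
    qed
  qed
qed

end
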